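(* Let $G$ be a 2-connected bipartite graph (with at least three vertices). Then the following are equivalent: (i) the edge ring $\Bbbk[G]$ is pseudo-Gorenstein; (ii) $\phi(G)=1$; (iii) $G$ is matching-covered.
   Context: All graphs are finite, with no loops and no multiple edges. $\Bbbk$ is an algebraically closed field of characteristic $0$. For a graph $G$ on $[d]=\{1,\ldots,d\}$, the edge ring is $\Bbbk[G]=\Bbbk[t_it_j:\{i,j\}\in E(G)]\subset\Bbbk[t_1,\ldots,t_d]$, graded by $\deg(t_it_j)=1$ for every edge. (For bipartite $G$ it is normal and Cohen--Macaulay.) For a Cohen--Macaulay standard graded domain $R=\bigoplus_{k\ge 0}R_k$ with $R_0=\Bbbk$ and Krull dimension $D$, write $\sum_{k\ge0}(\dim_\Bbbk R_k)t^k=\dfrac{h_0+\cdots+h_st^s}{(1-t)^D}$ with $h_s\ne0$. $R$ is pseudo-Gorenstein if $h_s=1$. A connected graph is 2-connected if deleting any one vertex leaves a connected graph. An (open) ear decomposition of a 2-connected graph $G$ is an expression $G=C\cup P_1\cup\cdots\cup P_r$ where $C$ is a cycle, each $P_i$ is a path (with two distinct end vertices), and $(C\cup P_1\cup\cdots\cup P_{i-1})\cap P_i$ consists exactly of the two end vertices of $P_i$, for each $i$. $\phi(G)$ denotes the minimum, over all ear decompositions of $G$, of the number of members of $C,P_1,\ldots,P_r$ having an even number of edges (the initial cycle $C$ is counted if it has even length). A graph is matching-covered if it is connected and each of its edges is contained in some perfect matching. *)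

theory Defs
  imports
    "HOL-Library.Poly_Mapping"
    "HOL-Library.Extended_Nat"
    "HOL-Computational_Algebra.Computational_Algebra"
    "HOL-Algebra.Algebra"
    "HOL-Algebra.Algebraic_Closure_Type"
begin

section \<open>Finite simple graphs\<close>

type_synonym 'v graph = "'v set \<times> 'v set set"

abbreviation verts :: "'v graph \<Rightarrow> 'v set" where "verts \<equiv> fst"
abbreviation edges :: "'v graph \<Rightarrow> 'v set set" where "edges \<equiv> snd"

definition simple_graph :: "'v graph \<Rightarrow> bool" where
  "simple_graph G \<longleftrightarrow> finite (verts G) \<and> (\<forall>e\<in>edges G. e \<subseteq> verts G \<and> card e = 2)"

definition connected_graph :: "'v graph \<Rightarrow> bool" where
  "connected_graph G \<longleftrightarrow> verts G \<noteq> {} \<and>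
     (\<forall>u\<in>verts G. \<forall>v\<in>verts G. (u, v) \<in> {(x, y). {x, y} \<in> edges G}\<^sup>*)"

definition delete_vertex :: "'v graph \<Rightarrow> 'v \<Rightarrow> 'v graph" where
  "delete_vertex G v = (verts G - {v}, {e \<in> edges G. v \<notin> e})"

definition two_connected :: "'v graph \<Rightarrow> bool" where
  "two_connected G \<longleftrightarrow> connected_graph G \<and> (\<forall>v\<in>verts G. connected_graph (delete_vertex G v))"

definition bipartite :: "'v graph \<Rightarrow> bool" where
  "bipartite G \<longleftrightarrow> (\<exists>A B. A \<union> B = verts G \<and> A \<inter> B = {} \<and>
     (\<forall>e\<in>edges G. \<exists>a\<in>A. \<exists>b\<in>B. e = {a, b}))"

definition perfect_matching :: "'v graph \<Rightarrow> 'v set set \<Rightarrow> bool" where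
  "perfect_matching G M \<longleftrightarrow> M \<subseteq> edges G \<and> (\<forall>v\<in>verts G. \<exists>!e. e \<in> M \<and> v \<in> e)"

definition matching_covered :: "'v graph \<Rightarrow> bool" where
  "matching_covered G \<longleftrightarrow>
     connected_graph G \<and> (\<forall>e\<in>edges G. \<exists>M. perfect_matching G M \<and> e \<in> M)"


section \<open>Ear decompositions\<close>

definition is_cycle :: "'v graph \<Rightarrow> bool" where
  "is_cycle C \<longleftrightarrow> (\<exists>xs. distinct xs \<and> length xs \<ge> 3 \<and> verts C = set xs \<and>
     edges C = {{xs ! i, xs ! (Suc i mod length xs)} | i. i < length xs})"

text \<open>\<open>is_path P u v\<close>: the graph \<open>P\<close> is a path with the two distinct end vertices \<open>u\<close> and \<open>v\<close>.\<close>

definition is_path :: "'v graph \<Rightarrow> 'v \<Rightarrow> 'v \<Rightarrow> bool" where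
  "is_path P u v \<longleftrightarrow> (\<exists>xs. distinct xs \<and> length xs \<ge> 2 \<and> hd xs = u \<and> last xs = v \<and>
     verts P = set xs \<and> edges P = {{xs ! i, xs ! Suc i} | i. Suc i < length xs})"

definition graph_Union :: "'v graph list \<Rightarrow> 'v graph" where
  "graph_Union Hs = (\<Union>H\<in>set Hs. verts H, \<Union>H\<in>set Hs. edges H)"

definition graph_inter :: "'v graph \<Rightarrow> 'v graph \<Rightarrow> 'v graph" where
  "graph_inter G H = (verts G \<inter> verts H, edges G \<inter> edges H)"

text \<open>
  The intersection of each ear with the union of its predecessors is taken as a graph: it has the
  two end vertices of the ear and no edges. Hence an ear of length one is a new edge.
\<close>

definition ear_decomposition :: "'v graph \<Rightarrow> 'v graph \<Rightarrow> 'v graph list \<Rightarrow> bool" where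
  "ear_decomposition G C Ps \<longleftrightarrow>
     is_cycle C \<and> G = graph_Union (C # Ps) \<and>
     (\<forall>i<length Ps. \<exists>u v. is_path (Ps ! i) u v \<and>
        graph_inter (graph_Union (C # take i Ps)) (Ps ! i) = ({u, v}, {}))"

definition even_members :: "'v graph list \<Rightarrow> nat" where
  "even_members Hs = length (filter (\<lambda>H. even (card (edges H))) Hs)"

text \<open>The minimum is meaningful only for graphs that have an ear decomposition.\<close>

definition phi :: "'v graph \<Rightarrow> nat" where
  "phi G = (LEAST n. \<exists>C Ps. ear_decomposition G C Ps \<and> even_members (C # Ps) = n)"


section \<open>Krull dimension and the pseudo-Gorenstein property\<close>

definition krull_dim :: "('a, 'm) ring_scheme \<Rightarrow> enat" where
  "krull_dim R = Sup {enat n | n. \<exists>P :: nat \<Rightarrow> 'a set.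
     (\<forall>i\<le>n. primeideal (P i) R) \<and> (\<forall>i<n. P i \<subset> P (Suc i))}"

definition hilbert_series ::
    "('k::field \<Rightarrow> 'a::ab_group_add \<Rightarrow> 'a) \<Rightarrow> (nat \<Rightarrow> 'a set) \<Rightarrow> rat fps" where
  "hilbert_series scale A = Abs_fps (\<lambda>k. of_nat (vector_space.dim scale (A k)))"

text \<open>
  For a Cohen--Macaulay standard graded domain \<open>R\<close> over a field that acts by \<open>scale\<close>, with
  homogeneous components \<open>A k\<close>: the \<open>h\<close>-polynomial, read off with respect to the Krull dimension
  of \<open>R\<close>, has leading coefficient 1. The Cohen--Macaulay property belongs to the class of rings
  for which the notion is introduced and is not a conjunct of the condition; the edge ring of every
  bipartite graph is in this class.
\<close>

definition pseudo_gorenstein ::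
    "('k::field \<Rightarrow> 'a::ab_group_add \<Rightarrow> 'a) \<Rightarrow> ('a, 'm) ring_scheme \<Rightarrow> (nat \<Rightarrow> 'a set) \<Rightarrow> bool" where
  "pseudo_gorenstein scale R A \<longleftrightarrow>
     (\<exists>D (h :: rat poly). krull_dim R = enat D \<and>
        hilbert_series scale A = fps_of_poly h / (1 - fps_X) ^ D \<and> lead_coeff h = 1)"


section \<open>Edge rings\<close>

text \<open>
  Polynomials with coefficients in \<open>'k\<close> in variables indexed by \<open>'v\<close>: finitely supported maps from
  exponent vectors to coefficients, with the convolution product.
\<close>

type_synonym ('v, 'k) mpoly = "('v \<Rightarrow>\<^sub>0 nat) \<Rightarrow>\<^sub>0 'k"

definition const :: "'k::zero \<Rightarrow> ('v, 'k) mpoly" where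
  "const c = Poly_Mapping.single 0 c"

definition var :: "'v \<Rightarrow> ('v, 'k::zero_neq_one) mpoly" where
  "var v = Poly_Mapping.single (Poly_Mapping.single v 1) 1"

definition scale_mpoly :: "'k::comm_ring_1 \<Rightarrow> ('v, 'k) mpoly \<Rightarrow> ('v, 'k) mpoly" where
  "scale_mpoly c p = const c * p"

lemma vector_space_scale_mpoly:
  "vector_space (scale_mpoly :: 'k::field \<Rightarrow> ('v, 'k) mpoly \<Rightarrow> ('v, 'k) mpoly)"
  by unfold_locales
    (simp_all add: scale_mpoly_def const_def algebra_simps single_add mult_single
      flip: mult.assoc)

definition edge_mono :: "'v set \<Rightarrow> ('v, 'k::comm_ring_1) mpoly" where
  "edge_mono e = (\<Prod>v\<in>e. var v)"

definition edge_ring :: "'k::comm_ring_1 itself \<Rightarrow> 'v graph \<Rightarrow> ('v, 'k) mpoly ring" where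
  "edge_ring k G = ring_of_type_algebra
     \<lparr>carrier := generate_ring ring_of_type_algebra (range const \<union> edge_mono ` edges G)\<rparr>"

text \<open>The component of degree \<open>n\<close> for the grading in which every \<open>edge_mono e\<close> has degree 1.\<close>

definition edge_ring_grade :: "'k::field itself \<Rightarrow> 'v graph \<Rightarrow> nat \<Rightarrow> ('v, 'k) mpoly set" where
  "edge_ring_grade k G n = module.span scale_mpoly
     {prod_list (map edge_mono es) | es. set es \<subseteq> edges G \<and> length es = n}"

end

theory Submission
  imports Defs
begin

text \<open>
  Write \<open>S\<close> for the set of degree vectors of non-negative integer edge weightings of \<open>G\<close>, the exponents
  of the monomials in the edge ring. A generic push of the points of \<open>S\<close> into, respectively out of,
  the cone they span decomposes \<open>S\<close> and the set of its interior points into half-open simplicial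
  cones indexed by the same spanning trees. Hence the leading coefficient of the \<open>h\<close>-polynomial is
  the number of interior points of the lowest level that has any. By Hall's theorem a vector is
  interior iff all Hall inequalities on proper non-empty sets are strict; if \<open>G\<close> is 2-connected and
  an interior point has an entry \<open>\<ge> 2\<close>, one unit can be moved to another vertex within the interior.
  So the coefficient is 1 iff the all-ones vector is interior, that is, iff \<open>G\<close> is matching-covered.
  An odd ear keeps a positive weighting with constant degrees alive, so odd ear decompositions make
  the all-ones vector interior; conversely odd ears are found by following alternating cycles. The
  Krull dimension is one less than the number of vertices: elements picked from a chain of primes
  are algebraically independent, and setting the variables outside a growing connected vertex set
  to zero gives a chain of this length.
\<close>

section \<open>Degree vectors and Hall's theorem\<close>

text \<open>All arithmetic stays in the integers. A push by a small multiple of a direction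
  \<open>wt\<close> is replaced by the vectors \<open>big * p + wt\<close> and
  \<open>big * p - wt\<close>, where \<open>big\<close> exceeds every quantity derived from
  \<open>wt\<close> that it meets. The direction is the degree vector of the edge weights
  \<open>2 ^ rank e\<close>: positive weights put it inside the cone, and the dominance of the
  highest power rules out cancellation over a cut, so no pushed point lies on a wall between two
  simplicial cones. The cones are selected by lexicographic optimality of flows. Bipartiteness makes
  each tree a lattice basis of the balanced vectors, so the points of a half-open cone are counted
  by compositions. The two pushes are complementary: an edge of a tree is forced to have a positive
  coordinate under exactly one of them. If the tree has \<open>D\<close> edges and \<open>d\<close>
  of them are forced by the inward push, it contributes the \<open>d\<close>-th power of the
  variable to the numerator, and its interior points start at level \<open>D - d\<close> with a
  single point. Hence the trees with the largest \<open>d\<close> are counted both by the leading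
  coefficient and by the lowest level with interior points.\<close>

locale bipartite_sets =
  fixes A B :: "'v set" and E :: "'v set set"
  assumes finite_A: "finite A" and finite_B: "finite B" and disjoint: "A \<inter> B = {}"
    and edge_cases: "e \<in> E \<Longrightarrow> \<exists>a\<in>A. \<exists>b\<in>B. e = {a, b}"
begin

definition V :: "'v set" where "V = A \<union> B"

definition nbh :: "'v set \<Rightarrow> 'v set" where "nbh S = {b. \<exists>a\<in>S. {a, b} \<in> E}"

definition deg :: "('v set \<Rightarrow> int) \<Rightarrow> 'v \<Rightarrow> int" where
  "deg f v = (\<Sum>e\<in>E. if v \<in> e then f e else 0)"

definition sg :: "'v \<Rightarrow> int" where "sg v = (if v \<in> A then 1 else -1)"

text \<open>On a degree vector the two ends of an edge cancel, so this sum sees only the edges with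
  exactly one end in \<open>K\<close>. It tests cuts without distinguishing the two sides.\<close>

definition signed :: "('v \<Rightarrow> int) \<Rightarrow> 'v set \<Rightarrow> int" where "signed p K = (\<Sum>v\<in>K. sg v * p v)"

lemma finite_V: "finite V" using finite_A finite_B by (simp add: V_def)

lemma edge_subset: "e \<in> E \<Longrightarrow> e \<subseteq> V" using edge_cases by (fastforce simp: V_def)

lemma finite_E: "finite E"
  by (rule finite_subset[of _ "Pow V"]) (use edge_subset finite_V in auto)

lemma edge_AB: "{x, y} \<in> E \<Longrightarrow> (x \<in> A \<and> y \<in> B) \<or> (x \<in> B \<and> y \<in> A)"
  using edge_cases[of "{x,y}"] by (auto simp: doubleton_eq_iff)

lemma edge_A: "{x, y} \<in> E \<Longrightarrow> x \<in> A \<Longrightarrow> y \<in> B" using edge_AB disjoint by blast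
lemma edge_B: "{x, y} \<in> E \<Longrightarrow> x \<in> B \<Longrightarrow> y \<in> A" using edge_AB disjoint by blast

lemma edge_cases':
  assumes "e \<in> E"
  obtains a b where "a \<in> A" "b \<in> B" "e = {a, b}" "a \<noteq> b" "a \<notin> B" "b \<notin> A"
  using edge_cases[OF assms] disjoint by blast

lemma nbh_subset: "S \<subseteq> A \<Longrightarrow> nbh S \<subseteq> B" using edge_A by (auto simp: nbh_def)
lemma nbh_mono: "S \<subseteq> Y \<Longrightarrow> nbh S \<subseteq> nbh Y" by (auto simp: nbh_def)
lemma nbh_Un: "nbh (S \<union> Y) = nbh S \<union> nbh Y" by (auto simp: nbh_def)
lemma nbh_Int: "nbh (S \<inter> Y) \<subseteq> nbh S \<inter> nbh Y" by (auto simp: nbh_def)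
lemma nbh_empty [simp]: "nbh {} = {}" by (auto simp: nbh_def)

text \<open>The notions \<open>nbh\<close>, \<open>hall\<close> and \<open>interior\<close> favour
  the side \<open>A\<close>; reinterpreting the locale with the sides exchanged yields their
  counterparts for \<open>B\<close>.\<close>

lemma swap: "bipartite_sets B A E"
proof
  show "finite B" "finite A" "B \<inter> A = {}" using finite_A finite_B disjoint by auto
  fix e assume "e \<in> E"
  then obtain a b where "a \<in> A" "b \<in> B" "e = {b, a}" using edge_cases[of e] by (metis insert_commute)
  then show "\<exists>a\<in>B. \<exists>b\<in>A. e = {a, b}" by blast
qed

lemma swap_V: "bipartite_sets.V B A = V"
  using swap by (simp add: bipartite_sets.V_def V_def Un_commute)

lemma deg_add: "deg (\<lambda>e. f e + g e) v = deg f v + deg g v"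
  unfolding deg_def sum.distrib[symmetric] by (rule sum.cong) auto
lemma deg_diff: "deg (\<lambda>e. f e - g e) v = deg f v - deg g v"
  unfolding deg_def sum_subtractf[symmetric] by (rule sum.cong) auto
lemma deg_uminus: "deg (\<lambda>e. - f e) v = - deg f v"
  unfolding deg_def sum_negf[symmetric] by (rule sum.cong) auto
lemma deg_mult: "deg (\<lambda>e. c * f e) v = c * deg f v"
  by (simp add: deg_def sum_distrib_left) (rule sum.cong, auto)
lemma deg_sum: "deg (\<lambda>e. \<Sum>i\<in>I. f i e) v = (\<Sum>i\<in>I. deg (f i) v)"
  unfolding deg_def by (subst sum.swap) (rule sum.cong, auto)
lemma deg_zero [simp]: "deg (\<lambda>e. 0) v = 0" by (simp add: deg_def)
lemma deg_outside: "v \<notin> V \<Longrightarrow> deg f v = 0"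
  unfolding deg_def using edge_subset by (intro sum.neutral) auto
lemma deg_single: "e0 \<in> E \<Longrightarrow> deg (\<lambda>e. if e = e0 then c else 0) v = (if v \<in> e0 then c else 0)"
  unfolding deg_def using finite_E
  by (subst sum.mono_neutral_right[of E "{e0}"]) auto
lemma deg_cong: "(\<And>e. e \<in> E \<Longrightarrow> f e = g e) \<Longrightarrow> deg f v = deg g v"
  unfolding deg_def by (rule sum.cong) auto
lemma deg_nonneg: "(\<And>e. e \<in> E \<Longrightarrow> f e \<ge> 0) \<Longrightarrow> deg f v \<ge> 0"
  unfolding deg_def by (rule sum_nonneg) auto

lemma sum_deg:
  assumes "finite S"
  shows "(\<Sum>v\<in>S. c v * deg f v) = (\<Sum>e\<in>E. f e * (\<Sum>v\<in>S \<inter> e. c v))"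
proof -
  have "(\<Sum>v\<in>S. c v * deg f v) = (\<Sum>v\<in>S. \<Sum>e\<in>E. if v \<in> e then c v * f e else 0)"
    by (simp add: deg_def sum_distrib_left if_distrib cong: if_cong)
  also have "\<dots> = (\<Sum>e\<in>E. \<Sum>v\<in>S. if v \<in> e then c v * f e else 0)" by (rule sum.swap)
  also have "\<dots> = (\<Sum>e\<in>E. f e * (\<Sum>v\<in>S \<inter> e. c v))"
    using assms by (intro sum.cong refl) (simp add: sum.inter_restrict sum_distrib_left if_distrib mult.commute cong: if_cong)
  finally show ?thesis .
qed

lemma sum_deg_A:
  assumes "S \<subseteq> A"
  shows "sum (deg f) S = (\<Sum>e\<in>E. if e \<inter> S \<noteq> {} then f e else 0)"
proof -
  have "sum (deg f) S = (\<Sum>v\<in>S. 1 * deg f v)" by simp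
  also have "\<dots> = (\<Sum>e\<in>E. f e * (\<Sum>v\<in>S \<inter> e. 1))"
    using assms finite_A by (intro sum_deg) (auto intro: finite_subset)
  also have "\<dots> = (\<Sum>e\<in>E. if e \<inter> S \<noteq> {} then f e else 0)"
  proof (rule sum.cong[OF refl])
    fix e assume "e \<in> E"
    then obtain a b where *: "a \<in> A" "b \<in> B" "e = {a, b}" "a \<noteq> b" "a \<notin> B" "b \<notin> A" by (rule edge_cases')
    then have "S \<inter> e = (if a \<in> S then {a} else {})" using assms by auto
    then show "f e * (\<Sum>v\<in>S \<inter> e. 1) = (if e \<inter> S \<noteq> {} then f e else 0)" by (auto simp: Int_commute split: if_splits)
  qed
  finally show ?thesis .
qed

lemma sum_deg_B:
  assumes "S \<subseteq> B"
  shows "sum (deg f) S = (\<Sum>e\<in>E. if e \<inter> S \<noteq> {} then f e else 0)"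
  using bipartite_sets.sum_deg_A[OF swap assms] .

lemma deg_level: "sum (deg f) A = sum f E"
  by (subst sum_deg_A, simp, rule sum.cong) (auto elim!: edge_cases')

lemma deg_level_B: "sum (deg f) B = sum f E"
  by (subst sum_deg_B, simp, rule sum.cong) (auto elim!: edge_cases')

definition bal :: "('v \<Rightarrow> int) \<Rightarrow> bool" where "bal p \<longleftrightarrow> sum p A = sum p B"

lemma bal_deg: "bal (deg f)" by (simp add: bal_def deg_level deg_level_B)

lemma signed_V: "signed p V = sum p A - sum p B"
proof -
  have "signed p V = (\<Sum>v\<in>A. sg v * p v) + (\<Sum>v\<in>B. sg v * p v)"
    unfolding signed_def V_def using finite_A finite_B disjoint by (rule sum.union_disjoint)
  also have "(\<Sum>v\<in>A. sg v * p v) = sum p A" by (rule sum.cong) (auto simp: sg_def)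
  also have "(\<Sum>v\<in>B. sg v * p v) = - sum p B"
    unfolding sum_negf[symmetric] using disjoint by (intro sum.cong) (auto simp: sg_def)
  finally show ?thesis by simp
qed

lemma bal_signed: "bal p \<longleftrightarrow> signed p V = 0" by (simp add: bal_def signed_V)

section \<open>Hall's condition and integral weightings\<close>

definition hall :: "('v \<Rightarrow> int) \<Rightarrow> bool" where
  "hall p \<longleftrightarrow> bal p \<and> (\<forall>v\<in>V. p v \<ge> 0) \<and> (\<forall>S\<subseteq>A. sum p S \<le> sum p (nbh S))"

definition interior :: "('v \<Rightarrow> int) \<Rightarrow> bool" where
  "interior p \<longleftrightarrow> bal p \<and> (\<forall>v\<in>V. p v > 0) \<and> (\<forall>S\<subset>A. S \<noteq> {} \<longrightarrow> sum p S < sum p (nbh S))"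

lemma nbh_finite: "S \<subseteq> A \<Longrightarrow> finite (nbh S)" using nbh_subset finite_B finite_subset by blast

text \<open>Inclusion-exclusion for the two sets and for their neighbourhoods. Keeping
  \<open>nbh S \<inter> nbh Y\<close> instead of \<open>nbh (S \<inter> Y)\<close> gives an
  equality; it also lets a common neighbour of disjoint sets count.\<close>

lemma submodular:
  fixes p :: "'v \<Rightarrow> int"
  assumes "S \<subseteq> A" "Y \<subseteq> A"
  shows "sum p (nbh (S \<union> Y)) - sum p (S \<union> Y) + (sum p (nbh S \<inter> nbh Y) - sum p (S \<inter> Y))
    = (sum p (nbh S) - sum p S) + (sum p (nbh Y) - sum p Y)"
proof -
  have "finite S" "finite Y" using assms finite_A finite_subset by blast+
  then have "sum p (S \<union> Y) + sum p (S \<inter> Y) = sum p S + sum p Y" by (simp add: sum.union_inter)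
  moreover have "sum p (nbh (S \<union> Y)) + sum p (nbh S \<inter> nbh Y) = sum p (nbh S) + sum p (nbh Y)"
    using assms by (simp add: nbh_Un sum.union_inter nbh_finite)
  ultimately show ?thesis by linarith
qed

lemma sum_change:
  assumes "finite S"
  shows "(\<Sum>u\<in>S. p u - (if u = v then c else 0)) = sum p S - (if v \<in> S then c else (0::int))"
  using assms by (simp add: sum_subtractf sum.delta)

text \<open>If no edge at \<open>a\<close> can be removed, every neighbour of \<open>a\<close> of
  positive weight is adjacent to a tight set that avoids \<open>a\<close>. Tight sets are closed
  under union, so the union \<open>U\<close> of all of them absorbs these neighbours, and adding
  \<open>a\<close> to \<open>U\<close> raises the left side of Hall's inequality by
  \<open>p a\<close> but not the right side.\<close>

lemma hall_remove_edge:
  assumes h: "hall p" and a: "a \<in> A" "p a > 0"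
  obtains b where "b \<in> B" "{a, b} \<in> E" "hall (\<lambda>v. p v - (if v \<in> {a, b} then 1 else 0))"
proof (rule ccontr)
  assume neg: "\<not> thesis"
  note result = that
  have p0: "\<And>v. v \<in> V \<Longrightarrow> p v \<ge> 0" and hS: "\<And>S. S \<subseteq> A \<Longrightarrow> sum p S \<le> sum p (nbh S)"
    and bal: "sum p A = sum p B" using h by (auto simp: hall_def bal_def)
  have tight: "\<exists>S. S \<subseteq> A \<and> a \<notin> S \<and> b \<in> nbh S \<and> sum p S = sum p (nbh S)"
    if b: "{a, b} \<in> E" "p b > 0" for b
  proof (rule ccontr)
    assume nt: "\<not> ?thesis"
    have bB: "b \<in> B" "a \<noteq> b" "a \<notin> B" "b \<notin> A" using b a edge_A disjoint by blast+
    define q where "q = (\<lambda>v. p v - (if v \<in> {a, b} then 1 else 0))"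
    have sumq: "sum q S = sum p S - (if a \<in> S then 1 else 0) - (if b \<in> S then 1 else 0)"
      if "finite S" for S
    proof -
      have "sum q S = (\<Sum>u\<in>S. (p u - (if u = a then 1 else 0)) - (if u = b then 1 else 0))"
        using bB unfolding q_def by (intro sum.cong) auto
      then show ?thesis using that by (simp only: sum_change)
    qed
    have "hall q" unfolding hall_def bal_def
    proof (intro conjI ballI allI impI)
      show "sum q A = sum q B" using bal a bB finite_A finite_B by (simp add: sumq)
      show "q v \<ge> 0" if "v \<in> V" for v using p0[OF that] a b by (auto simp: q_def)
    next
      fix S assume S: "S \<subseteq> A"
      then have S': "finite S" "finite (nbh S)" "b \<notin> S" "a \<notin> nbh S"
        using finite_A finite_subset nbh_finite bB nbh_subset[OF S] by blast+
      have "a \<in> S \<Longrightarrow> b \<in> nbh S" using b by (auto simp: nbh_def)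
      then show "sum q S \<le> sum q (nbh S)" using S S' hS[OF S] nt by (force simp: sumq)
    qed
    then show False using neg result[of b] b bB by (simp add: q_def)
  qed
  define \<T> where "\<T> = {S. S \<subseteq> A \<and> a \<notin> S \<and> sum p S = sum p (nbh S)}"
  have fin\<T>: "finite \<T>" using finite_A by (auto simp: \<T>_def intro: finite_subset[of _ "Pow A"])
  have un: "S \<union> Y \<in> \<T>" if "S \<in> \<T>" "Y \<in> \<T>" for S Y
  proof -
    have SY: "S \<subseteq> A" "Y \<subseteq> A" using that by (auto simp: \<T>_def)
    have "sum p (nbh (S \<inter> Y)) \<le> sum p (nbh S \<inter> nbh Y)"
      using SY nbh_Int nbh_finite p0 nbh_subset[OF SY(1)] by (intro sum_mono2) (auto simp: V_def)
    moreover have "sum p (S \<inter> Y) \<le> sum p (nbh (S \<inter> Y))" using hS SY by blast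
    moreover have "sum p (S \<union> Y) \<le> sum p (nbh (S \<union> Y))" using hS SY by blast
    ultimately show ?thesis using that submodular[OF SY, of p] by (auto simp: \<T>_def)
  qed
  have Un_in: "\<Union>F \<in> \<T>" if "F \<subseteq> \<T>" for F
  proof -
    have "finite F" using that fin\<T> finite_subset by blast
    then show ?thesis using that
    proof (induction F)
      case empty show ?case by (simp add: \<T>_def)
    next
      case (insert x F) then show ?case using un by auto
    qed
  qed
  define U where "U = \<Union>\<T>"
  have U: "U \<subseteq> A" "a \<notin> U" "sum p U = sum p (nbh U)" using Un_in[of \<T>] by (auto simp: \<T>_def U_def)
  have sub: "p b = 0" if "b \<in> nbh {a} - nbh U" for b
  proof (rule ccontr)
    assume "p b \<noteq> 0"
    moreover have b: "{a, b} \<in> E" using that by (auto simp: nbh_def)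
    moreover have "b \<in> V" using b a edge_A by (auto simp: V_def)
    ultimately have "p b > 0" using p0[of b] by simp
    then obtain S where S: "S \<in> \<T>" "b \<in> nbh S" using tight b by (auto simp: \<T>_def)
    then have "b \<in> nbh U" unfolding U_def using nbh_mono[of S "\<Union>\<T>"] by blast
    then show False using that by simp
  qed
  have "sum p (nbh (insert a U)) = sum p (nbh U)"
    using U a nbh_mono[of U "insert a U"] sub nbh_Un[of "{a}" U]
    by (intro sum.mono_neutral_right) (auto intro!: nbh_finite)
  moreover have "sum p (insert a U) = p a + sum p U" using U finite_A finite_subset by (subst sum.insert) auto
  ultimately show False using hS[of "insert a U"] U a by auto
qed

text \<open>Induction on the level \<open>sum p A\<close>, peeling off one edge at a time.
  Integrality is the point: integer vectors satisfying the inequalities of the cone are degree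
  vectors of integer weightings, which is the normality of the semigroup of exponents.\<close>

theorem hall_flow:
  assumes "hall p"
  obtains f where "\<And>e. e \<in> E \<Longrightarrow> f e \<ge> 0" "\<And>e. e \<notin> E \<Longrightarrow> f e = 0" "\<And>v. v \<in> V \<Longrightarrow> deg f v = p v"
proof -
  have "\<exists>f. (\<forall>e\<in>E. f e \<ge> 0) \<and> (\<forall>e. e \<notin> E \<longrightarrow> f e = 0) \<and> (\<forall>v\<in>V. deg f v = p v)"
    using assms
  proof (induction "nat (sum p A)" arbitrary: p)
    case 0
    have nn: "p v \<ge> 0" if "v \<in> V" for v using 0 that by (auto simp: hall_def)
    have "sum p A \<le> 0" using 0 by simp
    moreover have "sum p A \<ge> 0" using nn by (intro sum_nonneg) (auto simp: V_def)
    ultimately have "sum p A = 0" by simp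
    moreover from this have "sum p B = 0" using 0 by (simp add: hall_def bal_def)
    ultimately have "\<forall>v\<in>A. p v = 0" "\<forall>v\<in>B. p v = 0" using nn finite_A finite_B
      by (simp_all add: sum_nonneg_eq_0_iff V_def)
    then show ?case by (intro exI[of _ "\<lambda>e. 0"]) (auto simp: V_def)
  next
    case (Suc n)
    have nn: "p v \<ge> 0" if "v \<in> V" for v using Suc.prems that by (auto simp: hall_def)
    have "\<exists>a\<in>A. p a > 0"
    proof (rule ccontr)
      assume "\<not> ?thesis"
      then have "sum p A \<le> 0" by (intro sum_nonpos) auto
      then show False using Suc.hyps(2) by simp
    qed
    then obtain a where a: "a \<in> A" "p a > 0" by blast
    obtain b where b: "b \<in> B" "{a, b} \<in> E" "hall (\<lambda>v. p v - (if v \<in> {a, b} then 1 else 0))"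
      using hall_remove_edge[OF Suc.prems a] by blast
    have "b \<notin> A" using b disjoint by blast
    then have "(\<Sum>v\<in>A. p v - (if v \<in> {a, b} then 1 else 0)) = (\<Sum>v\<in>A. p v - (if v = a then 1 else 0))"
      by (intro sum.cong) auto
    also have "\<dots> = sum p A - 1" using a finite_A by (simp only: sum_change if_True)
    finally have "n = nat (\<Sum>v\<in>A. p v - (if v \<in> {a, b} then 1 else 0))" using Suc.hyps(2) by simp
    from Suc.hyps(1)[OF this b(3)] obtain f where
      f: "\<forall>e\<in>E. f e \<ge> 0" "\<forall>e. e \<notin> E \<longrightarrow> f e = 0" "\<forall>v\<in>V. deg f v = p v - (if v \<in> {a, b} then 1 else 0)" by blast
    show ?case
      by (rule exI[of _ "\<lambda>e. f e + (if e = {a,b} then 1 else 0)"])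
        (use f b in \<open>auto simp: deg_add deg_single\<close>)
  qed
  then show ?thesis using that by blast
qed

lemma flow_hall:
  assumes "\<And>e. e \<in> E \<Longrightarrow> f e \<ge> 0"
  shows "hall (deg f)"
  unfolding hall_def
proof (intro conjI ballI allI impI bal_deg)
  show "deg f v \<ge> 0" for v using assms by (rule deg_nonneg)
  fix S assume S: "S \<subseteq> A"
  have "e \<inter> nbh S \<noteq> {}" if "e \<in> E" "e \<inter> S \<noteq> {}" for e
  proof -
    from that(1) obtain a b where "a \<in> A" "b \<in> B" "e = {a, b}" "b \<notin> A" by (elim edge_cases') auto
    moreover from this have "a \<in> S" using that S by blast
    ultimately have "b \<in> e \<inter> nbh S" using that by (auto simp: nbh_def)
    then show ?thesis by blast
  qed
  then show "sum (deg f) S \<le> sum (deg f) (nbh S)"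
    using assms S by (auto simp: sum_deg_A sum_deg_B nbh_subset intro!: sum_mono)
qed

end

section \<open>Interior degree vectors\<close>

text \<open>A list is cut back whenever the next vertex already occurs in it. Paths without
  repetition are what cycles and ears are made from.\<close>

lemma rtrancl_distinct_path:
  assumes "(x, y) \<in> r\<^sup>*"
  obtains xs where "xs \<noteq> []" "hd xs = x" "last xs = y" "distinct xs" "successively (\<lambda>a b. (a, b) \<in> r) xs"
proof -
  have "\<exists>xs. xs \<noteq> [] \<and> hd xs = x \<and> last xs = y \<and> distinct xs \<and> successively (\<lambda>a b. (a, b) \<in> r) xs"
    using assms
  proof (induction rule: rtrancl_induct)
    case base
    show ?case by (intro exI[of _ "[x]"]) auto
  next
    case (step y z)
    then obtain xs where xs: "xs \<noteq> []" "hd xs = x" "last xs = y" "distinct xs"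
      "successively (\<lambda>a b. (a, b) \<in> r) xs" by blast
    show ?case
    proof (cases "z \<in> set xs")
      case True
      then obtain as bs where ab: "xs = as @ z # bs" by (meson split_list)
      show ?thesis using xs unfolding ab
        by (intro exI[of _ "as @ [z]"]) (auto simp: successively_append_iff hd_append split: if_splits)
    next
      case False
      then show ?thesis using xs step.hyps(2)
        by (intro exI[of _ "xs @ [z]"]) (auto simp: successively_append_iff)
    qed
  qed
  then show ?thesis using that by blast
qed


context bipartite_sets begin

text \<open>\<open>T\<close> meets every cut of \<open>W\<close>; for edges inside \<open>W\<close> this says that \<open>(W, T)\<close> is connected.\<close>

definition bicut :: "'v set set \<Rightarrow> 'v set \<Rightarrow> bool" where
  "bicut T W \<longleftrightarrow> (\<forall>K. K \<subseteq> W \<and> K \<noteq> {} \<and> K \<noteq> W \<longrightarrow> (\<exists>x\<in>K. \<exists>y\<in>W - K. {x, y} \<in> T))"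

lemma bicutD: "bicut T W \<Longrightarrow> K \<subseteq> W \<Longrightarrow> K \<noteq> {} \<Longrightarrow> K \<noteq> W \<Longrightarrow> \<exists>x\<in>K. \<exists>y\<in>W - K. {x, y} \<in> T"
  by (auto simp: bicut_def)

end

locale connected_bipartite = bipartite_sets A B E for A B :: "'v set" and E +
  assumes connected: "bicut E V" and A_nonempty: "A \<noteq> {}" and B_nonempty: "B \<noteq> {}"
begin

lemma swap_connected: "connected_bipartite B A E"
proof -
  interpret s: bipartite_sets B A E by (rule swap)
  show ?thesis by unfold_locales (use connected A_nonempty B_nonempty swap_V in \<open>auto simp: s.bicut_def bicut_def\<close>)
qed

lemma has_neighbour:
  assumes "v \<in> V"
  obtains u where "{v, u} \<in> E" "u \<in> V"
proof -
  obtain a b where "a \<in> A" "b \<in> B" using A_nonempty B_nonempty by blast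
  then have "a \<in> V" "b \<in> V" "a \<noteq> b" using disjoint by (auto simp: V_def)
  then have "{v} \<noteq> V" by (metis singletonD)
  then show ?thesis using bicutD[OF connected, of "{v}"] assms that by auto
qed

lemma nbh_A: "nbh A = B"
proof
  show "nbh A \<subseteq> B" by (rule nbh_subset) simp
  show "B \<subseteq> nbh A"
  proof
    fix b assume b: "b \<in> B"
    then obtain a where "{b, a} \<in> E" using has_neighbour[of b] by (auto simp: V_def)
    then show "b \<in> nbh A" using edge_B[OF _ b] by (auto simp: nbh_def insert_commute)
  qed
qed

text \<open>An edge leaving \<open>S \<union> nbh S\<close> cannot start in \<open>S\<close>, so it
  starts in \<open>nbh S\<close>. Such an edge makes the Hall inequality of \<open>S\<close> strict
  for positive weights.\<close>

lemma edge_leaving_nbh: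
  assumes "S \<subset> A" "S \<noteq> {}"
  obtains a b where "a \<in> A" "a \<notin> S" "b \<in> nbh S" "{a, b} \<in> E"
proof -
  have *: "S \<union> nbh S \<subseteq> V" "S \<union> nbh S \<noteq> {}" "S \<union> nbh S \<noteq> V"
    using assms nbh_subset[of S] disjoint by (auto simp: V_def)
  from bicutD[OF connected *] obtain x y where xy: "x \<in> S \<union> nbh S" "y \<in> V" "y \<notin> S \<union> nbh S" "{x, y} \<in> E" by blast
  have "x \<in> nbh S" using xy by (auto simp: nbh_def)
  moreover from this have "y \<in> A" using xy edge_B nbh_subset[of S] assms by blast
  ultimately show ?thesis using that[of y x] xy by (auto simp: insert_commute)
qed

text \<open>The inequality for \<open>Y\<close> on the side \<open>B\<close> is the one for the
  complementary set \<open>A - s.nbh Y\<close>, whose neighbours avoid \<open>Y\<close>. If that set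
  is empty, strictness comes from the vertices of \<open>B\<close> outside \<open>Y\<close>
  instead.\<close>

lemma swap_interior:
  assumes "interior p"
  shows "bipartite_sets.interior B A E p"
proof -
  interpret s: connected_bipartite B A E by (rule swap_connected)
  have bal: "sum p A = sum p B" and pos: "\<And>v. v \<in> V \<Longrightarrow> p v > 0"
    and int: "\<And>S. S \<subset> A \<Longrightarrow> S \<noteq> {} \<Longrightarrow> sum p S < sum p (nbh S)"
    using assms by (auto simp: interior_def bal_def)
  show ?thesis unfolding s.interior_def s.bal_def
  proof (intro conjI ballI allI impI)
    show "sum p B = sum p A" using bal by simp
    show "p v > 0" if "v \<in> s.V" for v using pos that swap_V by simp
    fix Y assume Y: "Y \<subset> B" "Y \<noteq> {}"
    have NY: "s.nbh Y \<subseteq> A" using Y by (intro s.nbh_subset) auto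
    define S where "S = A - s.nbh Y"
    have "b \<notin> Y" if "b \<in> nbh S" for b
      using that by (auto simp: nbh_def s.nbh_def S_def) (metis insert_commute)
    then have "nbh S \<subseteq> B - Y" using nbh_subset[of S] by (auto simp: S_def)
    then have "sum p (nbh S) \<le> sum p (B - Y)"
      using finite_B pos by (intro sum_mono2) (auto simp: V_def intro: less_imp_le)
    also have "\<dots> = sum p B - sum p Y" using Y finite_B finite_subset by (intro sum_diff) auto
    finally have 1: "sum p (nbh S) \<le> sum p B - sum p Y" .
    have 2: "sum p S = sum p A - sum p (s.nbh Y)"
      unfolding S_def using NY finite_A finite_subset by (intro sum_diff) auto
    obtain y where y: "y \<in> Y" using Y by blast
    obtain x where "{y, x} \<in> E" using has_neighbour[of y] y Y by (auto simp: V_def)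
    then have "x \<in> s.nbh Y" using y by (auto simp: s.nbh_def)
    then have SA: "S \<subset> A" using NY by (auto simp: S_def)
    show "sum p Y < sum p (s.nbh Y)"
    proof (cases "S = {}")
      case True
      then have "s.nbh Y = A" using NY by (auto simp: S_def)
      moreover have "0 < sum p (B - Y)" using Y finite_B pos by (intro sum_pos) (auto simp: V_def)
      moreover have "sum p (B - Y) = sum p B - sum p Y" using Y finite_B finite_subset by (intro sum_diff) auto
      ultimately show ?thesis using bal by simp
    next
      case False
      then show ?thesis using int[of S] SA 1 2 bal by linarith
    qed
  qed
qed

text \<open>The factor \<open>N\<close> clears denominators: it suffices that \<open>p\<close> is
  the degree vector of a positive rational weighting.\<close>

lemma interior_if_positive_flow:
  assumes N: "N > 0" and g: "\<And>e. e \<in> E \<Longrightarrow> g e > 0" and p: "\<And>v. v \<in> V \<Longrightarrow> N * p v = deg g v"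
  shows "interior p"
proof -
  have mult: "N * sum p S = sum (deg g) S" if "S \<subseteq> V" for S
    unfolding sum_distrib_left using that p by (intro sum.cong) auto
  show ?thesis unfolding interior_def bal_def
  proof (intro conjI ballI allI impI)
    have "N * sum p A = N * sum p B" using mult[of A] mult[of B] by (simp add: V_def deg_level deg_level_B)
    then show "sum p A = sum p B" using N by simp
  next
    fix v assume v: "v \<in> V"
    then obtain u where u: "{v, u} \<in> E" using has_neighbour by blast
    have "deg g v > 0" unfolding deg_def
      using u g by (intro sum_pos2[of E "{v, u}"]) (auto simp: finite_E intro: less_imp_le)
    then show "p v > 0" using p[OF v] N by (metis zero_less_mult_pos)
  next
    fix S assume S: "S \<subset> A" "S \<noteq> {}"
    then have S': "S \<subseteq> A" "nbh S \<subseteq> B" using nbh_subset[of S] by auto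
    obtain a b where ab: "a \<in> A" "a \<notin> S" "b \<in> nbh S" "{a, b} \<in> E" using edge_leaving_nbh[OF S] by blast
    have meet: "e \<inter> nbh S \<noteq> {}" if "e \<in> E" "e \<inter> S \<noteq> {}" for e
    proof -
      from that(1) obtain a b where "a \<in> A" "b \<in> B" "e = {a, b}" "b \<notin> A" by (elim edge_cases') auto
      moreover from this have "a \<in> S" using that S by blast
      ultimately have "b \<in> e \<inter> nbh S" using that by (auto simp: nbh_def)
      then show ?thesis by blast
    qed
    have "{a, b} \<inter> S = {}" using ab S' disjoint by blast
    then have "sum (deg g) S < sum (deg g) (nbh S)"
      unfolding sum_deg_A[OF S'(1)] sum_deg_B[OF S'(2)]
      using ab g meet by (intro sum_strict_mono_ex1 finite_E bexI[of _ "{a, b}"]) (auto intro: less_imp_le)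
    moreover have "S \<subseteq> V" "nbh S \<subseteq> V" using S' by (auto simp: V_def)
    ultimately have "N * sum p S < N * sum p (nbh S)" using mult by simp
    then show "sum p S < sum p (nbh S)" using N by simp
  qed
qed

end

section \<open>Moving a unit in a 2-connected graph\<close>

locale two_connected_bipartite = connected_bipartite A B E for A B :: "'v set" and E +
  assumes two_connected: "v \<in> V \<Longrightarrow> bicut E (V - {v})" and card_V: "card V \<ge> 3"
begin

lemma swap_two_connected: "two_connected_bipartite B A E"
proof -
  interpret s: connected_bipartite B A E by (rule swap_connected)
  show ?thesis by unfold_locales (use two_connected card_V swap_V in \<open>auto simp: s.bicut_def bicut_def\<close>)
qed

text \<open>If every shift of a unit from \<open>v\<close> to another vertex of \<open>A\<close> left the interior, a maximal set
  \<open>S\<close> with \<open>p (nbh S) - p S = 1\<close> avoiding \<open>v\<close> would, by submodularity and since \<open>v\<close> is not a cut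
  vertex, consist of all other vertices of \<open>A\<close>.\<close>

lemma interior_shift_A:
  assumes p: "interior p" and v: "v \<in> A" "p v \<ge> 2"
  obtains w where "w \<in> A" "w \<noteq> v" "interior (\<lambda>u. p u + (if u = w then 1 else 0) - (if u = v then 1 else 0))"
proof (rule ccontr)
  assume neg: "\<not> thesis"
  note result = that
  have bal: "sum p A = sum p B" and pos: "\<And>v. v \<in> V \<Longrightarrow> p v > 0"
    and int: "\<And>S. S \<subset> A \<Longrightarrow> S \<noteq> {} \<Longrightarrow> sum p S < sum p (nbh S)"
    using p by (auto simp: interior_def bal_def)
  \<comment> \<open>A shift from \<open>v\<close> to \<open>w\<close> raises the sum over a set only
    if the set contains \<open>w\<close> but not \<open>v\<close>. It therefore leaves the interior
    only if such a set has slack exactly one.\<close>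
  define \<T> where "\<T> = {S. S \<subseteq> A - {v} \<and> sum p (nbh S) = sum p S + 1}"
  have tight: "\<exists>S\<in>\<T>. w \<in> S" if w: "w \<in> A" "w \<noteq> v" for w
  proof (rule ccontr)
    assume nt: "\<not> ?thesis"
    define q where "q = (\<lambda>u. p u + (if u = w then 1 else 0) - (if u = v then 1 else 0))"
    have sumq: "sum q S = sum p S + (if w \<in> S then 1 else 0) - (if v \<in> S then 1 else 0)" if "finite S" for S
      using that by (simp add: q_def sum_subtractf sum.distrib)
    have "interior q" unfolding interior_def bal_def
    proof (intro conjI ballI allI impI)
      have "w \<notin> B" "v \<notin> B" using w v disjoint by auto
      then show "sum q A = sum q B" using bal w v finite_A finite_B by (simp add: sumq)
      show "q u > 0" if "u \<in> V" for u using pos[OF that] v by (auto simp: q_def)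
    next
      fix S assume S: "S \<subset> A" "S \<noteq> {}"
      then have S': "finite S" "finite (nbh S)" "w \<notin> nbh S" "v \<notin> nbh S"
        using finite_A finite_subset nbh_finite[of S] w v disjoint nbh_subset[of S] by blast+
      show "sum q S < sum q (nbh S)"
      proof (cases "w \<in> S \<and> v \<notin> S")
        case True
        then have "S \<subseteq> A - {v}" using S by auto
        then have "sum p (nbh S) \<noteq> sum p S + 1" using nt True by (auto simp: \<T>_def)
        then show ?thesis using int[OF S] True S' by (simp add: sumq)
      next
        case False
        then show ?thesis using int[OF S] S' by (auto simp: sumq)
      qed
    qed
    then show False using neg result[of w] w by (simp add: q_def)
  qed
  have fin\<T>: "finite \<T>" using finite_A by (auto simp: \<T>_def intro: finite_subset[of _ "Pow A"])
  \<comment> \<open>If \<open>v\<close> were all of \<open>A\<close>, its deletion would leave at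
    least two vertices of \<open>B\<close> without any edge.\<close>
  have "A \<noteq> {v}"
  proof
    assume "A = {v}"
    obtain b where b: "b \<in> B" using B_nonempty by blast
    have "V - {v} = B" using \<open>A = {v}\<close> disjoint unfolding V_def by auto
    moreover have "B \<noteq> {b}" using card_V \<open>A = {v}\<close> unfolding V_def by (auto simp: card_insert_if split: if_splits)
    ultimately obtain y where "y \<in> B" "{b, y} \<in> E"
      using bicutD[OF two_connected[of v], of "{b}"] b v by (auto simp: V_def)
    then show False using edge_B[of b y] b disjoint by blast
  qed
  then obtain w where "w \<in> A" "w \<noteq> v" using v by blast
  then have "\<T> - {{}} \<noteq> {}" using tight by blast
  then obtain S where S: "S \<in> \<T>" "S \<noteq> {}" and max: "\<And>S'. S' \<in> \<T> \<Longrightarrow> S \<subseteq> S' \<Longrightarrow> S' = S"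
    using finite_has_maximal[of "\<T> - {{}}"] fin\<T> by (smt (verit) Diff_iff finite_Diff singletonD subset_empty insertCI)
  have SA: "S \<subseteq> A" "v \<notin> S" using S by (auto simp: \<T>_def)
  show False
  proof (cases "S \<union> nbh S = V - {v}")
    case True
    have "S = A - {v}" "nbh S = B" using True SA nbh_subset[of S] disjoint v by (auto simp: V_def)
    moreover have "sum p (A - {v}) = sum p A - p v" using finite_A v by (simp add: sum_diff1)
    ultimately have "p v = 1" using S bal by (auto simp: \<T>_def)
    then show False using v by simp
  next
    case False
    have "S \<union> nbh S \<subseteq> V - {v}" using SA nbh_subset[of S] v disjoint by (auto simp: V_def)
    then obtain x y where xy: "x \<in> S \<union> nbh S" "y \<in> V - {v}" "y \<notin> S \<union> nbh S" "{x, y} \<in> E"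
      using bicutD[OF two_connected[of v], of "S \<union> nbh S"] S False v by (auto simp: V_def)
    have xN: "x \<in> nbh S" using xy by (auto simp: nbh_def)
    then have yA: "y \<in> A" using xy edge_B[of x y] nbh_subset[OF SA(1)] by blast
    then obtain Y where Y: "Y \<in> \<T>" "y \<in> Y" using tight[of y] xy by auto
    have YA: "Y \<subseteq> A" "v \<notin> Y" using Y by (auto simp: \<T>_def)
    have "x \<in> nbh Y" using Y xy by (auto simp: nbh_def insert_commute)
    have nonneg: "p u \<ge> 0" if "u \<in> nbh S" for u
      using that pos[of u] nbh_subset[OF SA(1)] by (auto simp: V_def)
    \<comment> \<open>The slacks of \<open>S\<close> and \<open>Y\<close> add up to 2, so this bound
      leaves at most 1 for the slack of the union, and \<open>interior p\<close> demands at least 1.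
      For disjoint \<open>S\<close> and \<open>Y\<close> the bound comes from the common neighbour
      \<open>x\<close>.\<close>
    have ge1: "sum p (nbh S \<inter> nbh Y) - sum p (S \<inter> Y) \<ge> 1"
    proof (cases "S \<inter> Y = {}")
      case True
      have "0 < sum p (nbh S \<inter> nbh Y)"
        using xN \<open>x \<in> nbh Y\<close> nonneg pos[of x] nbh_subset[OF SA(1)] nbh_finite[OF SA(1)]
        by (intro sum_pos2[of _ x]) (auto simp: V_def)
      then show ?thesis using True by simp
    next
      case False
      have "sum p (nbh (S \<inter> Y)) \<le> sum p (nbh S \<inter> nbh Y)"
        using nbh_Int nonneg nbh_finite[OF SA(1)] by (intro sum_mono2) auto
      moreover have "sum p (S \<inter> Y) < sum p (nbh (S \<inter> Y))"
        using SA v False by (intro int) auto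
      ultimately show ?thesis by simp
    qed
    have "sum p (S \<union> Y) < sum p (nbh (S \<union> Y))" using SA YA S v by (intro int) auto
    moreover have "sum p (nbh S) = sum p S + 1" "sum p (nbh Y) = sum p Y + 1" using S Y by (auto simp: \<T>_def)
    ultimately have "sum p (nbh (S \<union> Y)) = sum p (S \<union> Y) + 1"
      using submodular[OF SA(1) YA(1), of p] ge1 by linarith
    then have "S \<union> Y \<in> \<T>" using SA YA by (auto simp: \<T>_def)
    then have "y \<in> S" using max[of "S \<union> Y"] Y by auto
    then show False using xy by simp
  qed
qed

text \<open>An entry of at least 2 gives a second interior point on the same level. For
  \<open>v\<close> in \<open>B\<close> the shift is made with the sides exchanged; it does not touch
  the sum over \<open>A\<close>.\<close>

lemma interior_not_unique:
  assumes p: "interior p" and v: "v \<in> V" "p v \<ge> 2"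
  obtains q where "interior q" "sum q A = sum p A" "\<exists>u\<in>V. q u \<noteq> p u" "\<And>u. u \<notin> V \<Longrightarrow> q u = p u"
proof -
  interpret s: two_connected_bipartite B A E by (rule swap_two_connected)
  have "\<exists>w. w \<in> V \<and> w \<noteq> v \<and> interior (\<lambda>u. p u + (if u = w then 1 else 0) - (if u = v then 1 else 0))
    \<and> (\<Sum>u\<in>A. p u + (if u = w then 1 else 0) - (if u = v then 1 else 0)) = sum p A"
  proof (cases "v \<in> A")
    case True
    then obtain w where w: "w \<in> A" "w \<noteq> v" "interior (\<lambda>u. p u + (if u = w then 1 else 0) - (if u = v then 1 else 0))"
      using interior_shift_A[OF p] v by blast
    then show ?thesis using True finite_A by (auto simp: V_def sum_subtractf sum.distrib)
  next
    case False
    then have vB: "v \<in> B" using v by (auto simp: V_def)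
    obtain w where w: "w \<in> B" "w \<noteq> v" "s.interior (\<lambda>u. p u + (if u = w then 1 else 0) - (if u = v then 1 else 0))"
      using s.interior_shift_A[OF swap_interior[OF p] vB v(2)] by blast
    have "w \<notin> A" "v \<notin> A" using w vB disjoint by auto
    moreover have "interior (\<lambda>u. p u + (if u = w then 1 else 0) - (if u = v then 1 else 0))"
      using s.swap_interior[OF w(3)] .
    ultimately show ?thesis using w finite_A by (auto simp: V_def sum_subtractf sum.distrib intro!: exI[of _ w])
  qed
  then obtain w where w: "w \<in> V" "w \<noteq> v" "interior (\<lambda>u. p u + (if u = w then 1 else 0) - (if u = v then 1 else 0))"
    "(\<Sum>u\<in>A. p u + (if u = w then 1 else 0) - (if u = v then 1 else 0)) = sum p A" by blast
  show ?thesis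
    by (rule that[OF w(3,4)]) (use w v in \<open>auto intro!: bexI[of _ w]\<close>)
qed

end

context bipartite_sets begin

subsection \<open>Lattice generated by a connected edge set\<close>

text \<open>Degree vector of the alternating weights 1 and -1 along a path from \<open>u\<close> to
  \<open>v\<close> that starts with \<open>sg u\<close>. With these signs it telescopes whatever
  sides the ends lie on.\<close>

definition unit_diff :: "'v \<Rightarrow> 'v \<Rightarrow> 'v \<Rightarrow> int" where
  "unit_diff u v x = (if x = u then sg u else 0) - (if x = v then sg v else 0)"

definition linked :: "'v set set \<Rightarrow> 'v \<Rightarrow> 'v \<Rightarrow> bool" where
  "linked T u v \<longleftrightarrow> (\<exists>c. (\<forall>e. c e \<noteq> 0 \<longrightarrow> e \<in> T) \<and> (\<forall>x. deg c x = unit_diff u v x))"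

lemma sg_sq [simp]: "sg v * sg v = 1" by (simp add: sg_def)
lemma sg_nonzero [simp]: "sg v \<noteq> 0" by (simp add: sg_def)

lemma sg_edge: "{x, y} \<in> E \<Longrightarrow> sg y = - sg x"
  using edge_AB[of x y] disjoint by (auto simp: sg_def)

lemma edge_distinct: "{x, y} \<in> E \<Longrightarrow> x \<noteq> y"
  using edge_AB[of x y] disjoint by auto

lemma linked_refl: "linked T u u"
  unfolding linked_def by (rule exI[of _ "\<lambda>e. 0"]) (auto simp: unit_diff_def)

lemma linked_sym: assumes "linked T u v" shows "linked T v u"
proof -
  obtain c where c: "\<forall>e. c e \<noteq> 0 \<longrightarrow> e \<in> T" "\<forall>x. deg c x = unit_diff u v x"
    using assms by (auto simp: linked_def)
  then show ?thesis unfolding linked_def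
    by (intro exI[of _ "\<lambda>e. - c e"]) (auto simp: deg_uminus unit_diff_def)
qed

lemma linked_trans: assumes "linked T u v" "linked T v w" shows "linked T u w"
proof -
  obtain c d where c: "\<forall>e. c e \<noteq> 0 \<longrightarrow> e \<in> T" "\<forall>x. deg c x = unit_diff u v x"
      and d: "\<forall>e. d e \<noteq> 0 \<longrightarrow> e \<in> T" "\<forall>x. deg d x = unit_diff v w x"
    using assms by (auto simp: linked_def)
  then show ?thesis unfolding linked_def
    by (intro exI[of _ "\<lambda>e. c e + d e"]) (auto simp: deg_add unit_diff_def, metis add_cancel_left_left)
qed

lemma linked_mono: "linked T u v \<Longrightarrow> T \<subseteq> T' \<Longrightarrow> linked T' u v"
  unfolding linked_def by blast

lemma linked_edge: assumes "{x, y} \<in> T" "{x, y} \<in> E" shows "linked T x y"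
  unfolding linked_def
  using assms sg_edge[OF assms(2)] edge_distinct[OF assms(2)]
  by (intro exI[of _ "\<lambda>e. if e = {x, y} then sg x else 0"])
    (auto simp: deg_single unit_diff_def)

lemma bicut_linked:
  assumes "bicut T W" "T \<subseteq> E" "u \<in> W" "v \<in> W"
  shows "linked T u v"
proof (rule ccontr)
  assume "\<not> linked T u v"
  then have "{y \<in> W. linked T u y} \<noteq> W" using assms by blast
  then obtain x y where xy: "x \<in> W" "linked T u x" "y \<in> W" "\<not> linked T u y" "{x, y} \<in> T"
    using bicutD[OF assms(1), of "{y \<in> W. linked T u y}"] assms linked_refl by blast
  then show False using linked_trans linked_edge assms(2) by blast
qed

text \<open>Each \<open>v\<close> contributes \<open>q v * sg v\<close> times the vector that links
  it to the root \<open>r\<close>. The error collected at \<open>r\<close> is the signed sum of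
  \<open>q\<close>, which vanishes by balance.\<close>

lemma linked_generates:
  assumes T: "\<And>u v. u \<in> V \<Longrightarrow> v \<in> V \<Longrightarrow> linked T u v" and q: "bal q" and r: "r \<in> V"
  obtains c where "\<And>e. c e \<noteq> 0 \<Longrightarrow> e \<in> T" "\<And>v. v \<in> V \<Longrightarrow> deg c v = q v"
proof -
  have "\<forall>v\<in>V. \<exists>c. (\<forall>e. c e \<noteq> 0 \<longrightarrow> e \<in> T) \<and> (\<forall>x. deg c x = unit_diff v r x)"
    using T r by (auto simp: linked_def)
  then obtain c where c: "\<And>v e. v \<in> V \<Longrightarrow> c v e \<noteq> 0 \<Longrightarrow> e \<in> T"
    "\<And>v x. v \<in> V \<Longrightarrow> deg (c v) x = unit_diff v r x" by metis
  define d where "d = (\<lambda>e. \<Sum>v\<in>V. q v * sg v * c v e)"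
  show ?thesis
  proof (rule that[of d])
    fix e assume "d e \<noteq> 0"
    then obtain v where "v \<in> V" "c v e \<noteq> 0" unfolding d_def by (metis (mono_tags, lifting) mult_zero_right sum.neutral)
    then show "e \<in> T" using c by blast
  next
    fix x assume x: "x \<in> V"
    have "deg d x = (\<Sum>v\<in>V. q v * sg v * unit_diff v r x)"
      unfolding d_def using c by (simp add: deg_sum deg_mult)
    also have "\<dots> = (\<Sum>v\<in>V. (if v = x then q x else 0) - (if x = r then sg r else 0) * (sg v * q v))"
      by (intro sum.cong) (auto simp: unit_diff_def algebra_simps)
    also have "\<dots> = q x - (if x = r then sg r else 0) * signed q V"
      unfolding signed_def using x finite_V by (simp add: sum_subtractf sum_distrib_left)
    finally show "deg d x = q x" using q by (simp add: bal_signed)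
  qed
qed

section \<open>Cut sums, generic vectors and alternating cycles\<close>

lemma signed_deg:
  assumes "K \<subseteq> V"
  shows "signed (deg f) K = (\<Sum>e\<in>E. f e * (\<Sum>v\<in>K \<inter> e. sg v))"
  unfolding signed_def using assms finite_V by (intro sum_deg) (auto intro: finite_subset)

lemma sum_sg_edge:
  assumes "e \<in> E"
  shows "e \<subseteq> K \<Longrightarrow> (\<Sum>v\<in>K \<inter> e. sg v) = 0"
    and "e = {x, y} \<Longrightarrow> x \<in> K \<Longrightarrow> y \<notin> K \<Longrightarrow> (\<Sum>v\<in>K \<inter> e. sg v) = sg x"
proof -
  assume "e \<subseteq> K"
  then have "K \<inter> e = e" by auto
  obtain a b where "a \<in> A" "b \<in> B" "e = {a, b}" "a \<noteq> b" "b \<notin> A"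
    using assms by (elim edge_cases') auto
  then show "(\<Sum>v\<in>K \<inter> e. sg v) = 0" unfolding \<open>K \<inter> e = e\<close> by (simp add: sg_def)
next
  assume "e = {x, y}" "x \<in> K" "y \<notin> K"
  then have "K \<inter> e = {x}" by auto
  then show "(\<Sum>v\<in>K \<inter> e. sg v) = sg x" by simp
qed

text \<open>The walls between simplicial cones lie in these hyperplanes. The full vertex set is left
  out because balance makes its signed sum zero.\<close>

definition generic :: "('v \<Rightarrow> int) \<Rightarrow> bool" where
  "generic q \<longleftrightarrow> (\<forall>K. K \<subseteq> V \<and> K \<noteq> {} \<and> K \<noteq> V \<longrightarrow> signed q K \<noteq> 0)"

lemma signed_cong: "(\<And>v. v \<in> K \<Longrightarrow> p v = q v) \<Longrightarrow> signed p K = signed q K"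
  unfolding signed_def by (rule sum.cong) auto

text \<open>If no edge of non-zero weight crossed the cut of \<open>K\<close>, all contributions to
  the signed sum over \<open>K\<close> would cancel edge by edge.\<close>

lemma generic_support:
  assumes "generic q" "\<And>v. v \<in> V \<Longrightarrow> deg f v = q v"
  shows "bicut {e \<in> E. f e \<noteq> 0} V"
  unfolding bicut_def
proof (intro allI impI, rule ccontr)
  fix K assume K: "K \<subseteq> V \<and> K \<noteq> {} \<and> K \<noteq> V"
    and no: "\<not> (\<exists>x\<in>K. \<exists>y\<in>V - K. {x, y} \<in> {e \<in> E. f e \<noteq> 0})"
  have "signed (deg f) K = 0"
    unfolding signed_deg[OF conjunct1[OF K]]
  proof (intro sum.neutral ballI)
    fix e assume e: "e \<in> E"
    then obtain a b where ab: "e = {a, b}" "a \<in> V" "b \<in> V" by (auto elim!: edge_cases' simp: V_def)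
    have "f e = 0" if "{k, l} = e" "k \<in> K" "l \<in> V - K" for k l using no e that by blast
    then have "f e = 0 \<or> e \<subseteq> K \<or> K \<inter> e = {}" using ab by blast
    then show "f e * (\<Sum>v\<in>K \<inter> e. sg v) = 0" using sum_sg_edge(1)[OF e] by auto
  qed
  moreover have "signed (deg f) K = signed q K" using assms(2) K by (intro signed_cong) auto
  ultimately show False using assms(1) K by (auto simp: generic_def)
qed

definition circulation :: "('v set \<Rightarrow> int) \<Rightarrow> bool" where
  "circulation z \<longleftrightarrow> (\<forall>v\<in>V. deg z v = 0) \<and> (\<forall>e. e \<notin> E \<longrightarrow> z e = 0)"

text \<open>The last clause on \<open>e\<close> records the direction in which the edge is
  traversed, towards a vertex other than the first one. This later keeps a given edge off the
  path.\<close>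

lemma path_flow:
  assumes "xs \<noteq> []" "distinct xs" "successively (\<lambda>a b. {a, b} \<in> E \<and> s {a, b} = sg a) xs"
  shows "\<exists>c. (\<forall>e. c e \<noteq> 0 \<longrightarrow> e \<in> E \<and> e \<subseteq> set xs \<and> c e = s e \<and>
      (\<exists>a b. e = {a, b} \<and> s e = sg a \<and> b \<in> set (tl xs))) \<and> (\<forall>v. deg c v = unit_diff (hd xs) (last xs) v)"
  using assms
proof (induction xs)
  case Nil then show ?case by simp
next
  case (Cons x ys)
  show ?case
  proof (cases ys)
    case Nil
    then show ?thesis by (intro exI[of _ "\<lambda>e. 0"]) (auto simp: unit_diff_def)
  next
    case (Cons y zs)
    have xy: "{x, y} \<in> E" "s {x, y} = sg x" using Cons.prems(3) Cons by auto
    obtain c where c: "\<And>e. c e \<noteq> 0 \<Longrightarrow> e \<in> E \<and> e \<subseteq> set ys \<and> c e = s e \<and>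
        (\<exists>a b. e = {a, b} \<and> s e = sg a \<and> b \<in> set (tl ys))" "\<And>v. deg c v = unit_diff y (last ys) v"
      using Cons.IH Cons.prems Cons by (auto simp: successively_Cons)
    have c0: "c {x, y} = 0" using c(1)[of "{x, y}"] Cons.prems(2) by auto
    define d where "d = (\<lambda>e. c e + (if e = {x, y} then sg x else 0))"
    have "deg d v = unit_diff x (last ys) v" for v
      using xy c(2) sg_edge[OF xy(1)] edge_distinct[OF xy(1)]
      by (auto simp: d_def deg_add deg_single unit_diff_def)
    moreover have "e \<in> E \<and> e \<subseteq> set (x # ys) \<and> d e = s e \<and> (\<exists>a b. e = {a, b} \<and> s e = sg a \<and> b \<in> set ys)"
      if "d e \<noteq> 0" for e
    proof (cases "e = {x, y}")
      case True
      then show ?thesis using xy c0 Cons by (auto simp: d_def)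
    next
      case False
      then have "c e \<noteq> 0" "d e = c e" using that by (auto simp: d_def)
      then show ?thesis using c(1)[of e] Cons by auto
    qed
    ultimately show ?thesis unfolding list.sel using Cons by (intro exI[of _ d]) fastforce
  qed
qed

text \<open>Orient each edge of the support of \<open>z\<close> away from the end whose sign is
  \<open>sgn (z e)\<close>. Then \<open>e0\<close> runs from \<open>x\<close> to \<open>y\<close>.
  If \<open>y\<close> could not reach \<open>x\<close>, the set of vertices reachable from
  \<open>y\<close> would have no outgoing edge but the incoming edge \<open>e0\<close>, so its
  signed sum would be negative, although all degrees of \<open>z\<close> vanish. A path from
  \<open>y\<close> to \<open>x\<close> is closed up by \<open>e0\<close>.\<close>

lemma conformal_cycle:
  assumes z: "circulation z" and e0: "z e0 \<noteq> 0"
  obtains c where "circulation c" "\<And>e. c e \<noteq> 0 \<Longrightarrow> c e = sgn (z e)" "c e0 = sgn (z e0)"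
proof -
  have e0E: "e0 \<in> E" using z e0 by (auto simp: circulation_def)
  obtain x y where xy: "e0 = {x, y}" "sg x = sgn (z e0)"
  proof -
    obtain a b where ab: "a \<in> A" "b \<in> B" "e0 = {a, b}" "b \<notin> A" using e0E by (elim edge_cases') auto
    show ?thesis
    proof (cases "z e0 > 0")
      case True then show ?thesis using that[of a b] ab by (auto simp: sg_def)
    next
      case False
      moreover have "e0 = {b, a}" using ab by auto
      ultimately show ?thesis using that[of b a] ab e0 by (auto simp: sg_def sgn_if)
    qed
  qed
  define r where "r = {(a, b). {a, b} \<in> E \<and> sgn (z {a, b}) = sg a}"
  have xyE: "{x, y} \<in> E" "sg y = - sg x" using xy e0E sg_edge by auto
  then have V: "x \<in> V" "y \<in> V" using edge_subset by auto
  have "(y, x) \<in> r\<^sup>*"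
  proof (rule ccontr)
    assume notin: "(y, x) \<notin> r\<^sup>*"
    define K where "K = {k \<in> V. (y, k) \<in> r\<^sup>*}"
    have K: "K \<subseteq> V" "y \<in> K" "x \<notin> K" using V notin by (auto simp: K_def)
    have "signed (deg z) K = 0" unfolding signed_def using z K by (intro sum.neutral) (auto simp: circulation_def)
    moreover have "signed (deg z) K < (\<Sum>e\<in>E. 0)"
      unfolding signed_deg[OF K(1)]
    proof (rule sum_strict_mono_ex1[OF finite_E])
      show "\<exists>e\<in>E. z e * (\<Sum>v\<in>K \<inter> e. sg v) < 0"
      proof (rule bexI[OF _ e0E])
        have "(\<Sum>v\<in>K \<inter> e0. sg v) = sg y" using sum_sg_edge(2)[OF e0E, of y x] K xy by (auto simp: insert_commute)
        then show "z e0 * (\<Sum>v\<in>K \<inter> e0. sg v) < 0" using xy xyE e0 by (auto simp: mult_less_0_iff sgn_if split: if_splits)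
      qed
    next
      show "\<forall>e\<in>E. z e * (\<Sum>v\<in>K \<inter> e. sg v) \<le> 0"
      proof
        fix e assume e: "e \<in> E"
        then obtain a b where ab: "e = {a, b}" "a \<in> V" "b \<in> V" by (auto elim!: edge_cases' simp: V_def)
        have cross: "z e * (\<Sum>v\<in>K \<inter> e. sg v) \<le> 0" if "e = {k, l}" "k \<in> K" "l \<notin> K" "l \<in> V" for k l
        proof -
          have "(k, l) \<notin> r" using that by (auto simp: K_def dest: rtrancl_into_rtrancl)
          then have "sgn (z e) \<noteq> sg k" using that e by (auto simp: r_def)
          then have "z e * sg k \<le> 0" by (auto simp: sg_def sgn_if split: if_splits)
          then show ?thesis using sum_sg_edge(2)[OF e, of k l] that by auto
        qed
        consider "e \<subseteq> K" | "K \<inter> e = {}" | "a \<in> K" "b \<notin> K" | "b \<in> K" "a \<notin> K" using ab by auto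
        then show "z e * (\<Sum>v\<in>K \<inter> e. sg v) \<le> 0"
        proof cases
          case 1 then show ?thesis using sum_sg_edge(1)[OF e] by simp
        next
          case 2 then show ?thesis by simp
        next
          case 3 then show ?thesis using cross[of a b] ab by simp
        next
          case 4 then show ?thesis using cross[of b a] ab by (simp add: insert_commute)
        qed
      qed
    qed
    ultimately show False by simp
  qed
  then obtain xs where xs: "xs \<noteq> []" "hd xs = y" "last xs = x" "distinct xs" "successively (\<lambda>a b. (a, b) \<in> r) xs"
    by (rule rtrancl_distinct_path)
  have "successively (\<lambda>a b. {a, b} \<in> E \<and> (\<lambda>e. sgn (z e)) {a, b} = sg a) xs" using xs(5) by (simp add: r_def)
  from path_flow[OF xs(1,4) this] obtain c where
    c: "\<And>e. c e \<noteq> 0 \<Longrightarrow> e \<in> E \<and> e \<subseteq> set xs \<and> c e = sgn (z e) \<and>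
      (\<exists>a b. e = {a, b} \<and> sgn (z e) = sg a \<and> b \<in> set (tl xs))" "\<And>v. deg c v = unit_diff y x v"
    using xs by auto
  \<comment> \<open>An edge of the path never ends in its first vertex \<open>y\<close>, so
    \<open>e0\<close> could only be traversed from \<open>y\<close> to \<open>x\<close>, which
    contradicts its sign.\<close>
  have c0: "c e0 = 0"
  proof (rule ccontr)
    assume "c e0 \<noteq> 0"
    then obtain a b where ab: "e0 = {a, b}" "sgn (z e0) = sg a" "b \<in> set (tl xs)" using c(1) by blast
    have "y \<notin> set (tl xs)" using xs by (cases xs) auto
    then have "b \<noteq> y" using ab by auto
    then have "a = y" using ab xy by (auto simp: doubleton_eq_iff)
    then show False using ab xy xyE by auto
  qed
  show ?thesis
  proof (rule that[of "\<lambda>e. c e + (if e = e0 then sgn (z e0) else 0)"])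
    show "circulation (\<lambda>e. c e + (if e = e0 then sgn (z e0) else 0))"
      unfolding circulation_def
    proof (intro conjI ballI allI impI)
      fix v assume "v \<in> V"
      show "deg (\<lambda>e. c e + (if e = e0 then sgn (z e0) else 0)) v = 0"
        using c(2) xy xyE e0E edge_distinct[OF xyE(1)] by (auto simp: deg_add deg_single unit_diff_def)
    next
      fix e assume "e \<notin> E"
      then show "c e + (if e = e0 then sgn (z e0) else 0) = 0" using c(1)[of e] e0E by auto
    qed
  qed (use c(1) c0 in \<open>auto split: if_splits\<close>)
qed

section \<open>Optimal flows and spanning trees\<close>

text \<open>An arbitrary numbering of the edges. It serves as the order for lexicographic comparison
  and as the exponent in the weights \<open>2 ^ rank e\<close>.\<close>

definition rank :: "'v set \<Rightarrow> nat" where "rank = (SOME k. inj_on k E)"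

lemma inj_rank: "inj_on rank E"
  unfolding rank_def using finite_imp_inj_to_nat_seg[OF finite_E] by (metis someI_ex)

lemma sum_powers_less:
  assumes "F \<subseteq> E" "\<And>e. e \<in> F \<Longrightarrow> rank e < n"
  shows "(\<Sum>e\<in>F. 2 ^ rank e) < (2 ^ n :: int)"
proof -
  have "(\<Sum>e\<in>F. 2 ^ rank e) = (\<Sum>i\<in>rank ` F. (2::int) ^ i)"
    using inj_on_subset[OF inj_rank assms(1)] by (simp add: sum.reindex)
  also have "\<dots> \<le> (\<Sum>i\<in>{..<n}. 2 ^ i)" using assms(2) by (intro sum_mono2) auto
  also have "\<dots> = 2 ^ n - 1" by (induction n) auto
  finally show ?thesis by simp
qed

text \<open>Comparing at the edge of highest rank, rather than by total cost, has the advantage that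
  the sign survives the passage to a conformal cycle through that edge.\<close>

definition lexneg :: "('v set \<Rightarrow> int) \<Rightarrow> bool" where
  "lexneg z \<longleftrightarrow> (\<exists>e\<in>E. z e < 0 \<and> (\<forall>e'\<in>E. rank e < rank e' \<longrightarrow> z e' = 0))"

lemma lexneg_cases:
  assumes "e0 \<in> E" "z e0 \<noteq> 0"
  shows "lexneg z \<or> lexneg (\<lambda>e. - z e)"
proof -
  define F where "F = {e \<in> E. z e \<noteq> 0}"
  have "finite (rank ` F)" "rank ` F \<noteq> {}" using assms finite_E by (auto simp: F_def)
  then obtain e where e: "e \<in> F" "rank e = Max (rank ` F)" by (metis Max_in imageE)
  have "z e' = 0" if "e' \<in> E" "rank e < rank e'" for e'
    using Max_ge[OF \<open>finite (rank ` F)\<close>, of "rank e'"] that e by (force simp: F_def)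
  then show ?thesis using e by (auto simp: lexneg_def F_def neq_iff)
qed

text \<open>The leading entry is -1, and distinct ranks give distinct powers, so the remaining terms
  add up to less than the leading power.\<close>

lemma lexneg_cost:
  assumes "lexneg z" "\<And>e. e \<in> E \<Longrightarrow> \<bar>z e\<bar> \<le> 1"
  shows "(\<Sum>e\<in>E. z e * 2 ^ rank e) < 0"
proof -
  obtain e0 where e0: "e0 \<in> E" "z e0 < 0" "\<And>e'. e' \<in> E \<Longrightarrow> rank e0 < rank e' \<Longrightarrow> z e' = 0"
    using assms(1) by (auto simp: lexneg_def)
  define F where "F = {e \<in> E. rank e < rank e0}"
  have "(\<Sum>e\<in>E. z e * 2 ^ rank e) = (\<Sum>e\<in>insert e0 F. z e * 2 ^ rank e)"
  proof (intro sum.mono_neutral_right ballI)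
    fix e assume e: "e \<in> E - insert e0 F"
    then have "rank e \<noteq> rank e0" using inj_onD[OF inj_rank, of e e0] e0 by auto
    then have "rank e0 < rank e" using e by (auto simp: F_def)
    then show "z e * 2 ^ rank e = 0" using e e0(3)[of e] by simp
  qed (use e0 finite_E in \<open>auto simp: F_def\<close>)
  also have "\<dots> = z e0 * 2 ^ rank e0 + (\<Sum>e\<in>F. z e * 2 ^ rank e)"
    using finite_E by (subst sum.insert) (auto simp: F_def)
  also have "\<dots> \<le> - (2 ^ rank e0) + (\<Sum>e\<in>F. 2 ^ rank e)"
  proof (rule add_mono)
    have "z e0 = -1" using e0 assms(2)[of e0] by simp
    then show "z e0 * 2 ^ rank e0 \<le> - (2 ^ rank e0)" by simp
    show "(\<Sum>e\<in>F. z e * 2 ^ rank e) \<le> (\<Sum>e\<in>F. 2 ^ rank e)"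
    proof (rule sum_mono)
      fix e assume "e \<in> F"
      then have "z e \<le> 1" using assms(2)[of e] by (auto simp: F_def)
      then have "z e * 2 ^ rank e \<le> 1 * 2 ^ rank e" by (intro mult_right_mono) auto
      then show "z e * 2 ^ rank e \<le> 2 ^ rank e" by simp
    qed
  qed
  also have "\<dots> < 0"
  proof -
    have "(\<Sum>e\<in>F. 2 ^ rank e) < (2 ^ rank e0 :: int)" by (rule sum_powers_less) (auto simp: F_def)
    then show ?thesis by linarith
  qed
  finally show ?thesis .
qed

definition optimal :: "('v set \<Rightarrow> int) \<Rightarrow> bool" where
  "optimal f \<longleftrightarrow> (\<forall>e. f e \<ge> 0) \<and> (\<forall>e. e \<notin> E \<longrightarrow> f e = 0) \<and>
    \<not> (\<exists>z. circulation z \<and> lexneg z \<and> (\<forall>e\<in>E. f e + z e \<ge> 0))"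

lemma optimalD:
  assumes "optimal f"
  shows "f e \<ge> 0" and "f e \<noteq> 0 \<Longrightarrow> e \<in> E"
    and "circulation z \<Longrightarrow> lexneg z \<Longrightarrow> \<exists>e\<in>E. f e + z e < 0"
  using assms unfolding optimal_def by (blast, blast, meson not_less)

text \<open>A conformal cycle through the leading edge of \<open>z\<close> has the same leading
  sign. Its entries are at most 1 in absolute value, so a single step along it fits into the
  positive integer entries of \<open>f\<close>.\<close>

lemma improving_cycle:
  assumes z: "circulation z" "lexneg z" and f: "\<And>e. e \<in> E \<Longrightarrow> f e \<ge> 0" "\<And>e. e \<in> E \<Longrightarrow> z e < 0 \<Longrightarrow> f e > 0"
  shows "\<exists>c. circulation c \<and> lexneg c \<and> (\<forall>e\<in>E. f e + c e \<ge> 0) \<and> (\<forall>e. \<bar>c e\<bar> \<le> 1)"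
proof -
  obtain e0 where e0: "e0 \<in> E" "z e0 < 0" "\<And>e'. e' \<in> E \<Longrightarrow> rank e0 < rank e' \<Longrightarrow> z e' = 0"
    using z(2) by (auto simp: lexneg_def)
  then have "z e0 \<noteq> 0" by simp
  then obtain c where c: "circulation c" "\<And>e. c e \<noteq> 0 \<Longrightarrow> c e = sgn (z e)" "c e0 = sgn (z e0)"
    using conformal_cycle[OF z(1)] by blast
  show ?thesis
  proof (intro exI[of _ c] conjI ballI allI c(1))
    have "c e' = 0" if "e' \<in> E" "rank e0 < rank e'" for e'
      using c(2)[of e'] e0(3)[OF that] by (cases "c e' = 0") auto
    then show "lexneg c" unfolding lexneg_def using c(3) e0 by (intro bexI[of _ e0]) auto
    show "f e + c e \<ge> 0" if "e \<in> E" for e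
      using c(2)[of e] f(1)[OF that] f(2)[OF that] by (cases "c e = 0") (auto simp: sgn_if split: if_splits)
    show "\<bar>c e\<bar> \<le> 1" for e using c(2)[of e] by (cases "c e = 0") (auto simp: sgn_if)
  qed
qed

text \<open>A weighting of least cost is optimal: any improving circulation could be replaced by a
  cycle with entries bounded by 1, and for these lexicographic descent lowers the cost.\<close>

lemma optimal_exists:
  assumes "hall q"
  obtains f where "optimal f" "\<And>v. v \<in> V \<Longrightarrow> deg f v = q v"
proof -
  define P where "P = (\<lambda>f. (\<forall>e. f e \<ge> 0) \<and> (\<forall>e. e \<notin> E \<longrightarrow> f e = 0) \<and> (\<forall>v\<in>V. deg f v = q v))"
  define cost where "cost = (\<lambda>f :: 'v set \<Rightarrow> int. \<Sum>e\<in>E. f e * 2 ^ rank e)"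
  obtain f0 where "P f0" using hall_flow[OF assms] unfolding P_def by (metis order_refl)
  then obtain f where f: "P f" "\<And>g. P g \<Longrightarrow> nat (cost f) \<le> nat (cost g)"
    using ex_has_least_nat[of P f0 "nat \<circ> cost"] by auto
  have pos: "cost g \<ge> 0" if "P g" for g
    unfolding cost_def using that by (intro sum_nonneg) (auto simp: P_def)
  have "optimal f" unfolding optimal_def
  proof (intro conjI allI impI notI)
    assume "\<exists>z. circulation z \<and> lexneg z \<and> (\<forall>e\<in>E. f e + z e \<ge> 0)"
    then obtain z where z: "circulation z" "lexneg z" "\<And>e. e \<in> E \<Longrightarrow> f e + z e \<ge> 0" by blast
    have f0: "f e \<ge> 0" "e \<notin> E \<Longrightarrow> f e = 0" for e using f(1) by (auto simp: P_def)
    have "f e > 0" if "e \<in> E" "z e < 0" for e using z(3)[OF that(1)] that(2) by simp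
    from improving_cycle[where f = f, OF z(1,2) f0(1) this]
    obtain c where c: "circulation c" "lexneg c" "\<And>e. e \<in> E \<Longrightarrow> f e + c e \<ge> 0" "\<And>e. \<bar>c e\<bar> \<le> 1" by blast
    have out: "c e = 0" if "e \<notin> E" for e using c(1) that by (auto simp: circulation_def)
    have "P (\<lambda>e. f e + c e)" unfolding P_def
    proof (intro conjI allI impI ballI)
      show "0 \<le> f e + c e" for e by (cases "e \<in> E") (use c(3) f0 out in auto)
    qed (use f(1) c(1) in \<open>auto simp: P_def circulation_def deg_add\<close>)
    moreover have "cost (\<lambda>e. f e + c e) < cost f"
      using lexneg_cost[OF c(2)] c(4) by (simp add: cost_def algebra_simps sum.distrib)
    ultimately show False using f(2)[of "\<lambda>e. f e + c e"] pos by fastforce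
  qed (use f(1) in \<open>auto simp: P_def\<close>)
  then show ?thesis using that f(1) by (auto simp: P_def)
qed

lemma optimal_unique:
  assumes "optimal f" "optimal g" "\<And>v. v \<in> V \<Longrightarrow> deg f v = deg g v"
  shows "f = g"
proof (rule ccontr)
  assume "f \<noteq> g"
  then obtain e0 where e0: "f e0 \<noteq> g e0" by blast
  then have "e0 \<in> E" using assms(1,2) by (auto simp: optimal_def)
  have circ: "circulation (\<lambda>e. g e - f e)" "circulation (\<lambda>e. f e - g e)"
    using assms by (auto simp: circulation_def deg_diff optimal_def)
  have "lexneg (\<lambda>e. g e - f e) \<or> lexneg (\<lambda>e. - (g e - f e))"
    using lexneg_cases[OF \<open>e0 \<in> E\<close>, of "\<lambda>e. g e - f e"] e0 by auto
  then show False
  proof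
    assume "lexneg (\<lambda>e. g e - f e)"
    then show False using optimalD(3)[OF assms(1) circ(1)] optimalD(1)[OF assms(2)] by (auto simp flip: not_less)
  next
    assume "lexneg (\<lambda>e. - (g e - f e))"
    then have "lexneg (\<lambda>e. f e - g e)" by simp
    then show False using optimalD(3)[OF assms(2) circ(2)] optimalD(1)[OF assms(1)] by (auto simp flip: not_less)
  qed
qed

text \<open>Only zeros of \<open>f\<close> can block an improving circulation, not its size.
  Inheritance by subsupports and acyclicity of supports both rest on this.\<close>

lemma optimal_no_cycle:
  assumes "optimal f" "circulation z" "lexneg z"
  shows "\<exists>e\<in>E. z e < 0 \<and> f e = 0"
proof (rule ccontr)
  assume no: "\<not> ?thesis"
  have f: "f e \<ge> 0" if "e \<in> E" for e using assms(1) by (auto simp: optimal_def)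
  have "f e > 0" if "e \<in> E" "z e < 0" for e using no f that by (metis order_le_less)
  from improving_cycle[where f = f, OF assms(2,3) f this]
  obtain c where "circulation c" "lexneg c" "\<And>e. e \<in> E \<Longrightarrow> f e + c e \<ge> 0" by blast
  then show False using assms(1) by (auto simp: optimal_def)
qed

lemma optimal_subsupport:
  assumes "optimal f" "\<And>e. g e \<ge> 0" "\<And>e. g e \<noteq> 0 \<Longrightarrow> f e \<noteq> 0"
  shows "optimal g"
  unfolding optimal_def
proof (intro conjI allI impI notI)
  show "g e \<ge> 0" for e by fact
  show "g e = 0" if "e \<notin> E" for e using that assms by (auto simp: optimal_def)
  assume "\<exists>z. circulation z \<and> lexneg z \<and> (\<forall>e\<in>E. g e + z e \<ge> 0)"
  then obtain z where z: "circulation z" "lexneg z" "\<And>e. e \<in> E \<Longrightarrow> g e + z e \<ge> 0" by blast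
  then obtain e where e: "e \<in> E" "z e < 0" "f e = 0" using optimal_no_cycle[OF assms(1)] by blast
  then show False using z(3)[of e] assms(3)[of e] by fastforce
qed

lemma optimal_independent:
  assumes "optimal f" "circulation z" "\<And>e. z e \<noteq> 0 \<Longrightarrow> f e \<noteq> 0"
  shows "z = (\<lambda>e. 0)"
proof (rule ccontr)
  assume "z \<noteq> (\<lambda>e. 0)"
  then obtain e0 where "z e0 \<noteq> 0" by auto
  moreover from this have "e0 \<in> E" using assms(2) by (auto simp: circulation_def)
  moreover have "circulation (\<lambda>e. - z e)" using assms(2) by (auto simp: circulation_def deg_uminus)
  ultimately show False
    using lexneg_cases[of e0 z] optimal_no_cycle[OF assms(1)] assms(2,3) by force
qed

text \<open>Genericity makes these supports connected, optimality makes them acyclic.\<close>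

definition trees :: "'v set set set" where
  "trees = {{e \<in> E. f e \<noteq> 0} |f. optimal f \<and> generic (deg f)}"

lemma trees_subset: "T \<in> trees \<Longrightarrow> T \<subseteq> E" by (auto simp: trees_def)

lemma finite_trees: "finite trees"
  by (rule finite_subset[of _ "Pow E"]) (use trees_subset finite_E in auto)

lemma trees_bicut: "T \<in> trees \<Longrightarrow> bicut T V"
  using generic_support by (auto simp: trees_def)

lemma trees_independent:
  assumes "T \<in> trees" "circulation z" "\<And>e. z e \<noteq> 0 \<Longrightarrow> e \<in> T"
  shows "z = (\<lambda>e. 0)"
  using assms optimal_independent by (auto simp: trees_def)

lemma trees_optimal:
  assumes "T \<in> trees" "\<And>e. g e \<ge> 0" "\<And>e. g e \<noteq> 0 \<Longrightarrow> e \<in> T"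
  shows "optimal g"
proof -
  obtain f where "optimal f" "T = {e \<in> E. f e \<noteq> 0}" using assms(1) by (auto simp: trees_def)
  then show ?thesis using optimal_subsupport[of f g] assms(2,3) by auto
qed

end

section \<open>Integer coordinates with respect to a spanning tree\<close>

context connected_bipartite begin

text \<open>Existence comes from \<open>bicut_generates\<close> and uniqueness from
  \<open>trees_independent\<close>: a tree is a lattice basis of the balanced vectors, so no
  denominators occur.\<close>

definition coord :: "'v set set \<Rightarrow> ('v \<Rightarrow> int) \<Rightarrow> 'v set \<Rightarrow> int" where
  "coord T q = (SOME c. (\<forall>e. c e \<noteq> 0 \<longrightarrow> e \<in> T) \<and> (\<forall>v\<in>V. deg c v = q v))"

lemma bicut_generates:
  assumes "bicut T V" "T \<subseteq> E" "bal q"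
  shows "\<exists>c. (\<forall>e. c e \<noteq> 0 \<longrightarrow> e \<in> T) \<and> (\<forall>v\<in>V. deg c v = q v)"
proof -
  obtain r where "r \<in> V" using A_nonempty by (auto simp: V_def)
  then show ?thesis using linked_generates[of T q r] bicut_linked[OF assms(1,2)] assms(3) by metis
qed

lemma coord:
  assumes "T \<in> trees" "bal q"
  shows "coord T q e \<noteq> 0 \<Longrightarrow> e \<in> T" and "v \<in> V \<Longrightarrow> deg (coord T q) v = q v"
  using someI_ex[OF bicut_generates[OF trees_bicut[OF assms(1)] trees_subset[OF assms(1)] assms(2)]]
  unfolding coord_def[symmetric] by blast+

lemma tree_flow_unique:
  assumes T: "T \<in> trees" and "\<And>e. c e \<noteq> 0 \<Longrightarrow> e \<in> T" "\<And>e. d e \<noteq> 0 \<Longrightarrow> e \<in> T"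
    and "\<And>v. v \<in> V \<Longrightarrow> deg c v = deg d v"
  shows "c = d"
proof -
  have "circulation (\<lambda>e. c e - d e)" unfolding circulation_def
  proof (intro conjI ballI allI impI)
    show "deg (\<lambda>e. c e - d e) v = 0" if "v \<in> V" for v using assms(4)[OF that] by (simp add: deg_diff)
    show "c e - d e = 0" if "e \<notin> E" for e
      using assms(2,3)[of e] trees_subset[OF T] that by (cases "c e = 0"; cases "d e = 0") auto
  qed
  moreover have "e \<in> T" if "c e - d e \<noteq> 0" for e
    using assms(2,3)[of e] that by (cases "c e = 0") auto
  ultimately have "(\<lambda>e. c e - d e) = (\<lambda>e. 0)" by (rule trees_independent[OF T])
  then have "c e - d e = 0" for e by (rule fun_cong)
  then show ?thesis by (simp add: fun_eq_iff)
qed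

lemma coord_unique:
  assumes "T \<in> trees" "bal q" "\<And>e. c e \<noteq> 0 \<Longrightarrow> e \<in> T" "\<And>v. v \<in> V \<Longrightarrow> deg c v = q v"
  shows "coord T q = c"
  using tree_flow_unique[OF assms(1), of "coord T q" c] coord[OF assms(1,2)] assms(3,4) by auto

lemma coord_linear:
  assumes "T \<in> trees" "bal p" "bal w"
  shows "coord T (\<lambda>v. N * p v + w v) e = N * coord T p e + coord T w e"
proof -
  have "bal (\<lambda>v. N * p v + w v)" using assms by (simp add: bal_def sum.distrib flip: sum_distrib_left)
  moreover have "e \<in> T" if "N * coord T p e + coord T w e \<noteq> 0" for e
    using coord(1)[OF assms(1,2), of e] coord(1)[OF assms(1,3), of e] that by (cases "coord T p e = 0") auto
  ultimately have "coord T (\<lambda>v. N * p v + w v) = (\<lambda>e. N * coord T p e + coord T w e)"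
    using coord(2)[OF assms(1,2)] coord(2)[OF assms(1,3)]
    by (intro coord_unique[OF assms(1)]) (auto simp: deg_add deg_mult)
  then show ?thesis by simp
qed

text \<open>If the coordinate at \<open>e\<close> vanished, the support of the others would still
  meet every cut and hence generate the degree vector of \<open>e\<close> itself, against
  independence of the tree.\<close>

lemma coord_generic:
  assumes T: "T \<in> trees" and q: "bal q" "generic q" and e: "e \<in> T"
  shows "coord T q e \<noteq> 0"
proof
  assume 0: "coord T q e = 0"
  define S where "S = {e \<in> E. coord T q e \<noteq> 0}"
  have "bicut S V" unfolding S_def using q coord[OF T q(1)] by (intro generic_support[of q])
  moreover have S: "S \<subseteq> T" "e \<notin> S" using 0 coord(1)[OF T q(1)] by (auto simp: S_def)
  ultimately obtain c where c: "\<And>e. c e \<noteq> 0 \<Longrightarrow> e \<in> S"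
    "\<And>v. v \<in> V \<Longrightarrow> deg c v = deg (\<lambda>e'. if e' = e then 1 else 0) v"
    using bicut_generates[of S "deg (\<lambda>e'. if e' = e then 1 else 0)"] bal_deg trees_subset[OF T] by blast
  have "c = (\<lambda>e'. if e' = e then 1 else 0)"
    using c S e by (intro tree_flow_unique[OF T]) (auto split: if_splits)
  then show False using c(1)[of e] S by auto
qed

lemma cone_exists:
  assumes "hall q" "generic q"
  obtains T where "T \<in> trees" "\<And>e. coord T q e \<ge> 0"
proof -
  obtain f where f: "optimal f" "\<And>v. v \<in> V \<Longrightarrow> deg f v = q v" using optimal_exists[OF assms(1)] by blast
  have "signed (deg f) K = signed q K" if "K \<subseteq> V" for K using f(2) that by (intro signed_cong) auto
  then have "generic (deg f)" using assms(2) by (simp add: generic_def)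
  then have T: "{e \<in> E. f e \<noteq> 0} \<in> trees" using f(1) by (auto simp: trees_def)
  have "bal q" using assms(1) by (simp add: hall_def)
  then have "coord {e \<in> E. f e \<noteq> 0} q = f" using f by (intro coord_unique[OF T]) (auto simp: optimal_def)
  then show ?thesis using that[OF T] f(1) by (auto simp: optimal_def)
qed

text \<open>Both coordinate functions are optimal weightings for the same vector, hence equal, and
  by genericity each tree is exactly the support of its coordinate function.\<close>

lemma cone_unique:
  assumes q: "bal q" "generic q" and T: "T \<in> trees" "\<And>e. coord T q e \<ge> 0"
    and T': "T' \<in> trees" "\<And>e. coord T' q e \<ge> 0"
  shows "T = T'"
proof -
  have "coord T q = coord T' q"
    using coord[OF T(1) q(1)] coord[OF T'(1) q(1)] trees_optimal T T' by (intro optimal_unique) auto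
  moreover have "T = {e. coord T q e \<noteq> 0}" using coord_generic[OF T(1) q] coord(1)[OF T(1) q(1)] by auto
  moreover have "T' = {e. coord T' q e \<noteq> 0}" using coord_generic[OF T'(1) q] coord(1)[OF T'(1) q(1)] by auto
  ultimately show ?thesis by simp
qed

end

section \<open>Half-open decomposition and the \<open>h\<close>-polynomial\<close>

text \<open>Coordinates of the lattice points on level \<open>n\<close> of a half-open simplicial
  cone; the members of \<open>I\<close> are the edges whose facet is removed. Integer values allow
  direct comparison with \<open>coord\<close>.\<close>

definition compositions :: "'a set \<Rightarrow> 'a set \<Rightarrow> nat \<Rightarrow> ('a \<Rightarrow> int) set" where
  "compositions T I n =
    {c. (\<forall>e. c e \<ge> 0) \<and> (\<forall>e. c e \<noteq> 0 \<longrightarrow> e \<in> T) \<and> (\<forall>e\<in>I. c e \<ge> 1) \<and> sum c T = int n}"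

lemma finite_compositions: assumes "finite T" shows "finite (compositions T I n)"
proof (rule finite_subset)
  show "compositions T I n \<subseteq> {c. \<forall>e. (e \<in> T \<longrightarrow> c e \<in> {0..int n}) \<and> (e \<notin> T \<longrightarrow> c e = 0)}"
  proof
    fix c assume c: "c \<in> compositions T I n"
    have "c e \<le> int n" if "e \<in> T" for e
      using member_le_sum[of e T c] that c assms by (auto simp: compositions_def)
    then show "c \<in> {c. \<forall>e. (e \<in> T \<longrightarrow> c e \<in> {0..int n}) \<and> (e \<notin> T \<longrightarrow> c e = 0)}"
      using c by (auto simp: compositions_def)
  qed
  show "finite {c. \<forall>e. (e \<in> T \<longrightarrow> c e \<in> {0..int n}) \<and> (e \<notin> T \<longrightarrow> c e = 0)}"
    using assms by (intro finite_set_of_finite_funs) auto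
qed

lemma card_compositions_shift:
  assumes T: "finite T" and x: "x \<in> T" "x \<notin> I"
  shows "card (compositions T (insert x I) n) = (if n = 0 then 0 else card (compositions T I (n - 1)))"
proof (cases n)
  case 0
  have False if "c \<in> compositions T (insert x I) 0" for c
    using that member_le_sum[of x T c] T x by (auto simp: compositions_def)
  then have "compositions T (insert x I) 0 = {}" by blast
  then show ?thesis using 0 by simp
next
  case (Suc m)
  have sum1: "(\<Sum>e\<in>T. c e + (if e = x then k else 0)) = sum c T + (k::int)" for c k
    using T x by (simp add: sum.distrib)
  have "bij_betw (\<lambda>c e. c e + (if e = x then 1 else 0)) (compositions T I m) (compositions T (insert x I) n)"
  proof (rule bij_betw_byWitness[where f' = "\<lambda>c e. c e + (if e = x then -1 else 0)"])
    show "(\<lambda>c e. c e + (if e = x then 1 else 0)) ` compositions T I m \<subseteq> compositions T (insert x I) n"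
      using x Suc by (auto simp: compositions_def sum1 split: if_splits)
    show "(\<lambda>c e. c e + (if e = x then -1 else 0)) ` compositions T (insert x I) n \<subseteq> compositions T I m"
      using x Suc by (auto simp: compositions_def sum1 split: if_splits)
  qed auto
  then show ?thesis using Suc by (simp add: bij_betw_same_card)
qed

lemma card_compositions_insert:
  assumes T: "finite T" and x: "x \<notin> T" "I \<subseteq> T"
  shows "card (compositions (insert x T) I n) =
    card (compositions T I n) + card (compositions (insert x T) (insert x I) n)"
proof -
  have 1: "sum c (insert x T) = c x + sum c T" for c :: "'a \<Rightarrow> int" using T x by simp
  have "compositions (insert x T) I n = compositions T I n \<union> compositions (insert x T) (insert x I) n"
  proof (intro equalityI subsetI)
    fix c assume c: "c \<in> compositions (insert x T) I n"
    then have "c x \<ge> 0" by (auto simp: compositions_def)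
    then show "c \<in> compositions T I n \<union> compositions (insert x T) (insert x I) n"
      using c by (cases "c x = 0") (auto simp: compositions_def 1)
  next
    fix c assume c: "c \<in> compositions T I n \<union> compositions (insert x T) (insert x I) n"
    moreover have "c x = 0" if "c \<in> compositions T I n" using that x by (auto simp: compositions_def)
    ultimately show "c \<in> compositions (insert x T) I n" by (auto simp: compositions_def 1)
  qed
  moreover have "compositions T I n \<inter> compositions (insert x T) (insert x I) n = {}"
    using x by (force simp: compositions_def)
  ultimately show ?thesis using T by (simp add: card_Un_disjoint finite_compositions)
qed

lemma card_compositions:
  assumes "finite T" "I \<subseteq> T"
  shows "card (compositions T I n) = (if card I \<le> n then card (compositions T {} (n - card I)) else 0)"
proof -
  have "finite I" using assms finite_subset by blast
  then show ?thesis using assms(2)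
  proof (induction I arbitrary: n)
    case empty then show ?case by simp
  next
    case (insert x I)
    then show ?case using card_compositions_shift[OF assms(1), of x I n]
      by (cases n) auto
  qed
qed

lemma compositions_0: "finite T \<Longrightarrow> compositions T {} 0 = {\<lambda>e. 0}"
  by (auto simp: compositions_def sum_nonneg_eq_0_iff) (metis ext)

lemma fps_compositions_empty:
  assumes "finite T"
  shows "Abs_fps (\<lambda>n. of_nat (card (compositions T {} n))) * (1 - fps_X) ^ card T = (1 :: rat fps)"
  using assms
proof (induction T)
  case empty
  have "compositions {} {} n = (if n = 0 then {\<lambda>e. 0} else {} :: ('a \<Rightarrow> int) set)" for n
    by (auto simp: compositions_def)
  then show ?case by (auto simp: fps_eq_iff)
next
  case (insert x T)
  define F where "F = (\<lambda>T :: 'a set. Abs_fps (\<lambda>n. of_nat (card (compositions T {} n))) :: rat fps)"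
  have "F (insert x T) = F T + fps_X * F (insert x T)"
    using insert card_compositions_insert[of T x "{}"] card_compositions_shift[of "insert x T" x "{}"]
    by (auto simp: F_def fps_eq_iff)
  then have "F (insert x T) * (1 - fps_X) = F T" by (simp add: algebra_simps)
  then show ?case using insert by (simp add: F_def mult.assoc[symmetric])
qed

lemma fps_compositions:
  assumes "finite T" "I \<subseteq> T"
  shows "Abs_fps (\<lambda>n. of_nat (card (compositions T I n))) * (1 - fps_X) ^ card T = (fps_X ^ card I :: rat fps)"
proof -
  have "Abs_fps (\<lambda>n. of_nat (card (compositions T I n))) =
      fps_X ^ card I * Abs_fps (\<lambda>n. of_nat (card (compositions T {} n)) :: rat)"
    using card_compositions[OF assms] by (auto simp: fps_eq_iff fps_X_power_mult_nth)
  then show ?thesis using fps_compositions_empty[OF assms(1)] by (simp add: mult.assoc)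
qed

context connected_bipartite begin

text \<open>Reducing modulo 2 the bijection between integer weightings of \<open>T\<close> and balanced vectors turns the
  comparison of ranks into counting subsets.\<close>

lemma card_tree:
  assumes T: "T \<in> trees"
  shows "card T = card V - 1"
proof -
  obtain r where r: "r \<in> V" using A_nonempty by (auto simp: V_def)
  define W where "W = V - {r}"
  define ch :: "'v set set \<Rightarrow> 'v set \<Rightarrow> int" where "ch = (\<lambda>S e. if e \<in> S then 1 else 0)"
  \<comment> \<open>Parities of degrees, with the root left out: balance determines the parity
    there.\<close>
  define \<Phi> where "\<Phi> = (\<lambda>S. {v \<in> W. odd (deg (ch S) v)})"
  have finT: "finite T" using trees_subset[OF T] finite_E finite_subset by blast
  have "inj_on \<Phi> (Pow T)"
  proof (rule inj_onI)
    fix S S' assume SS: "S \<in> Pow T" "S' \<in> Pow T" "\<Phi> S = \<Phi> S'"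
    define z where "z = (\<lambda>e. ch S e - ch S' e)"
    have zT: "z e \<noteq> 0 \<Longrightarrow> e \<in> T" for e using SS by (auto simp: z_def ch_def split: if_splits)
    have even_W: "even (deg z v)" if "v \<in> W" for v
      using SS(3) that by (auto simp: \<Phi>_def z_def deg_diff set_eq_iff)
    have "signed (deg z) V = 0" using bal_deg bal_signed by blast
    then have "sg r * deg z r + (\<Sum>v\<in>W. sg v * deg z v) = 0"
      unfolding signed_def W_def using r finite_V by (simp add: sum.remove)
    moreover have "even (\<Sum>v\<in>W. sg v * deg z v)" using even_W by (intro dvd_sum) auto
    ultimately have "even (deg z r)" by (auto simp: sg_def split: if_splits) (metis add.inverse_inverse add_eq_0_iff dvd_minus_iff)+
    then have ev: "even (deg z v)" if "v \<in> V" for v using that even_W by (cases "v = r") (auto simp: W_def)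
    \<comment> \<open>Half of the degree vector of \<open>z\<close> is balanced and so has integer
      coordinates on \<open>T\<close>. By uniqueness \<open>z\<close> is twice these, and as its
      entries lie between -1 and 1, they vanish.\<close>
    define q where "q = (\<lambda>v. deg z v div 2)"
    have dq: "deg z v = 2 * q v" if "v \<in> V" for v using ev[OF that] by (simp add: q_def)
    have "sum (deg z) A = 2 * sum q A" "sum (deg z) B = 2 * sum q B"
      using dq by (auto simp: sum_distrib_left V_def intro!: sum.cong)
    then have bq: "bal q" using bal_deg[of z] by (simp add: bal_def)
    have "z = (\<lambda>e. 2 * coord T q e)"
      using coord[OF T bq] dq zT by (intro tree_flow_unique[OF T]) (auto simp: deg_mult)
    then have "even (z e)" for e by simp
    moreover have "z e \<in> {-1, 0, 1}" for e by (auto simp: z_def ch_def)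
    ultimately have "z e = 0" for e by (metis empty_iff even_minus insert_iff odd_one)
    then show "S = S'" by (auto simp: z_def ch_def set_eq_iff split: if_splits) (metis zero_neq_one eq_iff_diff_eq_0)+
  qed
  moreover have "\<Phi> ` Pow T = Pow W"
  proof (intro equalityI subsetI)
    fix Y assume "Y \<in> \<Phi> ` Pow T" then show "Y \<in> Pow W" by (auto simp: \<Phi>_def)
  next
    fix Y assume "Y \<in> Pow W"
    then have Y: "Y \<subseteq> W" by simp
    \<comment> \<open>The indicator of \<open>Y\<close>, completed at the root so as to become
      balanced; the odd coordinates of this vector form the preimage of \<open>Y\<close>.\<close>
    define q where "q = (\<lambda>v. if v = r then - sg r * sum sg Y else if v \<in> Y then 1 else 0)"
    have "signed q V = sg r * q r + (\<Sum>v\<in>W. sg v * q v)"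
      unfolding signed_def W_def using r finite_V by (simp add: sum.remove)
    also have "(\<Sum>v\<in>W. sg v * q v) = (\<Sum>v\<in>W. if v \<in> Y then sg v else 0)"
      by (intro sum.cong) (auto simp: q_def W_def)
    also have "\<dots> = sum sg Y" using Y finite_V
      by (intro sum.mono_neutral_cong_right) (auto simp: W_def)
    finally have bq: "bal q" by (simp add: bal_signed q_def)
    define S where "S = {e \<in> T. odd (coord T q e)}"
    have "even (coord T q e - ch S e)" for e
      using coord(1)[OF T bq, of e] by (cases "coord T q e = 0") (auto simp: ch_def S_def)
    then have "even (deg (\<lambda>e. coord T q e - ch S e) v)" for v
      unfolding deg_def by (intro dvd_sum) auto
    then have "odd (deg (ch S) v) \<longleftrightarrow> odd (q v)" if "v \<in> V" for v
      using coord(2)[OF T bq that] by (simp add: deg_diff) (metis even_diff)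
    then have "\<Phi> S = Y" using Y by (auto simp: \<Phi>_def W_def q_def split: if_splits)
    moreover have "S \<in> Pow T" by (auto simp: S_def)
    ultimately show "Y \<in> \<Phi> ` Pow T" by blast
  qed
  ultimately have "card (Pow T) = card (Pow W)" by (metis card_image)
  then have "card T = card W" using finT finite_V by (simp add: card_Pow W_def)
  then show ?thesis using r finite_V by (simp add: W_def)
qed

section \<open>Pushing lattice points in a generic direction\<close>

definition wt :: "'v \<Rightarrow> int" where "wt = deg (\<lambda>e. 2 ^ rank e)"

lemma bal_wt: "bal wt" unfolding wt_def by (rule bal_deg)

lemma interior_wt: "interior wt"
  by (rule interior_if_positive_flow[of 1 "\<lambda>e. 2 ^ rank e"]) (auto simp: wt_def)

text \<open>The signed sum over \<open>K\<close> is a sum of powers \<open>2 ^ rank e\<close> with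
  coefficients -1, 0 and 1 that are non-zero on the edges across the cut. By connectedness there is
  such an edge, and the highest power cannot be cancelled.\<close>

lemma generic_wt: "generic wt"
  unfolding generic_def
proof (intro allI impI notI)
  fix K assume K: "K \<subseteq> V \<and> K \<noteq> {} \<and> K \<noteq> V" and 0: "signed wt K = 0"
  define z where "z = (\<lambda>e. \<Sum>v\<in>K \<inter> e. sg v)"
  have sum0: "(\<Sum>e\<in>E. z e * 2 ^ rank e) = 0"
    using 0 signed_deg[of K] K by (simp add: wt_def z_def mult.commute)
  have zle: "\<bar>z e\<bar> \<le> 1" if e: "e \<in> E" for e
  proof -
    obtain a b where ab: "e = {a, b}" using e by (elim edge_cases') auto
    consider "e \<subseteq> K" | "K \<inter> e = {}" | "a \<in> K" "b \<notin> K" | "b \<in> K" "a \<notin> K" using ab by auto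
    then show ?thesis
    proof cases
      case 1 then show ?thesis using sum_sg_edge(1)[OF e] by (simp add: z_def)
    next
      case 2 then show ?thesis by (simp add: z_def)
    next
      case 3 then show ?thesis using sum_sg_edge(2)[OF e ab] by (simp add: z_def sg_def)
    next
      case 4
      then have "z e = sg b" unfolding z_def using ab by (intro sum_sg_edge(2)[OF e]) auto
      then show ?thesis by (simp add: sg_def)
    qed
  qed
  obtain x y where xy: "x \<in> K" "y \<notin> K" "{x, y} \<in> E" using bicutD[OF connected, of K] K by auto
  then have "z {x, y} \<noteq> 0" using sum_sg_edge(2)[OF xy(3) refl xy(1,2)] by (simp add: z_def)
  then consider "lexneg z" | "lexneg (\<lambda>e. - z e)" using lexneg_cases[OF xy(3), of z] by blast
  then show False
  proof cases
    case 1 then show False using lexneg_cost[OF 1] zle sum0 by simp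
  next
    case 2 then show False using lexneg_cost[OF 2] zle sum0 by (simp add: sum_negf)
  qed
qed

text \<open>Exceeds all tree coordinates of \<open>wt\<close> and all its sums over vertex sets,
  signed or not. Thus \<open>big * p + \<sigma> * wt\<close> behaves like \<open>p\<close> moved by
  an infinitesimal amount.\<close>

definition big :: int where
  "big = 1 + (\<Sum>T\<in>trees. \<Sum>e\<in>E. \<bar>coord T wt e\<bar>) + (\<Sum>v\<in>V. \<bar>wt v\<bar>)"

lemma big_pos: "big > 0"
  unfolding big_def by (intro add_pos_nonneg sum_nonneg) auto

lemma coord_less_big:
  assumes "T \<in> trees" shows "\<bar>coord T wt e\<bar> < big"
proof (cases "e \<in> E")
  case True
  have "\<bar>coord T wt e\<bar> \<le> (\<Sum>e\<in>E. \<bar>coord T wt e\<bar>)" using True finite_E by (intro member_le_sum) auto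
  moreover have "\<dots> \<le> (\<Sum>T\<in>trees. \<Sum>e\<in>E. \<bar>coord T wt e\<bar>)"
    using assms finite_trees by (intro member_le_sum[of T trees "\<lambda>T. \<Sum>e\<in>E. \<bar>coord T wt e\<bar>"] sum_nonneg) auto
  moreover have "\<dots> < big" unfolding big_def by (simp add: add_pos_nonneg sum_nonneg)
  ultimately show ?thesis by linarith
next
  case False
  then have "coord T wt e = 0" using coord(1)[OF assms bal_wt] trees_subset[OF assms] by blast
  then show ?thesis using big_pos by simp
qed

lemma sum_less_big:
  assumes "K \<subseteq> V" "\<And>v. \<bar>s v\<bar> \<le> 1" shows "\<bar>\<Sum>v\<in>K. s v * wt v\<bar> < big"
proof -
  have "\<bar>\<Sum>v\<in>K. s v * wt v\<bar> \<le> (\<Sum>v\<in>K. \<bar>wt v\<bar>)"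
  proof (rule order.trans[OF sum_abs sum_mono])
    fix v
    have "\<bar>s v\<bar> * \<bar>wt v\<bar> \<le> 1 * \<bar>wt v\<bar>" by (intro mult_right_mono assms) auto
    then show "\<bar>s v * wt v\<bar> \<le> \<bar>wt v\<bar>" by (simp add: abs_mult)
  qed
  moreover have "\<dots> \<le> (\<Sum>v\<in>V. \<bar>wt v\<bar>)" using assms(1) finite_V by (intro sum_mono2) auto
  moreover have "\<dots> < big" unfolding big_def by (simp add: add_pos_nonneg sum_nonneg)
  ultimately show ?thesis by linarith
qed

lemma signed_less_big: "K \<subseteq> V \<Longrightarrow> \<bar>signed wt K\<bar> < big"
  unfolding signed_def by (rule sum_less_big) (auto simp: sg_def)

lemma sum_wt_less_big: "K \<subseteq> V \<Longrightarrow> sum wt K < big"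
  using sum_less_big[of K "\<lambda>v. 1"] by simp

lemma wt_pos: "v \<in> V \<Longrightarrow> wt v > 0" using interior_wt by (auto simp: interior_def)

lemma sum_wt_nonneg: "K \<subseteq> V \<Longrightarrow> sum wt K \<ge> 0"
  using wt_pos by (intro sum_nonneg) (auto intro: less_imp_le)

lemma big_mult: "big * x + y \<ge> 0 \<Longrightarrow> y < big \<Longrightarrow> x \<ge> 0"
  using mult_left_mono[of x "-1" big] big_pos by (cases "x \<ge> 0") auto

definition shifted :: "int \<Rightarrow> ('v \<Rightarrow> int) \<Rightarrow> 'v \<Rightarrow> int" where
  "shifted \<sigma> p = (\<lambda>v. big * p v + \<sigma> * wt v)"

lemma bal_shifted: "bal p \<Longrightarrow> bal (shifted \<sigma> p)"
  using bal_wt by (simp add: bal_def shifted_def sum.distrib flip: sum_distrib_left)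

text \<open>The two terms of the signed sum cannot cancel: that of \<open>wt\<close> is non-zero and
  smaller than \<open>big\<close> in absolute value, while the other is a multiple of
  \<open>big\<close>.\<close>

lemma generic_shifted:
  assumes "bal p" "\<sigma> \<in> {1, -1}" shows "generic (shifted \<sigma> p)"
  unfolding generic_def
proof (intro allI impI notI)
  fix K assume K: "K \<subseteq> V \<and> K \<noteq> {} \<and> K \<noteq> V" and 0: "signed (shifted \<sigma> p) K = 0"
  have "signed (shifted \<sigma> p) K = big * signed p K + \<sigma> * signed wt K"
    by (simp add: signed_def shifted_def sum.distrib sum_distrib_left algebra_simps)
  then have eq: "big * signed p K = - \<sigma> * signed wt K" using 0 by simp
  have "\<bar>big\<bar> * \<bar>signed p K\<bar> = \<bar>signed wt K\<bar>" using assms(2) by (auto simp: eq simp flip: abs_mult)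
  moreover have "signed wt K \<noteq> 0" using generic_wt K by (auto simp: generic_def)
  moreover have "\<bar>signed wt K\<bar> < big" using K by (intro signed_less_big) auto
  ultimately have "big * \<bar>signed p K\<bar> < big * 1" "\<bar>signed p K\<bar> \<noteq> 0" using big_pos by auto
  then show False using big_pos by (simp only: mult_less_cancel_left_pos)
qed

lemma sum_shifted: "sum (shifted \<sigma> p) S = big * sum p S + \<sigma> * sum wt S"
  by (simp add: shifted_def sum.distrib sum_distrib_left)

lemma hall_shifted_plus:
  assumes "bal p" shows "hall (shifted 1 p) \<longleftrightarrow> hall p"
proof
  assume h: "hall (shifted 1 p)"
  show "hall p" unfolding hall_def
  proof (intro conjI ballI allI impI assms)
    fix v assume v: "v \<in> V"
    then have "big * p v + wt v \<ge> 0" using h by (auto simp: hall_def shifted_def)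
    moreover have "wt v < big" using sum_wt_less_big[of "{v}"] v by simp
    ultimately show "p v \<ge> 0" by (rule big_mult)
  next
    fix S assume S: "S \<subseteq> A"
    then have V: "S \<subseteq> V" "nbh S \<subseteq> V" using nbh_subset[OF S] by (auto simp: V_def)
    have "sum (shifted 1 p) S \<le> sum (shifted 1 p) (nbh S)" using h S by (auto simp: hall_def)
    then have "big * (sum p (nbh S) - sum p S) + (sum wt (nbh S) - sum wt S) \<ge> 0"
      by (simp add: sum_shifted algebra_simps)
    moreover have "sum wt (nbh S) - sum wt S < big" using sum_wt_less_big[OF V(2)] sum_wt_nonneg[OF V(1)] by simp
    ultimately have "sum p (nbh S) - sum p S \<ge> 0" by (rule big_mult)
    then show "sum p S \<le> sum p (nbh S)" by simp
  qed
next
  assume h: "hall p"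
  have w: "hall wt" unfolding wt_def by (rule flow_hall) auto
  show "hall (shifted 1 p)" unfolding hall_def
  proof (intro conjI ballI allI impI bal_shifted assms)
    show "shifted 1 p v \<ge> 0" if "v \<in> V" for v using h w big_pos that by (auto simp: hall_def shifted_def)
    show "sum (shifted 1 p) S \<le> sum (shifted 1 p) (nbh S)" if "S \<subseteq> A" for S
      unfolding sum_shifted using h w big_pos that by (intro add_mono mult_left_mono) (auto simp: hall_def)
  qed
qed

text \<open>A strict inequality between integers leaves a margin of at least \<open>big\<close>
  after scaling, more than \<open>wt\<close> can use up; an equality leaves none, and
  \<open>wt\<close> lies strictly inside. For the whole side \<open>A\<close> both sides of the Hall
  inequality agree by balance.\<close>

lemma hall_shifted_minus:
  assumes "bal p" shows "hall (shifted (-1) p) \<longleftrightarrow> interior p"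
proof
  assume h: "hall (shifted (-1) p)"
  have pos: "x > 0" if "big * x - y \<ge> 0" "y > 0" for x y
  proof -
    have "big * x > 0" using that by simp
    then show ?thesis using big_pos by (simp add: zero_less_mult_iff)
  qed
  show "interior p" unfolding interior_def
  proof (intro conjI ballI allI impI assms)
    fix v assume v: "v \<in> V"
    then have "big * p v - wt v \<ge> 0" using h by (auto simp: hall_def shifted_def)
    then show "p v > 0" using pos wt_pos[OF v] by blast
  next
    fix S assume S: "S \<subset> A" "S \<noteq> {}"
    have "sum (shifted (-1) p) S \<le> sum (shifted (-1) p) (nbh S)" using h S by (auto simp: hall_def)
    then have "big * (sum p (nbh S) - sum p S) - (sum wt (nbh S) - sum wt S) \<ge> 0"
      by (simp add: sum_shifted algebra_simps)
    moreover have "sum wt (nbh S) - sum wt S > 0" using interior_wt S by (auto simp: interior_def)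
    ultimately have "sum p (nbh S) - sum p S > 0" by (rule pos)
    then show "sum p S < sum p (nbh S)" by simp
  qed
next
  assume i: "interior p"
  have ge: "big * x \<ge> y" if "x > 0" "y < big" for x y
  proof -
    have "big * 1 \<le> big * x" using that big_pos by (intro mult_left_mono) auto
    then show ?thesis using that by simp
  qed
  show "hall (shifted (-1) p)" unfolding hall_def
  proof (intro conjI ballI allI impI bal_shifted assms)
    fix v assume v: "v \<in> V"
    then have "p v > 0" using i by (auto simp: interior_def)
    moreover have "wt v < big" using sum_wt_less_big[of "{v}"] v by simp
    ultimately show "shifted (-1) p v \<ge> 0" using ge by (simp add: shifted_def)
  next
    fix S assume S: "S \<subseteq> A"
    then have V: "S \<subseteq> V" "nbh S \<subseteq> V" using nbh_subset[OF S] by (auto simp: V_def)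
    consider "S = {}" | "S = A" | "S \<subset> A" "S \<noteq> {}" using S by blast
    then show "sum (shifted (-1) p) S \<le> sum (shifted (-1) p) (nbh S)"
    proof cases
      case 1 then show ?thesis by simp
    next
      case 2 then show ?thesis using nbh_A bal_shifted[OF assms] by (simp add: bal_def)
    next
      case 3
      then have "sum p (nbh S) - sum p S > 0" using i by (auto simp: interior_def)
      moreover have "sum wt (nbh S) - sum wt S < big" using sum_wt_less_big[OF V(2)] sum_wt_nonneg[OF V(1)] by simp
      ultimately have "sum wt (nbh S) - sum wt S \<le> big * (sum p (nbh S) - sum p S)" by (rule ge)
      then show ?thesis by (simp add: sum_shifted algebra_simps)
    qed
  qed
qed


text \<open>An integer coordinate becomes non-negative after the push iff it was non-negative
  before, except at these edges, where it must be at least 1. They are the removed facets of the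
  cone of \<open>T\<close>.\<close>

definition negative_edges :: "int \<Rightarrow> 'v set set \<Rightarrow> 'v set set" where
  "negative_edges \<sigma> T = {e \<in> T. \<sigma> * coord T wt e < 0}"

definition shifted_points :: "int \<Rightarrow> nat \<Rightarrow> ('v \<Rightarrow> int) set" where
  "shifted_points \<sigma> n = {p. (\<forall>v. v \<notin> V \<longrightarrow> p v = 0) \<and> bal p \<and> hall (shifted \<sigma> p) \<and> sum p A = int n}"

lemma hall_cong:
  assumes "\<And>v. v \<in> V \<Longrightarrow> p v = q v" shows "hall p \<longleftrightarrow> hall q"
proof -
  have "sum p S = sum q S" if "S \<subseteq> V" for S using assms that by (intro sum.cong) auto
  moreover have "S \<subseteq> V \<and> nbh S \<subseteq> V" if "S \<subseteq> A" for S using that nbh_subset[OF that] by (auto simp: V_def)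
  ultimately show ?thesis using assms by (auto simp: hall_def bal_def V_def)
qed

lemma interior_cong:
  assumes "\<And>v. v \<in> V \<Longrightarrow> p v = q v" shows "interior p \<longleftrightarrow> interior q"
proof -
  have "sum p S = sum q S" if "S \<subseteq> V" for S using assms that by (intro sum.cong) auto
  moreover have "S \<subseteq> V \<and> nbh S \<subseteq> V" if "S \<subseteq> A" for S using that nbh_subset[OF that] by (auto simp: V_def)
  ultimately show ?thesis using assms by (auto simp: interior_def bal_def V_def psubset_eq)
qed

lemma coord_shifted:
  assumes "T \<in> trees" "bal p"
  shows "coord T (shifted \<sigma> p) e = big * coord T p e + \<sigma> * coord T wt e"
proof -
  have 0: "bal (\<lambda>v. 0)" by (simp add: bal_def)
  have "coord T (\<lambda>v. 0) = (\<lambda>e. 0)" by (rule coord_unique[OF assms(1) 0]) auto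
  then have "coord T (\<lambda>v. \<sigma> * wt v) e = \<sigma> * coord T wt e"
    using coord_linear[OF assms(1) bal_wt 0, of \<sigma> e] by simp
  moreover have "bal (\<lambda>v. \<sigma> * wt v)" using bal_wt by (simp add: bal_def flip: sum_distrib_left)
  ultimately show ?thesis
    using coord_linear[OF assms(1,2), of "\<lambda>v. \<sigma> * wt v" big e] by (simp add: shifted_def)
qed

lemma coord_shifted_nonneg_iff:
  assumes T: "T \<in> trees" and p: "bal p" and \<sigma>: "\<sigma> \<in> {1, -1}"
  shows "(\<forall>e. coord T (shifted \<sigma> p) e \<ge> 0) \<longleftrightarrow>
    (\<forall>e. coord T p e \<ge> 0) \<and> (\<forall>e\<in>negative_edges \<sigma> T. coord T p e \<ge> 1)"
    (is "?l \<longleftrightarrow> ?r")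
proof -
  have less: "\<bar>\<sigma> * coord T wt e\<bar> < big" for e using coord_less_big[OF T, of e] \<sigma> by auto
  show ?thesis
  proof
    assume l: ?l
    have "coord T p e \<ge> 0" for e
    proof (rule big_mult)
      show "0 \<le> big * coord T p e + \<sigma> * coord T wt e" using l coord_shifted[OF T p] by simp
      show "\<sigma> * coord T wt e < big" using less[of e] by linarith
    qed
    moreover have "coord T p e \<noteq> 0" if "e \<in> negative_edges \<sigma> T" for e
    proof -
      have "0 \<le> coord T (shifted \<sigma> p) e" using l by blast
      then show ?thesis using coord_shifted[OF T p, of \<sigma> e] that by (auto simp: negative_edges_def)
    qed
    ultimately show ?r by (metis le_less int_one_le_iff_zero_less)
  next
    assume r: ?r
    show ?l
    proof
      fix e
      show "coord T (shifted \<sigma> p) e \<ge> 0"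
      proof (cases "\<sigma> * coord T wt e < 0")
        case True
        then have "coord T wt e \<noteq> 0" by auto
        then have "e \<in> negative_edges \<sigma> T"
          using coord(1)[OF T bal_wt] True by (simp add: negative_edges_def)
        then have "coord T p e \<ge> 1" using r by blast
        then have "big * 1 \<le> big * coord T p e" using big_pos by (intro mult_left_mono) auto
        then show ?thesis using less[of e] coord_shifted[OF T p, of \<sigma> e] by linarith
      next
        case False
        then show ?thesis using r big_pos coord_shifted[OF T p, of \<sigma> e] by simp
      qed
    qed
  qed
qed

lemma deg_level_subset:
  assumes "T \<subseteq> E" "\<And>e. c e \<noteq> 0 \<Longrightarrow> e \<in> T" shows "sum (deg c) A = sum c T"
  unfolding deg_level using assms finite_E by (intro sum.mono_neutral_right) auto

text \<open>The half-open decomposition: every lattice point of the cone, pushed into direction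
  \<open>\<sigma> * wt\<close>, lies in the simplicial cone of exactly one tree.\<close>

lemma shifted_points_bij:
  assumes \<sigma>: "\<sigma> \<in> {1, -1}"
  shows "bij_betw (\<lambda>(T, c). deg c) (SIGMA T:trees. compositions T (negative_edges \<sigma> T) n) (shifted_points \<sigma> n)"
proof (rule bij_betwI')
  fix x y assume x: "x \<in> (SIGMA T:trees. compositions T (negative_edges \<sigma> T) n)"
    and y: "y \<in> (SIGMA T:trees. compositions T (negative_edges \<sigma> T) n)"
  obtain T c T' c' where xy: "x = (T, c)" "y = (T', c')" by (cases x, cases y)
  have T: "T \<in> trees" "c \<in> compositions T (negative_edges \<sigma> T) n"
    and T': "T' \<in> trees" "c' \<in> compositions T' (negative_edges \<sigma> T') n" using x y xy by auto
  have c: "coord T (deg c) = c" using T by (intro coord_unique bal_deg) (auto simp: compositions_def)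
  have c': "coord T' (deg c') = c'" using T' by (intro coord_unique bal_deg) (auto simp: compositions_def)
  show "((case x of (T, c) \<Rightarrow> deg c) = (case y of (T, c) \<Rightarrow> deg c)) = (x = y)"
  proof
    assume "(case x of (T, c) \<Rightarrow> deg c) = (case y of (T, c) \<Rightarrow> deg c)"
    then have eq: "deg c = deg c'" by (simp add: xy)
    have "\<forall>e. coord T (shifted \<sigma> (deg c)) e \<ge> 0"
      unfolding coord_shifted_nonneg_iff[OF T(1) bal_deg \<sigma>] c using T(2) by (auto simp: compositions_def)
    moreover have "\<forall>e. coord T' (shifted \<sigma> (deg c)) e \<ge> 0"
      unfolding eq coord_shifted_nonneg_iff[OF T'(1) bal_deg \<sigma>] c' using T'(2) by (auto simp: compositions_def)
    ultimately have "T = T'"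
      using cone_unique[OF bal_shifted[OF bal_deg[of c]] generic_shifted[OF bal_deg[of c] \<sigma>] T(1) _ T'(1)] by blast
    moreover from this have "c = c'" using c c' eq by metis
    ultimately show "x = y" by (simp add: xy)
  qed auto
next
  fix x assume "x \<in> (SIGMA T:trees. compositions T (negative_edges \<sigma> T) n)"
  then obtain T c where xT: "x = (T, c)" "T \<in> trees" "c \<in> compositions T (negative_edges \<sigma> T) n" by auto
  have c: "coord T (deg c) = c" using xT by (intro coord_unique bal_deg) (auto simp: compositions_def)
  have nn: "coord T (shifted \<sigma> (deg c)) e \<ge> 0" for e
    using coord_shifted_nonneg_iff[OF xT(2) bal_deg \<sigma>, of c] c xT(3) by (auto simp: compositions_def)
  have "hall (deg (coord T (shifted \<sigma> (deg c))))" using nn by (intro flow_hall)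
  then have "hall (shifted \<sigma> (deg c))"
    using hall_cong[of "deg (coord T (shifted \<sigma> (deg c)))" "shifted \<sigma> (deg c)"]
      coord(2)[OF xT(2) bal_shifted[OF bal_deg]] by blast
  moreover have "sum (deg c) A = sum c T"
    using trees_subset xT by (intro deg_level_subset) (auto simp: compositions_def)
  ultimately show "(case x of (T, c) \<Rightarrow> deg c) \<in> shifted_points \<sigma> n"
    using xT by (auto simp: shifted_points_def bal_deg deg_outside compositions_def)
next
  fix p assume "p \<in> shifted_points \<sigma> n"
  then have p: "\<And>v. v \<notin> V \<Longrightarrow> p v = 0" "bal p" "hall (shifted \<sigma> p)" "sum p A = int n"
    by (auto simp: shifted_points_def)
  obtain T where T: "T \<in> trees" "\<And>e. coord T (shifted \<sigma> p) e \<ge> 0"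
    using cone_exists[OF p(3) generic_shifted[OF p(2) \<sigma>]] by blast
  define c where "c = coord T p"
  have d: "deg c = p"
  proof
    fix v show "deg c v = p v"
      using coord(2)[OF T(1) p(2), of v] deg_outside[of v c] p(1)[of v] by (cases "v \<in> V") (auto simp: c_def)
  qed
  have cT: "e \<in> T" if "c e \<noteq> 0" for e using coord(1)[OF T(1) p(2), of e] that by (simp add: c_def)
  then have "sum c T = int n" using deg_level_subset[OF trees_subset[OF T(1)], of c] d p(4) by simp
  then have "c \<in> compositions T (negative_edges \<sigma> T) n"
    using coord_shifted_nonneg_iff[OF T(1) p(2) \<sigma>] T(2) cT unfolding compositions_def c_def by blast
  then show "\<exists>x\<in>SIGMA T:trees. compositions T (negative_edges \<sigma> T) n. p = (case x of (T, c) \<Rightarrow> deg c)"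
    using T d by (intro bexI[of _ "(T, c)"]) auto
qed

lemma finite_tree: "T \<in> trees \<Longrightarrow> finite T"
  using trees_subset finite_E finite_subset by blast

lemma finite_shifted_points: assumes "\<sigma> \<in> {1, -1}" shows "finite (shifted_points \<sigma> n)"
proof -
  have "finite (SIGMA T:trees. compositions T (negative_edges \<sigma> T) n)"
    by (intro finite_SigmaI finite_trees finite_compositions finite_tree)
  then show ?thesis using bij_betw_finite[OF shifted_points_bij[OF assms, of n]] by simp
qed

lemma card_shifted_points:
  assumes "\<sigma> \<in> {1, -1}"
  shows "card (shifted_points \<sigma> n) = (\<Sum>T\<in>trees. card (compositions T (negative_edges \<sigma> T) n))"
proof -
  have "\<forall>T\<in>trees. finite (compositions T (negative_edges \<sigma> T) n)"
    using finite_compositions finite_tree by blast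
  then show ?thesis
    unfolding bij_betw_same_card[OF shifted_points_bij[OF assms, of n], symmetric]
    by (rule card_SigmaI[OF finite_trees])
qed

section \<open>The numerator of the series and its leading coefficient\<close>

definition h_poly :: "rat poly" where
  "h_poly = (\<Sum>T\<in>trees. monom 1 (card (negative_edges 1 T)))"

text \<open>All trees have the same number of edges, so the series of their half-open cones share
  one denominator and the numerators, one power of the variable per tree, add up.\<close>

lemma fps_shifted_points:
  "Abs_fps (\<lambda>n. of_nat (card (shifted_points 1 n))) * (1 - fps_X) ^ (card V - 1) = fps_of_poly h_poly"
proof -
  have eq: "Abs_fps (\<lambda>n. of_nat (card (shifted_points 1 n))) =
      (\<Sum>T\<in>trees. Abs_fps (\<lambda>n. of_nat (card (compositions T (negative_edges 1 T) n))) :: rat fps)"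
    by (rule fps_ext) (simp add: card_shifted_points fps_sum_nth)
  have "Abs_fps (\<lambda>n. of_nat (card (shifted_points 1 n))) * (1 - fps_X :: rat fps) ^ (card V - 1) =
      (\<Sum>T\<in>trees. Abs_fps (\<lambda>n. of_nat (card (compositions T (negative_edges 1 T) n))) * (1 - fps_X) ^ card T)"
    unfolding eq sum_distrib_right by (intro sum.cong refl) (simp only: card_tree)
  also have "\<dots> = (\<Sum>T\<in>trees. fps_X ^ card (negative_edges 1 T))"
    by (intro sum.cong refl fps_compositions finite_tree) (auto simp: negative_edges_def)
  also have "\<dots> = fps_of_poly h_poly"
    by (simp add: h_poly_def fps_of_poly_sum fps_of_poly_monom)
  finally show ?thesis .
qed

definition interior_points :: "nat \<Rightarrow> ('v \<Rightarrow> int) set" where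
  "interior_points n = {p. (\<forall>v. v \<notin> V \<longrightarrow> p v = 0) \<and> interior p \<and> sum p A = int n}"

lemma interior_points: "interior_points n = shifted_points (-1) n"
  unfolding interior_points_def shifted_points_def using hall_shifted_minus
  by (auto simp: interior_def)

lemma finite_interior_points: "finite (interior_points n)"
  unfolding interior_points by (rule finite_shifted_points) simp

text \<open>The generic vector \<open>wt\<close> has no zero coordinate on a tree, so reversing the
  push exchanges forced and unforced edges. This replaces a reciprocity law for the generating
  functions.\<close>

lemma card_negative_edges:
  assumes "T \<in> trees"
  shows "card (negative_edges 1 T) + card (negative_edges (-1) T) = card V - 1"
proof -
  have "negative_edges 1 T \<union> negative_edges (-1) T = T"
    using coord_generic[OF assms bal_wt generic_wt] by (auto simp: negative_edges_def neq_iff)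
  moreover have "negative_edges 1 T \<inter> negative_edges (-1) T = {}" by (auto simp: negative_edges_def)
  moreover have "finite (negative_edges 1 T)" "finite (negative_edges (-1) T)"
    using finite_tree[OF assms] by (auto simp: negative_edges_def)
  ultimately show ?thesis using card_Un_disjoint card_tree[OF assms] by metis
qed

lemma trees_nonempty: "trees \<noteq> {}"
proof -
  have "hall (\<lambda>v. 0)" "bal (\<lambda>v. 0)" by (simp_all add: hall_def bal_def)
  then have "hall (shifted 1 (\<lambda>v. 0))" using hall_shifted_plus[of "\<lambda>v. 0"] by blast
  moreover have "generic (shifted 1 (\<lambda>v. 0))" by (rule generic_shifted) (auto simp: bal_def)
  ultimately show ?thesis using cone_exists by blast
qed

text \<open>In the cone of \<open>T\<close> interior points need one unit on each of
  \<open>D - d T\<close> edges, so the lowest level is \<open>D - s\<close> with \<open>s\<close>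
  the maximum of \<open>d\<close>. On that level each tree attaining the maximum contributes exactly
  one point and the others none; \<open>s\<close> is also the degree of
  \<open>h_poly\<close>.\<close>

theorem lead_coeff_h_poly:
  obtains m where "lead_coeff h_poly = of_nat (card (interior_points m))" "interior_points m \<noteq> {}"
    "\<And>n. n < m \<Longrightarrow> interior_points n = {}"
proof -
  define D where "D = card V - 1"
  define d where "d = (\<lambda>T. card (negative_edges 1 T))"
  define s where "s = Max (d ` trees)"
  define \<M> where "\<M> = {T \<in> trees. d T = s}"
  have fin: "finite (d ` trees)" "d ` trees \<noteq> {}" using finite_trees trees_nonempty by auto
  have ds: "d T \<le> s" if "T \<in> trees" for T using that fin by (simp add: s_def)
  have "s \<in> d ` trees" using Max_in[OF fin] by (simp add: s_def)
  then have M: "\<M> \<noteq> {}" "finite \<M>" using finite_trees by (auto simp: \<M>_def)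
  then have cM: "card \<M> > 0" by (simp add: card_gt_0_iff)
  have coeff: "coeff h_poly i = of_nat (card {T \<in> trees. d T = i})" for i
    using finite_trees by (simp add: h_poly_def d_def coeff_sum sum.If_cases Int_def)
  have "degree h_poly = s"
  proof (rule antisym)
    show "degree h_poly \<le> s"
    proof (rule degree_le, intro allI impI)
      fix i assume "s < i"
      then have "{T \<in> trees. d T = i} = {}" using ds by force
      then show "coeff h_poly i = 0" by (simp only: coeff card.empty of_nat_0)
    qed
    have "coeff h_poly s \<noteq> 0" using cM by (simp add: coeff \<M>_def)
    then show "s \<le> degree h_poly" by (rule le_degree)
  qed
  then have lead: "lead_coeff h_poly = of_nat (card \<M>)" by (simp add: coeff \<M>_def)
  have dJ: "card (negative_edges (-1) T) = D - d T" "d T \<le> D" if "T \<in> trees" for T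
    using card_negative_edges[OF that] by (auto simp: d_def D_def)
  have sD: "s \<le> D" using M dJ by (auto simp: \<M>_def)
  have count: "card (interior_points n) = (\<Sum>T\<in>trees. if D - d T \<le> n then card (compositions T {} (n - (D - d T))) else 0)" for n
    unfolding interior_points card_shifted_points[of "-1", simplified]
  proof (rule sum.cong[OF refl])
    fix T assume T: "T \<in> trees"
    have "negative_edges (-1) T \<subseteq> T" by (auto simp: negative_edges_def)
    then show "card (compositions T (negative_edges (-1) T) n) =
        (if D - d T \<le> n then card (compositions T {} (n - (D - d T))) else 0)"
      using card_compositions[OF finite_tree[OF T], of "negative_edges (-1) T" n] dJ[OF T] by simp
  qed
  have "card (interior_points (D - s)) = (\<Sum>T\<in>trees. if d T = s then 1 else 0)"
    unfolding count
  proof (rule sum.cong[OF refl])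
    fix T assume T: "T \<in> trees"
    have "D - d T \<le> D - s \<longleftrightarrow> d T = s" using ds[OF T] dJ(2)[OF T] sD by auto
    then show "(if D - d T \<le> D - s then card (compositions T {} (D - s - (D - d T))) else 0) = (if d T = s then 1 else 0)"
      using compositions_0[OF finite_tree[OF T]] by simp
  qed
  also have "\<dots> = card \<M>" using finite_trees by (simp add: \<M>_def sum.If_cases Int_def)
  finally have cI: "card (interior_points (D - s)) = card \<M>" .
  show ?thesis
  proof (rule that[of "D - s"])
    show "lead_coeff h_poly = of_nat (card (interior_points (D - s)))" using lead cI by simp
    show "interior_points (D - s) \<noteq> {}" using cI cM by auto
    fix n assume n: "n < D - s"
    have "\<not> D - d T \<le> n" if "T \<in> trees" for T using ds[OF that] n by linarith
    then have "card (interior_points n) = 0" unfolding count by (intro sum.neutral) auto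
    then show "interior_points n = {}" using finite_interior_points by simp
  qed
qed

end

context two_connected_bipartite begin

text \<open>Interior vectors have entries at least 1, so they lie above the all-ones vector in every
  entry. Once that vector is interior, no other interior point has level at most
  \<open>card A\<close>. Conversely, a unique point on the lowest level cannot have an entry of 2 or
  more.\<close>

lemma lead_coeff_one_iff:
  "lead_coeff h_poly = 1 \<longleftrightarrow> interior (\<lambda>v. 1)"
proof -
  obtain m where m: "lead_coeff h_poly = of_nat (card (interior_points m))" "interior_points m \<noteq> {}"
    "\<And>n. n < m \<Longrightarrow> interior_points n = {}" by (rule lead_coeff_h_poly) blast
  show ?thesis
  proof
    assume "lead_coeff h_poly = 1"
    then have "card (interior_points m) = 1" using m(1) by simp
    then obtain p where p: "interior_points m = {p}" by (auto simp: card_1_singleton_iff)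
    then have pI: "interior p" "sum p A = int m" "\<And>v. v \<notin> V \<Longrightarrow> p v = 0"
      unfolding interior_points_def by auto
    have "p v = 1" if v: "v \<in> V" for v
    proof (rule ccontr)
      assume "p v \<noteq> 1"
      moreover have "p v > 0" using pI(1) v by (auto simp: interior_def)
      ultimately have "p v \<ge> 2" by simp
      then obtain q where "interior q" "sum q A = sum p A" "\<exists>u\<in>V. q u \<noteq> p u" "\<And>u. u \<notin> V \<Longrightarrow> q u = p u"
        using interior_not_unique[OF pI(1) v] by blast
      moreover from this have "q \<in> interior_points m" using pI by (simp add: interior_points_def)
      ultimately show False using p by auto
    qed
    then show "interior (\<lambda>v. 1)" using interior_cong[of p "\<lambda>v. 1"] pI(1) by simp
  next
    assume 1: "interior (\<lambda>v. 1)"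
    define u where "u = (\<lambda>v. if v \<in> V then 1 else 0 :: int)"
    have "interior u" using 1 interior_cong[of u "\<lambda>v. 1"] by (simp add: u_def)
    moreover have sumu: "sum u A = int (card A)" "sum u B = int (card B)" by (simp_all add: u_def V_def)
    ultimately have u: "u \<in> interior_points (card A)" by (simp add: interior_points_def u_def)
    have ge: "p v \<ge> u v" if "interior p" "v \<in> V" for p v using that by (auto simp: interior_def u_def)
    have all: "p = u" if p: "p \<in> interior_points n" "n \<le> card A" for p n
    proof -
      have i: "interior p" "sum p A = int n" "\<And>v. v \<notin> V \<Longrightarrow> p v = 0" using p by (auto simp: interior_points_def)
      have eqV: "p v = u v" if "v \<in> S" "S \<subseteq> V" "sum p S \<le> sum u S" for v S
      proof (rule ccontr)
        assume "p v \<noteq> u v"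
        then have "u v < p v" using ge[OF i(1), of v] that by auto
        then have "sum u S < sum p S" using that ge[OF i(1)] finite_V finite_subset
          by (intro sum_strict_mono_ex1) auto
        then show False using that by simp
      qed
      have "sum p A \<le> sum u A" using i p sumu by simp
      moreover from this have "sum p B \<le> sum u B"
        using i(1) \<open>interior u\<close> by (simp add: interior_def bal_def)
      ultimately have "p v = u v" for v
        using eqV[of v A] eqV[of v B] i(3)[of v] by (cases "v \<in> V") (auto simp: V_def u_def)
      then show ?thesis by blast
    qed
    have "m \<le> card A" using m(3)[of "card A"] u by (cases "m \<le> card A") auto
    then have "interior_points m = {u}" using all m(2) by blast
    then show "lead_coeff h_poly = 1" using m(1) by simp
  qed
qed

end

context bipartite_sets begin

subsection \<open>Perfect matchings and the all-ones vector\<close>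

lemma indicator_matching:
  assumes "perfect_matching (V, E) M" "v \<in> V"
  shows "deg (\<lambda>e. if e \<in> M then 1 else 0) v = 1"
proof -
  have "\<exists>!e. e \<in> M \<and> v \<in> e" using assms by (simp add: perfect_matching_def)
  then obtain e where e: "e \<in> M" "v \<in> e" "\<And>e'. e' \<in> M \<Longrightarrow> v \<in> e' \<Longrightarrow> e' = e" by blast
  have "M \<subseteq> E" using assms by (simp add: perfect_matching_def)
  then have "deg (\<lambda>e. if e \<in> M then 1 else 0) v = (\<Sum>e'\<in>{e}. 1)"
    unfolding deg_def using e(1,2) finite_E by (intro sum.mono_neutral_cong_right) (auto dest: e(3))
  then show ?thesis by simp
qed

lemma flow_matching:
  assumes f: "\<And>e. e \<in> E \<Longrightarrow> f e \<ge> 0" "\<And>e. e \<notin> E \<Longrightarrow> f e = 0" "\<And>v. v \<in> V \<Longrightarrow> deg f v = 1"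
  shows "perfect_matching (V, E) {e. f e \<noteq> 0}"
  unfolding perfect_matching_def fst_conv snd_conv
proof (intro conjI ballI)
  show "{e. f e \<noteq> 0} \<subseteq> E" using f(2) by blast
  fix v assume v: "v \<in> V"
  have d: "(\<Sum>e\<in>E. if v \<in> e then f e else 0) = 1" using f(3)[OF v] by (simp add: deg_def)
  then have "(\<Sum>e\<in>E. if v \<in> e then f e else 0) \<noteq> 0" by simp
  then obtain e where e: "e \<in> E" "v \<in> e" "f e \<noteq> 0"
    by (rule sum.not_neutral_contains_not_neutral) (auto split: if_splits)
  have "e' = e" if "f e' \<noteq> 0" "v \<in> e'" for e'
  proof (rule ccontr)
    assume ne: "e' \<noteq> e"
    have e': "e' \<in> E" using f(2) that by blast
    have "(\<Sum>e\<in>{e, e'}. if v \<in> e then f e else 0) \<le> (\<Sum>e\<in>E. if v \<in> e then f e else 0)"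
      using e e' f(1) finite_E by (intro sum_mono2) auto
    then have "f e + f e' \<le> 1" using d ne e that by simp
    moreover have "f e > 0" "f e' > 0" using f(1) e e' that by (auto simp: order_less_le)
    ultimately show False by simp
  qed
  then show "\<exists>!e. e \<in> {e. f e \<noteq> 0} \<and> v \<in> e" using e by blast
qed

end

context connected_bipartite begin

text \<open>Choosing a perfect matching through each edge and adding up their indicators gives a
  positive weighting all of whose degrees are \<open>card E\<close>.\<close>

lemma interior_one_if_matching_covered:
  assumes "matching_covered (V, E)"
  shows "interior (\<lambda>v. 1)"
proof -
  have "\<forall>e\<in>E. \<exists>M. perfect_matching (V, E) M \<and> e \<in> M"
    using assms by (simp add: matching_covered_def)
  then obtain M where M: "\<And>e. e \<in> E \<Longrightarrow> perfect_matching (V, E) (M e) \<and> e \<in> M e" by metis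
  have "E \<noteq> {}" using has_neighbour A_nonempty by (auto simp: V_def)
  show ?thesis
  proof (rule interior_if_positive_flow)
    show "int (card E) > 0" using \<open>E \<noteq> {}\<close> finite_E by (simp add: card_gt_0_iff)
    fix e assume e: "e \<in> E"
    show "0 < (\<Sum>e'\<in>E. if e \<in> M e' then 1 else 0 :: int)"
      using M[OF e] e finite_E by (intro sum_pos2[of E e]) auto
  next
    fix v assume "v \<in> V"
    then show "int (card E) * 1 = deg (\<lambda>e. \<Sum>e'\<in>E. if e \<in> M e' then 1 else 0) v"
      using indicator_matching M by (simp add: deg_sum)
  qed
qed

text \<open>Removing both ends of \<open>e\<close> costs a neighbourhood at most one vertex, which
  the strict inequality absorbs. The remaining Hall vector gives a weighting that \<open>e\<close>
  completes to a perfect matching.\<close>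

lemma matching_covered_if_interior_one:
  assumes "interior (\<lambda>v. 1)" "connected_graph (V, E)"
  shows "matching_covered (V, E)"
  unfolding matching_covered_def fst_conv snd_conv
proof (intro conjI ballI assms(2))
  fix e assume e: "e \<in> E"
  then obtain a b where ab: "a \<in> A" "b \<in> B" "e = {a, b}" "a \<noteq> b" "a \<notin> B" "b \<notin> A" by (elim edge_cases') auto
  define q where "q = (\<lambda>v. 1 - (if v \<in> e then 1 else 0 :: int))"
  have sumq: "sum q S = int (card S) - int (card (S \<inter> e))" if "finite S" for S
    using that by (simp add: q_def sum_subtractf sum.If_cases Int_def)
  have "A \<inter> e = {a}" "B \<inter> e = {b}" using ab by auto
  have "hall q" unfolding hall_def bal_def
  proof (intro conjI ballI allI impI)
    have "card A = card B" using assms(1) by (simp add: interior_def bal_def)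
    then show "sum q A = sum q B"
      using finite_A finite_B \<open>A \<inter> e = {a}\<close> \<open>B \<inter> e = {b}\<close> by (simp add: sumq)
    then have balq: "sum q A = sum q B" .
    show "q v \<ge> 0" for v by (simp add: q_def)
    fix S assume S: "S \<subseteq> A"
    have fin: "finite S" "finite (nbh S)" using S finite_A finite_subset nbh_finite by blast+
    have "S \<inter> e \<subseteq> {a}" "nbh S \<inter> e \<subseteq> {b}" using S nbh_subset[OF S] ab by auto
    then have le1: "card (nbh S \<inter> e) \<le> 1" using card_mono[of "{b}" "nbh S \<inter> e"] by simp
    consider "S = {}" | "S = A" | "S \<subset> A" "S \<noteq> {}" using S by blast
    then show "sum q S \<le> sum q (nbh S)"
    proof cases
      case 1 then show ?thesis by simp
    next
      case 2 then show ?thesis using balq nbh_A by simp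
    next
      case 3
      then have "(\<Sum>v\<in>S. 1 :: int) < (\<Sum>v\<in>nbh S. 1)" using assms(1) unfolding interior_def by blast
      then have "int (card S) < int (card (nbh S))" by simp
      then show ?thesis using le1 fin by (simp add: sumq)
    qed
  qed
  then obtain f where f: "\<And>e. e \<in> E \<Longrightarrow> f e \<ge> 0" "\<And>e. e \<notin> E \<Longrightarrow> f e = 0" "\<And>v. v \<in> V \<Longrightarrow> deg f v = q v"
    by (rule hall_flow) blast
  have "perfect_matching (V, E) {e'. f e' + (if e' = e then 1 else 0) \<noteq> 0}"
    using f e by (intro flow_matching) (auto simp: deg_add deg_single q_def)
  moreover have "f e + (if e = e then 1 else 0) \<noteq> 0" using f(1)[OF e] by simp
  ultimately show "\<exists>M. perfect_matching (V, E) M \<and> e \<in> M" by blast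
qed

end

section \<open>Ear decompositions\<close>

fun path_edges :: "'v list \<Rightarrow> 'v set set" where
  "path_edges (x # y # zs) = insert {x, y} (path_edges (y # zs))"
| "path_edges xs = {}"

lemma path_edges_nth: "path_edges xs = {{xs ! i, xs ! Suc i} |i. Suc i < length xs}"
proof (induction xs rule: path_edges.induct)
  case (1 x y zs)
  have "{{(x # y # zs) ! i, (x # y # zs) ! Suc i} |i. Suc i < length (x # y # zs)} =
      insert {x, y} {{(y # zs) ! i, (y # zs) ! Suc i} |i. Suc i < length (y # zs)}" (is "?l = ?r")
  proof (intro equalityI subsetI)
    fix e assume "e \<in> ?l"
    then obtain i where "e = {(x # y # zs) ! i, (x # y # zs) ! Suc i}" "Suc i < length (x # y # zs)" by blast
    then show "e \<in> ?r" by (cases i) auto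
  next
    fix e assume "e \<in> ?r"
    then consider "e = {x, y}" | i where "e = {(y # zs) ! i, (y # zs) ! Suc i}" "Suc i < length (y # zs)" by blast
    then show "e \<in> ?l"
    proof cases
      case 1 then show ?thesis by (intro CollectI exI[of _ 0]) auto
    next
      case 2 then show ?thesis by (intro CollectI exI[of _ "Suc i"]) auto
    qed
  qed
  then show ?case using 1 by simp
qed auto

lemma path_edges_successively: "path_edges xs \<subseteq> F \<longleftrightarrow> successively (\<lambda>a b. {a, b} \<in> F) xs"
  by (induction xs rule: path_edges.induct) auto

lemma path_edges_subset: "e \<in> path_edges xs \<Longrightarrow> e \<subseteq> set xs"
  by (induction xs rule: path_edges.induct) auto

lemma finite_path_edges: "finite (path_edges xs)"
  by (induction xs rule: path_edges.induct) auto

lemma card_path_edges: "distinct xs \<Longrightarrow> card (path_edges xs) = length xs - 1"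
proof (induction xs rule: path_edges.induct)
  case (1 x y zs)
  have "{x, y} \<notin> path_edges (y # zs)" using path_edges_subset[of "{x, y}" "y # zs"] 1 by auto
  then show ?case using 1 finite_path_edges[of "y # zs"] by simp
qed auto

text \<open>Guarantees that the edge closing a path to a cycle is new, and that an ear with an inner
  vertex has no edge inside the graph to which it is attached.\<close>

lemma path_edge_interior:
  assumes "distinct xs" "length xs \<ge> 3" "e \<in> path_edges xs"
  shows "\<not> e \<subseteq> {hd xs, last xs}"
proof
  assume e: "e \<subseteq> {hd xs, last xs}"
  obtain i where i: "e = {xs ! i, xs ! Suc i}" "Suc i < length xs" using assms(3) by (auto simp: path_edges_nth)
  have "xs \<noteq> []" using assms by auto
  then have hl: "hd xs = xs ! 0" "last xs = xs ! (length xs - 1)" by (simp_all add: hd_conv_nth last_conv_nth)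
  have "xs ! j = xs ! 0 \<or> xs ! j = xs ! (length xs - 1)" if "j \<in> {i, Suc i}" for j
    using e i hl that by auto
  then have "j = 0 \<or> j = length xs - 1" if "j \<in> {i, Suc i}" for j
    using that i(2) assms(1,2) nth_eq_iff_index_eq[OF assms(1), of j] by (metis (no_types, lifting)
      Suc_lessD diff_less insertE length_greater_0_conv less_one singletonD \<open>xs \<noteq> []\<close> zero_less_one)
  from this[of i] this[of "Suc i"] show False using i(2) assms(2) by auto
qed

definition cycle_edges :: "'v list \<Rightarrow> 'v set set" where
  "cycle_edges xs = insert {last xs, hd xs} (path_edges xs)"

lemma cycle_edges_nth:
  assumes "xs \<noteq> []"
  shows "cycle_edges xs = {{xs ! i, xs ! (Suc i mod length xs)} |i. i < length xs}" (is "_ = ?r")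
proof (intro equalityI subsetI)
  fix e assume "e \<in> cycle_edges xs"
  then consider "e = {last xs, hd xs}" | i where "e = {xs ! i, xs ! Suc i}" "Suc i < length xs"
    by (auto simp: cycle_edges_def path_edges_nth)
  then show "e \<in> ?r"
  proof cases
    case 1
    then show ?thesis using assms
      by (intro CollectI exI[of _ "length xs - 1"]) (auto simp: hd_conv_nth last_conv_nth)
  next
    case 2
    then show ?thesis by (intro CollectI exI[of _ i]) auto
  qed
next
  fix e assume "e \<in> ?r"
  then obtain i where i: "e = {xs ! i, xs ! (Suc i mod length xs)}" "i < length xs" by blast
  show "e \<in> cycle_edges xs"
  proof (cases "Suc i < length xs")
    case True
    then show ?thesis using i by (auto simp: cycle_edges_def path_edges_nth)
  next
    case False
    then have "Suc i = length xs" "i = length xs - 1" using i by simp_all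
    then show ?thesis using i assms by (simp add: cycle_edges_def hd_conv_nth last_conv_nth)
  qed
qed

lemma card_cycle_edges:
  assumes "distinct xs" "length xs \<ge> 3"
  shows "card (cycle_edges xs) = length xs"
proof -
  have "{last xs, hd xs} \<notin> path_edges xs" using path_edge_interior[OF assms] by blast
  then show ?thesis using assms card_path_edges[of xs] finite_path_edges[of xs] by (simp add: cycle_edges_def)
qed

lemma is_cycle_iff:
  "is_cycle C \<longleftrightarrow> (\<exists>xs. distinct xs \<and> length xs \<ge> 3 \<and> C = (set xs, cycle_edges xs))"
proof -
  have "verts C = set xs \<and> edges C = {{xs ! i, xs ! (Suc i mod length xs)} |i. i < length xs} \<longleftrightarrow>
      C = (set xs, cycle_edges xs)" if "length xs \<ge> 3" for xs
  proof -
    have "xs \<noteq> []" using that by auto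
    then show ?thesis unfolding prod_eq_iff fst_conv snd_conv cycle_edges_nth[OF \<open>xs \<noteq> []\<close>] by blast
  qed
  then show ?thesis unfolding is_cycle_def by blast
qed

lemma is_path_iff:
  "is_path P u v \<longleftrightarrow> (\<exists>xs. distinct xs \<and> length xs \<ge> 2 \<and> hd xs = u \<and> last xs = v \<and> P = (set xs, path_edges xs))"
  unfolding is_path_def path_edges_nth by (auto simp: prod_eq_iff)

section \<open>Positive weightings of constant degree along odd ears\<close>

context bipartite_sets begin

text \<open>Weights \<open>a, b, a, b, ...\<close> along the path; with an even number of vertices
  the last edge carries \<open>a\<close> again. The induction swaps \<open>a\<close> and
  \<open>b\<close>, so both are kept general.\<close>

lemma alternating_flow:
  assumes "length xs \<ge> 2" "distinct xs" "path_edges xs \<subseteq> E" "a \<ge> 1" "b \<ge> 1"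
  shows "\<exists>h. (\<forall>e\<in>path_edges xs. h e \<ge> 1) \<and> (\<forall>e. e \<notin> path_edges xs \<longrightarrow> h e = 0) \<and>
    (\<forall>v. deg h v = (if v = hd xs then a else if v = last xs then (if even (length xs) then a else b)
      else if v \<in> set xs then a + b else 0))"
  using assms
proof (induction xs arbitrary: a b)
  case Nil then show ?case by simp
next
  case (Cons x ys)
  then obtain y zs where ys: "ys = y # zs" by (cases ys) auto
  have xy: "{x, y} \<in> E" "x \<noteq> y" using Cons.prems ys by auto
  have nin: "{x, y} \<notin> path_edges ys" using path_edges_subset[of "{x, y}" ys] Cons.prems by auto
  show ?case
  proof (cases zs)
    case Nil
    then show ?thesis using xy Cons.prems(4) ys
      by (intro exI[of _ "\<lambda>e. if e = {x, y} then a else 0"]) (auto simp: deg_single)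
  next
    case (Cons z ws)
    have "\<exists>h. (\<forall>e\<in>path_edges ys. h e \<ge> 1) \<and> (\<forall>e. e \<notin> path_edges ys \<longrightarrow> h e = 0) \<and>
      (\<forall>v. deg h v = (if v = hd ys then b else if v = last ys then (if even (length ys) then b else a)
      else if v \<in> set ys then b + a else 0))"
      using Cons.prems ys Cons by (intro Cons.IH) auto
    then obtain h where h: "\<And>e. e \<in> path_edges ys \<Longrightarrow> h e \<ge> 1" "\<And>e. e \<notin> path_edges ys \<Longrightarrow> h e = 0"
      "\<And>v. deg h v = (if v = y then b else if v = last ys then (if even (length ys) then b else a)
      else if v \<in> set ys then b + a else 0)" using ys by auto
    define g where "g = (\<lambda>e. h e + (if e = {x, y} then a else 0))"
    have lst: "last ys \<in> set ys" "last ys \<noteq> y" "x \<notin> set ys" using Cons ys Cons.prems(2) by auto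
    have "deg g v = (if v = hd (x # ys) then a else if v = last (x # ys) then (if even (length (x # ys)) then a else b)
      else if v \<in> set (x # ys) then a + b else 0)" for v
      using lst xy ys by (auto simp: g_def deg_add deg_single h(3))
    moreover have "\<forall>e\<in>path_edges (x # ys). g e \<ge> 1"
      using h(1,2) nin Cons.prems(4) ys by (auto simp: g_def)
    moreover have "\<forall>e. e \<notin> path_edges (x # ys) \<longrightarrow> g e = 0"
      using h(2) ys by (auto simp: g_def)
    ultimately show ?thesis by blast
  qed
qed

lemma sg_last:
  assumes "xs \<noteq> []" "path_edges xs \<subseteq> E"
  shows "sg (last xs) = (if odd (length xs) then sg (hd xs) else - sg (hd xs))"
  using assms by (induction xs rule: path_edges.induct) (auto simp: sg_edge)

lemma path_linked:
  assumes "path_edges xs \<subseteq> T" "T \<subseteq> E" "u \<in> set xs"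
  shows "linked T (hd xs) u"
  using assms
proof (induction xs arbitrary: u rule: path_edges.induct)
  case (1 x y zs)
  have "linked T x y" using 1 by (intro linked_edge) auto
  then show ?case using 1 linked_refl linked_trans[of T x y u] by auto
qed (auto simp: linked_refl)

lemma cycle_even:
  assumes "cycle_edges xs \<subseteq> E" "xs \<noteq> []"
  shows "even (length xs)"
proof (rule ccontr)
  assume "odd (length xs)"
  then have "sg (last xs) = sg (hd xs)" using sg_last[OF assms(2)] assms(1) by (simp add: cycle_edges_def)
  moreover have "sg (hd xs) = - sg (last xs)" using assms(1) by (intro sg_edge) (simp add: cycle_edges_def)
  ultimately show False by (simp add: sg_def split: if_splits)
qed

text \<open>The invariant along an ear decomposition. The links are kept because they supply the
  correction at the two ends of the next ear.\<close>

definition regular_flow :: "'v set \<Rightarrow> 'v set set \<Rightarrow> bool" where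
  "regular_flow W F \<longleftrightarrow> F \<subseteq> E \<and> (\<forall>u\<in>W. \<forall>v\<in>W. linked F u v) \<and>
    (\<exists>g N. N \<ge> 1 \<and> (\<forall>e\<in>F. g e \<ge> 1) \<and> (\<forall>e. e \<notin> F \<longrightarrow> g e = 0) \<and>
      (\<forall>v. deg g v = (if v \<in> W then N else 0)))"

lemma regular_flow_cycle:
  assumes "distinct xs" "length xs \<ge> 3" "cycle_edges xs \<subseteq> E"
  shows "regular_flow (set xs) (cycle_edges xs)"
  unfolding regular_flow_def
proof (intro conjI ballI assms(3))
  fix u v assume uv: "u \<in> set xs" "v \<in> set xs"
  have "path_edges xs \<subseteq> cycle_edges xs" by (auto simp: cycle_edges_def)
  then have "linked (cycle_edges xs) (hd xs) u" "linked (cycle_edges xs) (hd xs) v"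
    using path_linked assms(3) uv by blast+
  then show "linked (cycle_edges xs) u v" using linked_sym linked_trans by blast
next
  have ev: "even (length xs)" using assms by (intro cycle_even) auto
  have pE: "path_edges xs \<subseteq> E" "{last xs, hd xs} \<in> E" using assms(3) by (auto simp: cycle_edges_def)
  have "\<exists>h. (\<forall>e\<in>path_edges xs. h e \<ge> 1) \<and> (\<forall>e. e \<notin> path_edges xs \<longrightarrow> h e = 0) \<and>
    (\<forall>v. deg h v = (if v = hd xs then 1 else if v = last xs then (if even (length xs) then 1 else 1)
      else if v \<in> set xs then 1 + 1 else 0))"
    using assms pE by (intro alternating_flow) auto
  then obtain h where h: "\<forall>e\<in>path_edges xs. h e \<ge> 1" "\<forall>e. e \<notin> path_edges xs \<longrightarrow> h e = 0"
    "\<forall>v. deg h v = (if v = hd xs then 1 else if v = last xs then 1 else if v \<in> set xs then 2 else 0)" by auto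
  have hl: "hd xs \<in> set xs" "last xs \<in> set xs" using assms(2) by (auto intro!: hd_in_set last_in_set)
  have "{last xs, hd xs} \<notin> path_edges xs" using path_edge_interior[OF assms(1,2)] by blast
  moreover have "hd xs \<noteq> last xs" using edge_distinct[OF pE(2)] by simp
  ultimately show "\<exists>g N. N \<ge> 1 \<and> (\<forall>e\<in>cycle_edges xs. g e \<ge> 1) \<and> (\<forall>e. e \<notin> cycle_edges xs \<longrightarrow> g e = 0) \<and>
      (\<forall>v. deg g v = (if v \<in> set xs then N else 0))"
    using h hl pE(2)
    by (intro exI[of _ "\<lambda>e. h e + (if e = {last xs, hd xs} then 1 else 0)"] exI[of _ 2])
      (auto simp: cycle_edges_def deg_add deg_single)
qed

text \<open>A large multiple of the flow minus an integer combination of edges that is one at both ends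
  of the ear stays positive and makes room for the alternating weights on the ear.\<close>

lemma regular_flow_ear:
  assumes F: "regular_flow W F" and xs: "distinct xs" "length xs \<ge> 2" "even (length xs)" "path_edges xs \<subseteq> E"
    "set xs \<inter> W = {hd xs, last xs}" and disj: "path_edges xs \<inter> F = {}"
  shows "regular_flow (W \<union> set xs) (F \<union> path_edges xs)"
proof -
  define s t where "s = hd xs" and "t = last xs"
  obtain g N where g: "F \<subseteq> E" "\<And>u v. u \<in> W \<Longrightarrow> v \<in> W \<Longrightarrow> linked F u v" "N \<ge> 1" "\<And>e. e \<in> F \<Longrightarrow> g e \<ge> 1"
    "\<And>e. e \<notin> F \<Longrightarrow> g e = 0" "\<And>v. deg g v = (if v \<in> W then N else 0)"
    using F unfolding regular_flow_def by metis
  have st: "s \<in> W" "t \<in> W" "s \<in> set xs" "t \<in> set xs" using xs(5) by (auto simp: s_def t_def)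
  have "xs \<noteq> []" using xs(2) by auto
  \<comment> \<open>The ends of an odd ear lie on opposite sides, so up to sign
    \<open>unit_diff s t\<close> is 1 at both of them and can be subtracted from the degrees
    there.\<close>
  then have sgt: "sg t = - sg s" using sg_last[of xs] xs(3,4) by (simp add: s_def t_def)
  then have "s \<noteq> t" by (auto simp: sg_def split: if_splits)
  obtain c where c: "\<And>e. c e \<noteq> 0 \<Longrightarrow> e \<in> F" "\<And>x. deg c x = unit_diff s t x"
    using g(2)[OF st(1,2)] by (auto simp: linked_def)
  \<comment> \<open>Large enough that \<open>M * g e\<close> remains at least 2 on \<open>F\<close>
    after the correction.\<close>
  define M where "M = 2 + (\<Sum>e\<in>E. \<bar>c e\<bar>)"
  have M2: "M \<ge> 2" by (simp add: M_def sum_nonneg)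
  have Mc: "\<bar>c e\<bar> \<le> M - 2" if "e \<in> E" for e
    using member_le_sum[of e E "\<lambda>e. \<bar>c e\<bar>"] that finite_E by (simp add: M_def)
  \<comment> \<open>The new common degree. Weights 1 and \<open>R - 1\<close> alternate on the ear:
    inner vertices receive \<open>R\<close>, and each end receives the 1 taken from it by the
    correction.\<close>
  define R where "R = M * N"
  have "2 * 1 \<le> M * N" using M2 g(3) by (intro mult_mono) auto
  then have R: "R - 1 \<ge> 1" by (simp add: R_def)
  have "\<exists>h. (\<forall>e\<in>path_edges xs. h e \<ge> 1) \<and> (\<forall>e. e \<notin> path_edges xs \<longrightarrow> h e = 0) \<and>
    (\<forall>v. deg h v = (if v = hd xs then 1 else if v = last xs then (if even (length xs) then 1 else R - 1)
      else if v \<in> set xs then 1 + (R - 1) else 0))"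
    using xs R by (intro alternating_flow) auto
  then obtain h where h: "\<And>e. e \<in> path_edges xs \<Longrightarrow> h e \<ge> 1" "\<And>e. e \<notin> path_edges xs \<Longrightarrow> h e = 0"
    and h_deg: "\<forall>v. deg h v = (if v = hd xs then 1 else if v = last xs then (if even (length xs) then 1 else R - 1)
      else if v \<in> set xs then 1 + (R - 1) else 0)" by blast
  have h3: "deg h v = (if v = s then 1 else if v = t then 1 else if v \<in> set xs then R else 0)" for v
    using h_deg xs(3) by (simp add: s_def t_def)
  define g' where "g' = (\<lambda>e. M * g e - sg s * c e + h e)"
  show ?thesis unfolding regular_flow_def
  proof (intro conjI exI[of _ g'] exI[of _ R] ballI allI impI)
    show "F \<union> path_edges xs \<subseteq> E" using g(1) xs(4) by auto
    have mono: "linked F u v \<Longrightarrow> linked (F \<union> path_edges xs) u v" for u v by (rule linked_mono) auto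
    have "linked (F \<union> path_edges xs) s u" if "u \<in> W \<union> set xs" for u
      using that
    proof
      assume "u \<in> W" then show ?thesis using mono g(2) st(1) by blast
    next
      assume "u \<in> set xs" then show ?thesis unfolding s_def using g(1) xs(4) by (intro path_linked) auto
    qed
    then show "linked (F \<union> path_edges xs) u v" if "u \<in> W \<union> set xs" "v \<in> W \<union> set xs" for u v
      using linked_sym linked_trans that by blast
    show "1 \<le> R" using R by simp
    show "1 \<le> g' e" if "e \<in> F \<union> path_edges xs" for e
    proof (cases "e \<in> F")
      case True
      then have "h e = 0" using h(2) disj by blast
      have "M * 1 \<le> M * g e" using g(4)[OF True] M2 by (intro mult_left_mono) auto
      moreover have "\<bar>sg s * c e\<bar> \<le> M - 2" using Mc[of e] True g(1) by (auto simp: abs_mult sg_def)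
      ultimately show ?thesis using \<open>h e = 0\<close> unfolding g'_def by linarith
    next
      case False
      then show ?thesis using that h(1) g(5) c(1) by (cases "c e = 0") (auto simp: g'_def)
    qed
    show "g' e = 0" if "e \<notin> F \<union> path_edges xs" for e
      using that g(5) h(2) c(1) by (cases "c e = 0") (auto simp: g'_def)
    show "deg g' v = (if v \<in> W \<union> set xs then R else 0)" for v
    proof -
      have "deg g' v = M * deg g v - sg s * unit_diff s t v + deg h v"
        by (simp add: g'_def deg_add deg_diff deg_mult c(2))
      moreover have "sg s * unit_diff s t v = (if v = s \<or> v = t then 1 else 0)"
        using sgt \<open>s \<noteq> t\<close> by (auto simp: unit_diff_def)
      moreover have "v \<in> W \<and> v \<in> set xs \<longleftrightarrow> v = s \<or> v = t" using xs(5) by (auto simp: s_def t_def)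
      ultimately show ?thesis using g(6)[of v] h3[of v] st by (auto simp: R_def)
    qed
  qed
qed

end

lemma graph_Union_snoc:
  "graph_Union (Hs @ [P]) = (verts (graph_Union Hs) \<union> verts P, edges (graph_Union Hs) \<union> edges P)"
  by (auto simp: graph_Union_def)

context bipartite_sets begin

lemma regular_flow_ear_decomposition:
  assumes ear: "ear_decomposition (V, E) C Ps" and odd: "\<And>P. P \<in> set Ps \<Longrightarrow> odd (card (edges P))"
  shows "regular_flow V E"
proof -
  have G: "(V, E) = graph_Union (C # Ps)" and cyc: "is_cycle C"
    and step: "\<And>i. i < length Ps \<Longrightarrow> \<exists>u v. is_path (Ps ! i) u v \<and>
        graph_inter (graph_Union (C # take i Ps)) (Ps ! i) = ({u, v}, {})"
    using ear by (auto simp: ear_decomposition_def)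
  have sub: "edges H \<subseteq> E" if "H \<in> set (C # Ps)" for H
    using arg_cong[OF G, of snd] that by (auto simp: graph_Union_def)
  have "regular_flow (verts (graph_Union (C # take k Ps))) (edges (graph_Union (C # take k Ps)))"
    if "k \<le> length Ps" for k
    using that
  proof (induction k)
    case 0
    obtain xs where "distinct xs" "length xs \<ge> 3" "C = (set xs, cycle_edges xs)"
      using cyc by (auto simp: is_cycle_iff)
    then show ?case using regular_flow_cycle[of xs] sub[of C] by (simp add: graph_Union_def)
  next
    case (Suc k)
    define U where "U = graph_Union (C # take k Ps)"
    have k: "k < length Ps" using Suc by simp
    obtain u v where uv: "is_path (Ps ! k) u v" "graph_inter U (Ps ! k) = ({u, v}, {})"
      using step[OF k] by (auto simp: U_def)
    obtain xs where xs: "distinct xs" "length xs \<ge> 2" "hd xs = u" "last xs = v" "Ps ! k = (set xs, path_edges xs)"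
      using uv(1) by (auto simp: is_path_iff)
    have "odd (card (edges (Ps ! k)))" using odd k by simp
    then have ev: "even (length xs)" using xs card_path_edges[of xs] by (simp add: even_diff_nat)
    have pE: "path_edges xs \<subseteq> E" using sub[of "Ps ! k"] nth_mem[OF k] xs(5) by simp
    from ev have "regular_flow (verts U \<union> set xs) (edges U \<union> path_edges xs)"
      using Suc xs uv(2) pE
      by (intro regular_flow_ear) (auto simp: U_def graph_inter_def)
    moreover have "graph_Union (C # take (Suc k) Ps) = (verts U \<union> set xs, edges U \<union> path_edges xs)"
      using graph_Union_snoc[of "C # take k Ps" "Ps ! k"] k xs(5) by (simp add: U_def take_Suc_conv_app_nth)
    ultimately show ?case by simp
  qed
  from this[of "length Ps"] show ?thesis by (simp flip: G)
qed

end

context connected_bipartite begin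

lemma interior_one_if_odd_ears:
  assumes "ear_decomposition (V, E) C Ps" "\<And>P. P \<in> set Ps \<Longrightarrow> odd (card (edges P))"
  shows "interior (\<lambda>v. 1)"
proof -
  obtain g N where "N \<ge> 1" "\<forall>e\<in>E. g e \<ge> 1" "\<forall>v. deg g v = (if v \<in> V then N else 0)"
    using regular_flow_ear_decomposition[OF assms] by (auto simp: regular_flow_def)
  then show ?thesis by (intro interior_if_positive_flow[of N g]) auto
qed

end

section \<open>Building ear decompositions step by step\<close>

definition ear_built :: "(nat \<Rightarrow> bool) \<Rightarrow> 'v graph \<Rightarrow> bool" where
  "ear_built Q H \<longleftrightarrow> (\<exists>C Ps. ear_decomposition H C Ps \<and> (\<forall>P\<in>set Ps. Q (card (edges P))))"

lemma ear_built_cycle: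
  assumes "distinct xs" "length xs \<ge> 3"
  shows "ear_built Q (set xs, cycle_edges xs)"
  unfolding ear_built_def ear_decomposition_def is_cycle_iff
  using assms by (intro exI[of _ "(set xs, cycle_edges xs)"] exI[of _ "[]"]) (auto simp: graph_Union_def)

lemma ear_built_ear:
  assumes H: "ear_built Q H" and xs: "distinct xs" "length xs \<ge> 2" "Q (length xs - 1)"
    "set xs \<inter> verts H = {hd xs, last xs}" "path_edges xs \<inter> edges H = {}"
  shows "ear_built Q (verts H \<union> set xs, edges H \<union> path_edges xs)"
proof -
  obtain C Ps where C: "is_cycle C" "H = graph_Union (C # Ps)" "\<And>P. P \<in> set Ps \<Longrightarrow> Q (card (edges P))"
    "\<And>i. i < length Ps \<Longrightarrow> \<exists>u v. is_path (Ps ! i) u v \<and>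
        graph_inter (graph_Union (C # take i Ps)) (Ps ! i) = ({u, v}, {})"
    using H unfolding ear_built_def ear_decomposition_def by blast
  define P where "P = (set xs, path_edges xs)"
  have "ear_decomposition (verts H \<union> set xs, edges H \<union> path_edges xs) C (Ps @ [P])"
    unfolding ear_decomposition_def
  proof (intro conjI allI impI C(1))
    show "(verts H \<union> set xs, edges H \<union> path_edges xs) = graph_Union (C # Ps @ [P])"
      using graph_Union_snoc[of "C # Ps" P] C(2) by (simp add: P_def)
    fix i assume i: "i < length (Ps @ [P])"
    show "\<exists>u v. is_path ((Ps @ [P]) ! i) u v \<and>
        graph_inter (graph_Union (C # take i (Ps @ [P]))) ((Ps @ [P]) ! i) = ({u, v}, {})"
    proof (cases "i < length Ps")
      case True
      then show ?thesis using C(4)[OF True] by (simp add: nth_append)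
    next
      case False
      then have "i = length Ps" using i by simp
      moreover have "is_path P (hd xs) (last xs)" using xs(1,2) by (auto simp: is_path_iff P_def)
      moreover have "graph_inter H P = ({hd xs, last xs}, {})"
        using xs(4,5) by (auto simp: graph_inter_def P_def)
      ultimately show ?thesis using C(2) by auto
    qed
  qed
  moreover have "\<forall>R\<in>set (Ps @ [P]). Q (card (edges R))"
    using C(3) card_path_edges[OF xs(1)] xs(3) by (auto simp: P_def)
  ultimately show ?thesis unfolding ear_built_def by blast
qed

lemma ear_built_edges:
  assumes "finite F" "ear_built Q (W, F0)" "Q 1" "\<And>e. e \<in> F \<Longrightarrow> e \<subseteq> W \<and> card e = 2"
  shows "ear_built Q (W, F0 \<union> F)"
  using assms(1,4)
proof (induction F)
  case empty then show ?case using assms(2) by simp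
next
  case (insert e F)
  then have IH: "ear_built Q (W, F0 \<union> F)" by simp
  show ?case
  proof (cases "e \<in> F0")
    case True
    then have "F0 \<union> insert e F = F0 \<union> F" by auto
    then show ?thesis using IH by simp
  next
    case False
    obtain x y where e: "e = {x, y}" "x \<noteq> y" using insert.prems[of e] by (auto simp: card_2_iff)
    have "ear_built Q (verts (W, F0 \<union> F) \<union> set [x, y], edges (W, F0 \<union> F) \<union> path_edges [x, y])"
      using e insert.prems[of e] insert.hyps(2) assms(3) False by (intro ear_built_ear[OF IH]) auto
    moreover have "W \<union> set [x, y] = W" using e insert.prems[of e] by auto
    ultimately show ?thesis using e by (simp add: insert_commute Un_commute)
  qed
qed

context two_connected_bipartite begin

text \<open>Requiring an inner vertex makes each such ear enlarge \<open>W\<close>; ears consisting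
  of a single edge are added at the end.\<close>

definition is_ear :: "'v set \<Rightarrow> 'v list \<Rightarrow> bool" where
  "is_ear W xs \<longleftrightarrow> distinct xs \<and> length xs \<ge> 3 \<and> set xs \<subseteq> V \<and> path_edges xs \<subseteq> E \<and>
    set xs \<inter> W = {hd xs, last xs}"

lemma E_card: "e \<in> E \<Longrightarrow> e \<subseteq> V \<and> card e = 2"
  using edge_subset by (auto elim!: edge_cases')

text \<open>Induction on the number of missing vertices. The predicate \<open>I\<close> is an
  invariant of the vertex set, later closure under a perfect matching. Keeping \<open>F\<close>
  inside \<open>Pow W\<close> ensures that the edges of the next ear are new.\<close>

lemma ear_built_extend:
  assumes step: "\<And>W. W \<subset> V \<Longrightarrow> u \<in> W \<Longrightarrow> v \<in> W \<Longrightarrow> I W \<Longrightarrow> \<exists>xs. is_ear W xs \<and> I (W \<union> set xs) \<and> Q (length xs - 1)"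
    and W: "W \<subseteq> V" "u \<in> W" "v \<in> W" "I W"
    and F: "F \<subseteq> E" "F \<subseteq> Pow W" "ear_built Q (W, F)"
  shows "\<exists>F\<subseteq>E. ear_built Q (V, F)"
  using W F
proof (induction "card (V - W)" arbitrary: W F rule: less_induct)
  case less
  show ?case
  proof (cases "W = V")
    case True
    then show ?thesis using less.prems by blast
  next
    case False
    then obtain xs where xs: "is_ear W xs" "I (W \<union> set xs)" "Q (length xs - 1)"
      using step[of W] less.prems by blast
    have x: "distinct xs" "length xs \<ge> 3" "set xs \<subseteq> V" "path_edges xs \<subseteq> E" "set xs \<inter> W = {hd xs, last xs}"
      using xs(1) by (auto simp: is_ear_def)
    have "path_edges xs \<inter> F = {}"
    proof (rule ccontr)
      assume "path_edges xs \<inter> F \<noteq> {}"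
      then obtain e where e: "e \<in> path_edges xs" "e \<in> F" by blast
      then have "e \<subseteq> set xs \<inter> W" using path_edges_subset[OF e(1)] less.prems(6) by blast
      then show False using path_edge_interior[OF x(1,2) e(1)] x(5) by simp
    qed
    then have 1: "ear_built Q (W \<union> set xs, F \<union> path_edges xs)"
      using ear_built_ear[OF less.prems(7) x(1)] x xs(3) by simp
    have "\<not> set xs \<subseteq> W"
    proof
      assume "set xs \<subseteq> W"
      then have "set xs = {hd xs, last xs}" using x(5) by blast
      then have "card (set xs) \<le> 2" by (simp add: card_insert_if)
      then show False using x(1,2) distinct_card[of xs] by simp
    qed
    then have "V - (W \<union> set xs) \<subset> V - W" using x(3) by blast
    then have "card (V - (W \<union> set xs)) < card (V - W)" using finite_V by (intro psubset_card_mono) auto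
    then show ?thesis
    proof (rule less.hyps)
      show "F \<union> path_edges xs \<subseteq> Pow (W \<union> set xs)"
        using less.prems(6) path_edges_subset[of _ xs] by blast
    qed (use less.prems(1,2,3,5) x(3,4) xs(2) 1 in auto)
  qed
qed

text \<open>An ear attached to \<open>{u, v}\<close> is closed to the initial cycle by the edge
  between them, so the same step also provides the cycle. When all vertices are reached, the
  remaining edges are ears of length one, whence \<open>Q 1\<close>.\<close>

lemma ear_decomposition_by_steps:
  assumes uv: "{u, v} \<in> E" "I {u, v}" and "Q 1"
    and step: "\<And>W. W \<subset> V \<Longrightarrow> u \<in> W \<Longrightarrow> v \<in> W \<Longrightarrow> I W \<Longrightarrow> \<exists>xs. is_ear W xs \<and> I (W \<union> set xs) \<and> Q (length xs - 1)"
  shows "ear_built Q (V, E)"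
proof -
  have uvV: "u \<in> V" "v \<in> V" "u \<noteq> v" using edge_subset[OF uv(1)] edge_distinct[OF uv(1)] by auto
  have ne: "{u, v} \<noteq> V"
  proof
    assume eq: "{u, v} = V"
    have "card {u, v} = 2" using uvV(3) by simp
    then show False using card_V unfolding eq by simp
  qed
  have "\<exists>xs. is_ear {u, v} xs \<and> I ({u, v} \<union> set xs) \<and> Q (length xs - 1)"
  proof (rule step)
    show "{u, v} \<subset> V" using uvV(1,2) ne by (intro psubsetI) simp_all
  qed (use uv(2) in simp_all)
  then obtain xs where xs: "is_ear {u, v} xs" "I ({u, v} \<union> set xs)" by blast
  have x: "distinct xs" "length xs \<ge> 3" "set xs \<subseteq> V" "path_edges xs \<subseteq> E" "set xs \<inter> {u, v} = {hd xs, last xs}"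
    using xs(1) by (auto simp: is_ear_def)
  have "hd xs \<noteq> last xs"
  proof (cases xs)
    case (Cons a ys)
    then have "ys \<noteq> []" using x(2) by auto
    then have "last xs \<in> set ys" using Cons by simp
    then show ?thesis using Cons x(1) by auto
  qed (use x(2) in simp)
  then have "card {hd xs, last xs} = card {u, v}" using uvV(3) by simp
  then have "{hd xs, last xs} = {u, v}" using x(5) by (intro card_subset_eq) auto
  then have hl: "{last xs, hd xs} = {u, v}" "{u, v} \<subseteq> set xs" using x(5) by (simp_all add: insert_commute, blast)
  then have "cycle_edges xs \<subseteq> E" using x(4) uv(1) by (simp add: cycle_edges_def)
  moreover have "cycle_edges xs \<subseteq> Pow (set xs)" using path_edges_subset[of _ xs] hl by (auto simp: cycle_edges_def)
  moreover have "I (set xs)" using xs(2) unfolding Un_absorb1[OF hl(2)] .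
  ultimately have "\<exists>F\<subseteq>E. ear_built Q (V, F)"
    using hl(2) x(3) ear_built_cycle[OF x(1,2)]
    by (intro ear_built_extend[where I = I and W = "set xs" and F = "cycle_edges xs", OF step]) auto
  then obtain F where F: "F \<subseteq> E" "ear_built Q (V, F)" by blast
  have "ear_built Q (V, F \<union> E)" using finite_E F(2) assms(3) E_card by (rule ear_built_edges)
  moreover have "F \<union> E = E" using F(1) by auto
  ultimately show ?thesis by simp
qed

text \<open>Let \<open>y\<close> be an outside neighbour of \<open>x\<close> in \<open>W\<close>,
  and \<open>K\<close> its component outside \<open>W\<close>. As \<open>x\<close> is not a cut
  vertex, some edge leaves \<open>K\<close> without ending in \<open>x\<close>; it must end in
  another vertex of \<open>W\<close>, and a path through \<open>K\<close> joins the two.\<close>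

lemma whitney_step:
  assumes W: "W \<subset> V" "u \<in> W" "v \<in> W" "u \<noteq> v"
  shows "\<exists>xs. is_ear W xs"
proof -
  obtain x y where xy: "x \<in> W" "y \<in> V - W" "{x, y} \<in> E" using bicutD[OF connected, of W] W by blast
  define r where "r = {(a, b). {a, b} \<in> E \<and> a \<in> V - W \<and> b \<in> V - W}"
  define K where "K = {k \<in> V - W. (y, k) \<in> r\<^sup>*}"
  obtain w where w: "w \<in> W" "w \<noteq> x" using W by metis
  have K: "K \<subseteq> V - {x}" "K \<noteq> {}" "K \<noteq> V - {x}" using xy w W(1) by (auto simp: K_def)
  obtain k z where kz: "k \<in> K" "z \<in> V - {x}" "z \<notin> K" "{k, z} \<in> E"
    using bicutD[OF two_connected[of x] K] xy W(1) by blast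
  have kV: "k \<in> V - W" "(y, k) \<in> r\<^sup>*" using kz(1) by (auto simp: K_def)
  have zW: "z \<in> W"
  proof (rule ccontr)
    assume "z \<notin> W"
    then have "(k, z) \<in> r" using kz kV by (auto simp: r_def)
    then show False using kV kz \<open>z \<notin> W\<close> by (auto simp: K_def dest: rtrancl_into_rtrancl)
  qed
  obtain ys where ys: "ys \<noteq> []" "hd ys = y" "last ys = k" "distinct ys" "successively (\<lambda>a b. (a, b) \<in> r) ys"
    using rtrancl_distinct_path[OF kV(2)] by blast
  have ysV: "set ys \<subseteq> V - W" using ys(1,2,5) xy(2)
  proof (induction ys arbitrary: y)
    case (Cons a as)
    then show ?case by (cases as) (auto simp: r_def)
  qed simp
  define xs where "xs = x # ys @ [z]"
  have "successively (\<lambda>a b. {a, b} \<in> E) ys" using ys(5) by (rule successively_mono) (auto simp: r_def)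
  then have "path_edges xs \<subseteq> E" unfolding path_edges_successively xs_def
    using ys(1,2,3) xy kz by (auto simp: successively_Cons successively_append_iff)
  moreover have "distinct xs" "length xs \<ge> 3" "set xs \<subseteq> V" "set xs \<inter> W = {hd xs, last xs}"
    using ys ysV xy kz zW W(1) by (auto simp: xs_def Suc_le_eq)
  ultimately show ?thesis unfolding is_ear_def by blast
qed

text \<open>Ensures that the minimum defining \<open>phi\<close> is taken over a non-empty
  set.\<close>

lemma ear_built_exists: "ear_built (\<lambda>n. True) (V, E)"
proof -
  obtain a where a: "a \<in> A" using A_nonempty by blast
  then obtain b where b: "{a, b} \<in> E" using has_neighbour[of a] by (auto simp: V_def)
  then have ne: "a \<noteq> b" using edge_distinct by blast
  show ?thesis
  proof (rule ear_decomposition_by_steps[where I = "\<lambda>W. True", OF b])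
    show "\<exists>xs. is_ear W xs \<and> True \<and> True" if "W \<subset> V" "a \<in> W" "b \<in> W" for W
      using whitney_step[OF that ne] by blast
  qed auto
qed

section \<open>Odd ears from alternating cycles\<close>

lemma perfect_matching_partner:
  assumes "perfect_matching (V, E) M"
  obtains m where "\<And>v. v \<in> V \<Longrightarrow> m v \<in> V" "\<And>v. v \<in> V \<Longrightarrow> {v, m v} \<in> E"
    "\<And>v. v \<in> V \<Longrightarrow> m (m v) = v" "\<And>x y. {x, y} \<in> M \<Longrightarrow> m x = y"
proof -
  have M: "M \<subseteq> E" "\<And>v. v \<in> V \<Longrightarrow> \<exists>!e. e \<in> M \<and> v \<in> e" using assms by (auto simp: perfect_matching_def)
  have ex: "\<exists>w. {v, w} \<in> M" if "v \<in> V" for v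
  proof -
    from M(2)[OF that] obtain e where "e \<in> M" "v \<in> e" by blast
    moreover from this obtain a b where "e = {a, b}" using M(1) by (auto elim!: edge_cases')
    ultimately show ?thesis by (cases "v = a") (auto simp: insert_commute)
  qed
  then obtain m where m: "\<And>v. v \<in> V \<Longrightarrow> {v, m v} \<in> M" by metis
  have mV: "m v \<in> V" if "v \<in> V" for v using m[OF that] M(1) edge_subset by blast
  have uniq: "m x = y" if "{x, y} \<in> M" for x y
  proof -
    have xV: "x \<in> V" using that M(1) edge_subset by blast
    have "{x, m x} = {x, y}" using M(2)[OF xV] m[OF xV] that by (metis insertI1)
    moreover have "x \<noteq> y" using that M(1) edge_distinct[of x y] by blast
    ultimately show ?thesis by (metis doubleton_eq_iff)
  qed
  show ?thesis
  proof (rule that[of m])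
    show "m (m v) = v" if "v \<in> V" for v using m[OF that] by (intro uniq) (simp add: insert_commute)
  qed (use m mV uniq M(1) in auto)
qed

text \<open>Alternating between the matching \<open>m\<close> and a matching \<open>m'\<close> through an edge leaving \<open>W\<close>
  one runs along an \<open>m\<close>-\<open>m'\<close> cycle, which must come back to \<open>W\<close>.\<close>

lemma odd_ear_step:
  assumes mc: "matching_covered (V, E)"
    and m: "\<And>v. v \<in> V \<Longrightarrow> m v \<in> V" "\<And>v. v \<in> V \<Longrightarrow> {v, m v} \<in> E" "\<And>v. v \<in> V \<Longrightarrow> m (m v) = v"
    and W: "W \<subset> V" "W \<noteq> {}" "m ` W \<subseteq> W"
  shows "\<exists>xs. is_ear W xs \<and> m ` (W \<union> set xs) \<subseteq> W \<union> set xs \<and> odd (length xs - 1)"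
proof -
  obtain x y where xy: "x \<in> W" "y \<in> V - W" "{x, y} \<in> E" using bicutD[OF connected, of W] W by blast
  obtain M' where M': "perfect_matching (V, E) M'" "{x, y} \<in> M'"
    using mc xy(3) by (auto simp: matching_covered_def)
  obtain m' where m': "\<And>v. v \<in> V \<Longrightarrow> m' v \<in> V" "\<And>v. v \<in> V \<Longrightarrow> {v, m' v} \<in> E"
    "\<And>v. v \<in> V \<Longrightarrow> m' (m' v) = v" "\<And>x y. {x, y} \<in> M' \<Longrightarrow> m' x = y"
    using perfect_matching_partner[OF M'(1)] by blast
  have m'y: "m' y = x" using m'(4)[of y x] M'(2) by (simp add: insert_commute)
  have xV: "x \<in> V" using xy(1) W(1) by blast
  have out: "m s \<in> V - W" if "s \<in> V - W" for s
    using that m(1,3)[of s] W(3) by (metis DiffD1 DiffD2 DiffI image_subset_iff)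
  define r where "r = {(s, t). t = m' (m s) \<and> s \<in> V - W \<and> t \<in> V - W}"
  define K where "K = {k \<in> V - W. (y, k) \<in> r\<^sup>*}"
  have finK: "finite K" using finite_V by (simp add: K_def)
  have yK: "y \<in> K" using xy by (simp add: K_def)
  have inj: "inj_on (\<lambda>s. m' (m s)) V"
    by (rule inj_on_inverseI[of _ "\<lambda>s. m (m' s)"]) (simp add: m m')
  \<comment> \<open>Otherwise the injective map \<open>m' (m k)\<close> sends the finite set
    \<open>K\<close> onto itself and some \<open>k\<close> is mapped to \<open>y\<close>. Then
    \<open>m k = m' y = x\<close>, although \<open>m\<close> keeps vertices outside \<open>W\<close>
    outside.\<close>
  have "\<exists>k\<in>K. m' (m k) \<in> W"
  proof (rule ccontr)
    assume none: "\<not> ?thesis"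
    have "m' (m k) \<in> K" if k: "k \<in> K" for k
    proof -
      have kV: "k \<in> V - W" "(y, k) \<in> r\<^sup>*" using k by (auto simp: K_def)
      have "m' (m k) \<in> V - W" using none k m(1) m'(1) kV by blast
      moreover from this have "(k, m' (m k)) \<in> r" using kV by (simp add: r_def)
      ultimately show ?thesis using kV by (auto simp: K_def dest: rtrancl_into_rtrancl)
    qed
    then have "(\<lambda>s. m' (m s)) ` K = K"
      using finK inj by (intro endo_inj_surj) (auto simp: K_def intro: inj_on_subset)
    then obtain k where k: "k \<in> K" "y = m' (m k)" using yK by (metis imageE)
    then have kV: "k \<in> V - W" by (simp add: K_def)
    then have "x = m k" using k(2) m'y m'(3)[of "m k"] m(1) by auto
    then show False using out[OF kV] xy(1) by simp
  qed
  then obtain k where k: "k \<in> K" "m' (m k) \<in> W" by blast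
  define z where "z = m' (m k)"
  have kV: "k \<in> V - W" "(y, k) \<in> r\<^sup>*" using k by (auto simp: K_def)
  obtain ss where ss: "ss \<noteq> []" "hd ss = y" "last ss = k" "distinct ss" "successively (\<lambda>a b. (a, b) \<in> r) ss"
    using rtrancl_distinct_path[OF kV(2)] by blast
  have sgm: "sg (m s) = - sg s" if "s \<in> V" for s using m(2)[OF that] by (rule sg_edge)
  have sgm': "sg (m' s) = - sg s" if "s \<in> V" for s using m'(2)[OF that] by (rule sg_edge)
  have ssV: "set ss \<subseteq> {s \<in> V - W. sg s = sg y}" using ss(1,2,5) xy(2)
  proof (induction ss arbitrary: y)
    case (Cons a as)
    show ?case
    proof (cases as)
      case Nil then show ?thesis using Cons.prems by auto
    next
      case (Cons b bs)
      have b: "b = m' (m a)" "a \<in> V - W" "b \<in> V - W" using Cons.prems Cons by (auto simp: r_def)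
      then have "sg b = sg a" using sgm sgm' m(1) by auto
      then show ?thesis using Cons.IH[of b] Cons.prems Cons b by auto
    qed
  qed simp
  \<comment> \<open>Each visited vertex is followed by its partner under \<open>m\<close>, which
    keeps the extended vertex set closed under \<open>m\<close> and makes the number of inner
    vertices even.\<close>
  define w where "w = concat (map (\<lambda>s. [s, m s]) ss)"
  have wset: "set w = set ss \<union> m ` set ss" by (auto simp: w_def)
  have wlen: "length w = 2 * length ss" unfolding w_def by (induction ss) auto
  have wdist: "distinct w" using ss(4) ssV unfolding w_def
  proof (induction ss)
    case (Cons a as)
    have aV: "a \<in> V" "sg a = sg y" using Cons.prems by auto
    have "a \<noteq> m s \<and> m a \<noteq> m s \<and> m a \<noteq> s" if "s \<in> set as" for s
    proof -
      have s: "s \<in> V" "sg s = sg y" "s \<noteq> a" using Cons.prems that by auto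
      have "sg y \<noteq> - sg y" using sg_nonzero[of y] by simp
      then show ?thesis using s aV sgm[of s] sgm[of a] m(3)[of a] m(3)[of s] by metis
    qed
    moreover have "a \<noteq> m a" using m(2)[OF aV(1)] edge_distinct by blast
    ultimately show ?case using Cons by auto
  qed simp
  have wne: "w \<noteq> []" using wlen ss(1) by auto
  have wends: "hd w = y" "last w = m k"
  proof -
    show "hd w = y" using ss(1,2) by (cases ss) (auto simp: w_def)
    have "last (concat (map (\<lambda>s. [s, m s]) ss)) = m (last ss)" using ss(1) by (induction ss) auto
    then show "last w = m k" using ss(3) by (simp add: w_def)
  qed
  have wsucc: "successively (\<lambda>a b. {a, b} \<in> E) w" using ss(5) ssV unfolding w_def
  proof (induction ss)
    case (Cons a as)
    have aV: "a \<in> V" using Cons.prems by auto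
    show ?case
    proof (cases as)
      case Nil then show ?thesis using m(2)[OF aV] by simp
    next
      case (Cons b bs)
      have "b = m' (m a)" using Cons.prems Cons by (auto simp: r_def)
      then have "{m a, b} \<in> E" using m'(2) m(1) aV by simp
      then show ?thesis using Cons.IH Cons.prems Cons m(2)[OF aV] by auto
    qed
  qed simp
  define xs where "xs = x # w @ [z]"
  have wV: "set w \<subseteq> V - W" using wset ssV out by auto
  \<comment> \<open>Applying \<open>m\<close> and \<open>m'\<close> in turn preserves the side, so
    the end \<open>z\<close> lies opposite to \<open>x\<close> and the ear is open.\<close>
  have "sg z = sg y" using ssV ss(1,3) sgm sgm' m(1) kV unfolding z_def by (auto dest: last_in_set)
  moreover have "sg y = - sg x" using sg_edge[OF xy(3)] .
  ultimately have "x \<noteq> z" by (auto simp: sg_def split: if_splits)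
  have zW: "z \<in> W" using k by (simp add: z_def)
  have "{m k, z} \<in> E" unfolding z_def using m'(2) m(1) kV by blast
  then have "path_edges xs \<subseteq> E" unfolding path_edges_successively xs_def
    using wsucc wne wends xy(3) by (auto simp: successively_Cons successively_append_iff)
  moreover have "distinct xs" "length xs \<ge> 3" "set xs \<subseteq> V" "set xs \<inter> W = {hd xs, last xs}"
    using wdist wV wne xy(1) xV zW W(1) \<open>x \<noteq> z\<close> by (auto simp: xs_def Suc_le_eq)
  ultimately have "is_ear W xs" unfolding is_ear_def by blast
  moreover have "m ` (W \<union> set xs) \<subseteq> W \<union> set xs"
    using W(3) xy(1) zW wset ssV m(3) by (auto simp: xs_def)
  moreover have "odd (length xs - 1)" by (simp add: xs_def wlen)
  ultimately show ?thesis by blast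
qed

text \<open>The starting edge is an edge of the matching that defines \<open>m\<close>, so its two
  ends form a set closed under \<open>m\<close>.\<close>

lemma odd_ears_exist:
  assumes "matching_covered (V, E)"
  shows "ear_built odd (V, E)"
proof -
  obtain a where a: "a \<in> A" using A_nonempty by blast
  then obtain b where b: "{a, b} \<in> E" using has_neighbour[of a] by (auto simp: V_def)
  obtain M where M: "perfect_matching (V, E) M" "{a, b} \<in> M" using assms b by (auto simp: matching_covered_def)
  obtain m where m: "\<And>v. v \<in> V \<Longrightarrow> m v \<in> V" "\<And>v. v \<in> V \<Longrightarrow> {v, m v} \<in> E"
    "\<And>v. v \<in> V \<Longrightarrow> m (m v) = v" "\<And>x y. {x, y} \<in> M \<Longrightarrow> m x = y"
    using perfect_matching_partner[OF M(1)] by blast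
  have ab: "m a = b" "m b = a" using m(4)[of a b] m(4)[of b a] M(2) by (simp_all add: insert_commute)
  show ?thesis
  proof (rule ear_decomposition_by_steps[where I = "\<lambda>W. m ` W \<subseteq> W", OF b])
    show "m ` {a, b} \<subseteq> {a, b}" using ab by simp
    show "\<exists>xs. is_ear W xs \<and> m ` (W \<union> set xs) \<subseteq> W \<union> set xs \<and> odd (length xs - 1)"
      if "W \<subset> V" "a \<in> W" "b \<in> W" "m ` W \<subseteq> W" for W
      using odd_ear_step[OF assms m(1-3) that(1) _ that(4)] that(2) by blast
  qed auto
qed

text \<open>The initial cycle of a bipartite graph is even and always counted, so the value 1 leaves
  no room for an even ear.\<close>

lemma even_members_eq_one:
  assumes "ear_decomposition (V, E) C Ps"
  shows "even_members (C # Ps) \<ge> 1" and "even_members (C # Ps) = 1 \<longleftrightarrow> (\<forall>P\<in>set Ps. odd (card (edges P)))"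
proof -
  obtain xs where xs: "distinct xs" "length xs \<ge> 3" "C = (set xs, cycle_edges xs)"
    using assms by (auto simp: ear_decomposition_def is_cycle_iff)
  have "edges C \<subseteq> E" using arg_cong[of "(V, E)" "graph_Union (C # Ps)" snd] assms
    by (auto simp: ear_decomposition_def graph_Union_def)
  then have "even (length xs)" using xs by (intro cycle_even) auto
  then have "even (card (edges C))" using card_cycle_edges[OF xs(1,2)] xs(3) by simp
  then show "even_members (C # Ps) \<ge> 1" "even_members (C # Ps) = 1 \<longleftrightarrow> (\<forall>P\<in>set Ps. odd (card (edges P)))"
    by (auto simp: even_members_def filter_empty_conv)
qed

theorem phi_eq_one_iff:
  "phi (V, E) = 1 \<longleftrightarrow> ear_built odd (V, E)"
proof
  obtain C0 Ps0 where "ear_decomposition (V, E) C0 Ps0" using ear_built_exists by (auto simp: ear_built_def)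
  then have "\<exists>C Ps. ear_decomposition (V, E) C Ps \<and> even_members (C # Ps) = phi (V, E)"
    unfolding phi_def by (intro LeastI[of "\<lambda>n. \<exists>C Ps. ear_decomposition (V, E) C Ps \<and> even_members (C # Ps) = n"]) blast
  moreover assume "phi (V, E) = 1"
  ultimately obtain C Ps where "ear_decomposition (V, E) C Ps" "even_members (C # Ps) = 1" by auto
  then show "ear_built odd (V, E)" using even_members_eq_one(2) unfolding ear_built_def by blast
next
  assume "ear_built odd (V, E)"
  then obtain C Ps where "ear_decomposition (V, E) C Ps" "even_members (C # Ps) = 1"
    using even_members_eq_one(2) unfolding ear_built_def by blast
  then show "phi (V, E) = 1" unfolding phi_def
  proof (intro Least_equality exI conjI)
    fix n assume "\<exists>C Ps. ear_decomposition (V, E) C Ps \<and> even_members (C # Ps) = n"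
    then show "1 \<le> n" using even_members_eq_one(1) by blast
  qed
qed

theorem phi_iff_matching_covered:
  assumes "connected_graph (V, E)"
  shows "phi (V, E) = 1 \<longleftrightarrow> matching_covered (V, E)"
  using phi_eq_one_iff odd_ears_exist interior_one_if_odd_ears matching_covered_if_interior_one[OF _ assms]
  unfolding ear_built_def by blast

theorem lead_coeff_iff_matching_covered:
  assumes "connected_graph (V, E)"
  shows "lead_coeff h_poly = 1 \<longleftrightarrow> matching_covered (V, E)"
  using lead_coeff_one_iff matching_covered_if_interior_one[OF _ assms] interior_one_if_matching_covered by blast

end

section \<open>Krull dimension and Hilbert series of the edge ring\<close>

lemma edge_ring_simps:
  "carrier (edge_ring k G) = generate_ring ring_of_type_algebra (range const \<union> edge_mono ` edges G)"
  "monoid.mult (edge_ring k G) = (*)" "monoid.one (edge_ring k G) = 1"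
  "ring.zero (edge_ring k G) = 0" "ring.add (edge_ring k G) = (+)"
  by (simp_all add: edge_ring_def ring_of_type_algebra_def)

lemma cring_edge_ring:
  fixes k :: "'k::comm_ring_1 itself" and G :: "'v graph"
  shows "cring (edge_ring k G)"
proof -
  interpret U: cring "ring_of_type_algebra :: ('v, 'k) mpoly ring" by (rule cring_from_type_algebra)
  define H :: "('v, 'k) mpoly set" where "H = range const \<union> edge_mono ` edges G"
  have "H \<subseteq> carrier ring_of_type_algebra" by (simp add: ring_of_type_algebra_def)
  then have "subcring (generate_ring ring_of_type_algebra H) ring_of_type_algebra"
    by (intro U.subcringI' U.generate_ring_is_subring)
  then show ?thesis unfolding edge_ring_def H_def
    using U.subcring_iff by (simp add: ring_of_type_algebra_def)
qed

section \<open>Ideals of the edge ring and chains of primes\<close>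

context
  fixes k :: "'k::field itself" and G :: "'v graph"
begin

interpretation R: cring "edge_ring k G" by (rule cring_edge_ring)

lemma edge_ring_closed:
  assumes "p \<in> carrier (edge_ring k G)" "q \<in> carrier (edge_ring k G)"
  shows "p + q \<in> carrier (edge_ring k G)" "p * q \<in> carrier (edge_ring k G)"
  using R.add.m_closed[OF assms] R.m_closed[OF assms] by (simp_all add: edge_ring_simps(2,5))

lemma edge_ring_zero: "0 \<in> carrier (edge_ring k G)" and edge_ring_one: "1 \<in> carrier (edge_ring k G)"
  using R.zero_closed R.one_closed by (simp_all add: edge_ring_simps(3,4))

lemma edge_ring_const: "const c \<in> carrier (edge_ring k G)"
  unfolding edge_ring_simps by (rule generate_ring.incl) simp

lemma edge_ring_edge_mono: "e \<in> edges G \<Longrightarrow> edge_mono e \<in> carrier (edge_ring k G)"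
  unfolding edge_ring_simps by (rule generate_ring.incl) simp

lemma edge_ring_power: "p \<in> carrier (edge_ring k G) \<Longrightarrow> p ^ n \<in> carrier (edge_ring k G)"
  by (induction n) (simp_all add: edge_ring_one edge_ring_closed(2))

lemma edge_ring_sum: "(\<And>i. i \<in> I \<Longrightarrow> f i \<in> carrier (edge_ring k G)) \<Longrightarrow> sum f I \<in> carrier (edge_ring k G)"
  by (induction I rule: infinite_finite_induct) (simp_all add: edge_ring_zero edge_ring_closed(1))

lemma edge_ring_uminus: "p \<in> carrier (edge_ring k G) \<Longrightarrow> - p \<in> carrier (edge_ring k G)"
proof -
  have "const (-1) = (-1 :: ('v, 'k) mpoly)" by (simp add: const_def single_uminus flip: single_one)
  moreover assume "p \<in> carrier (edge_ring k G)"
  ultimately show ?thesis using edge_ring_closed(2)[OF edge_ring_const[of "-1"]] by (metis mult_minus1)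
qed

lemma edge_ring_ideal:
  assumes "ideal J (edge_ring k G)"
  shows "J \<subseteq> carrier (edge_ring k G)" "0 \<in> J" "p \<in> J \<Longrightarrow> q \<in> J \<Longrightarrow> p + q \<in> J"
    "p \<in> J \<Longrightarrow> c \<in> carrier (edge_ring k G) \<Longrightarrow> c * p \<in> J" "p \<in> J \<Longrightarrow> - p \<in> J"
proof -
  interpret J: ideal J "edge_ring k G" by fact
  show "J \<subseteq> carrier (edge_ring k G)" using J.a_subset .
  show "0 \<in> J" using J.zero_closed by (simp add: edge_ring_simps)
  show "p \<in> J \<Longrightarrow> q \<in> J \<Longrightarrow> p + q \<in> J" using J.a_closed[of p q] by (simp add: edge_ring_simps)
  show *: "p \<in> J \<Longrightarrow> c \<in> carrier (edge_ring k G) \<Longrightarrow> c * p \<in> J" for p c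
    using J.I_l_closed[of p c] by (simp add: edge_ring_simps)
  show "p \<in> J \<Longrightarrow> - p \<in> J" using *[of p "-1"] edge_ring_uminus[OF edge_ring_one] by simp
qed

lemma edge_ring_prime:
  assumes "primeideal J (edge_ring k G)"
  shows "ideal J (edge_ring k G)" "1 \<notin> J"
    "p \<in> carrier (edge_ring k G) \<Longrightarrow> q \<in> carrier (edge_ring k G) \<Longrightarrow> p * q \<in> J \<Longrightarrow> p \<in> J \<or> q \<in> J"
proof -
  interpret J: primeideal J "edge_ring k G" by fact
  show id: "ideal J (edge_ring k G)" by (rule J.is_ideal)
  show "1 \<notin> J"
  proof
    assume "1 \<in> J"
    then have "c \<in> J" if "c \<in> carrier (edge_ring k G)" for c
      using edge_ring_ideal(4)[OF id, of 1 c] that by simp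
    then show False using J.I_notcarr edge_ring_ideal(1)[OF id] by blast
  qed
  show "p \<in> carrier (edge_ring k G) \<Longrightarrow> q \<in> carrier (edge_ring k G) \<Longrightarrow> p * q \<in> J \<Longrightarrow> p \<in> J \<or> q \<in> J"
    using J.I_prime[of p q] by (simp add: edge_ring_simps)
qed

text \<open>The constant term of the polynomial expression in \<open>x\<close> lies in
  \<open>Q\<close>, since \<open>x\<close> and the whole sum do; hence it is zero. What remains is
  \<open>x\<close> times a shorter expression, and \<open>x\<close> can be cancelled because
  \<open>P\<close> is prime and does not contain it.\<close>

lemma prime_chain_step:
  assumes P: "primeideal P (edge_ring k G)" and Q: "primeideal Q (edge_ring k G)" "P \<subseteq> Q" and x: "x \<in> Q" "x \<notin> P"
    and U: "\<And>a. a \<le> m \<Longrightarrow> U a \<in> carrier (edge_ring k G)" "\<And>a. a \<le> m \<Longrightarrow> U a \<in> Q \<Longrightarrow> U a = 0"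
    and sum: "(\<Sum>a\<le>m. x ^ a * U a) \<in> P"
  shows "\<forall>a\<le>m. U a = 0"
  using U sum
proof (induction m arbitrary: U)
  case 0
  then show ?case using Q(2) by auto
next
  case (Suc m)
  note iP = edge_ring_prime(1)[OF P] and iQ = edge_ring_prime(1)[OF Q(1)]
  have xC: "x \<in> carrier (edge_ring k G)" using x(1) edge_ring_ideal(1)[OF iQ] by blast
  define S where "S = (\<Sum>a\<le>m. x ^ a * U (Suc a))"
  have SC: "S \<in> carrier (edge_ring k G)" unfolding S_def
    using Suc.prems(1) xC by (intro edge_ring_sum edge_ring_closed(2) edge_ring_power) auto
  have eq: "(\<Sum>a\<le>Suc m. x ^ a * U a) = U 0 + x * S"
    unfolding S_def by (subst sum.atMost_Suc_shift) (simp add: sum_distrib_left mult.assoc)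
  have "S * x \<in> Q" using edge_ring_ideal(4)[OF iQ x(1) SC] .
  then have "- (x * S) \<in> Q" using edge_ring_ideal(5)[OF iQ] by (simp add: mult.commute)
  moreover have "U 0 + x * S \<in> Q" using Suc.prems(3) Q(2) eq by auto
  ultimately have "U 0 \<in> Q" using edge_ring_ideal(3)[OF iQ, of "U 0 + x * S" "- (x * S)"] by simp
  then have U0: "U 0 = 0" using Suc.prems(2)[of 0] by simp
  then have "x * S \<in> P" using Suc.prems(3) eq by simp
  then have "S \<in> P" using edge_ring_prime(3)[OF P xC SC] x(2) by blast
  then have "\<forall>a\<le>m. U (Suc a) = 0"
    unfolding S_def using Suc.prems(1,2) by (intro Suc.IH) auto
  then show ?case using U0 by (metis Suc_le_mono not0_implies_Suc)
qed

end

fun chain_monomial :: "(nat \<Rightarrow> 'a::comm_monoid_mult) \<Rightarrow> nat \<Rightarrow> nat list \<Rightarrow> 'a" where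
  "chain_monomial x j [] = 1"
| "chain_monomial x j (a # l) = x j ^ a * chain_monomial x (Suc j) l"

abbreviation exponent_lists :: "nat \<Rightarrow> nat \<Rightarrow> nat list set" where
  "exponent_lists m n \<equiv> {l. set l \<subseteq> {..m} \<and> length l = n}"

lemma exponent_lists_Suc: "exponent_lists m (Suc n) = (\<lambda>(a, l). a # l) ` ({..m} \<times> exponent_lists m n)"
  by (auto simp: length_Suc_conv image_iff)

lemma sum_exponent_lists_Suc:
  "(\<Sum>l\<in>exponent_lists m (Suc n). f l) = (\<Sum>a\<le>m. \<Sum>l\<in>exponent_lists m n. f (a # l))"
proof -
  have "inj_on (\<lambda>(a, l). a # l) ({..m} \<times> exponent_lists m n)" by (auto simp: inj_on_def)
  then show ?thesis unfolding exponent_lists_Suc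
    by (simp add: sum.reindex sum.cartesian_product case_prod_unfold)
qed

context
  fixes k :: "'k::field itself" and G :: "'v graph" and P :: "nat \<Rightarrow> ('v, 'k) mpoly set" and n :: nat
    and x :: "nat \<Rightarrow> ('v, 'k) mpoly"
  assumes P: "\<And>i. i \<le> n \<Longrightarrow> primeideal (P i) (edge_ring k G)" "\<And>i. i < n \<Longrightarrow> P i \<subseteq> P (Suc i)"
    and x: "\<And>i. i < n \<Longrightarrow> x i \<in> P (Suc i)" "\<And>i. i < n \<Longrightarrow> x i \<notin> P i"
begin

lemma chain_in_carrier: "i < n \<Longrightarrow> x i \<in> carrier (edge_ring k G)"
  using x(1) edge_ring_ideal(1)[OF edge_ring_prime(1)[OF P(1)[of "Suc i"]]] by auto

lemma chain_monomial_in_carrier: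
  "j + length l \<le> n \<Longrightarrow> chain_monomial x j l \<in> carrier (edge_ring k G)"
  by (induction l arbitrary: j)
    (auto simp: edge_ring_one intro!: edge_ring_closed(2) edge_ring_power chain_in_carrier)

text \<open>Elements picked from the steps of a chain of primes are algebraically independent.\<close>

lemma chain_independent:
  assumes "i + j = n" "(\<Sum>l\<in>exponent_lists m i. const (c l) * chain_monomial x j l) \<in> P j"
  shows "\<forall>l\<in>exponent_lists m i. c l = 0"
  using assms
proof (induction i arbitrary: j c)
  case 0
  have "exponent_lists m 0 = {[]}" by auto
  then have in_P: "const (c []) \<in> P n" using 0 by simp
  have "c [] = 0"
  proof (rule ccontr)
    assume "c [] \<noteq> 0"
    then have "const (inverse (c [])) * const (c []) = (1 :: ('v, 'k) mpoly)"
      by (simp add: const_def mult_single)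
    moreover have "const (inverse (c [])) * const (c []) \<in> P n"
      by (rule edge_ring_ideal(4)[OF edge_ring_prime(1)[OF P(1)] in_P edge_ring_const]) simp
    ultimately show False using edge_ring_prime(2)[OF P(1)[of n]] by simp
  qed
  then show ?case by auto
next
  case (Suc i)
  \<comment> \<open>The coefficient of \<open>x j ^ a\<close>, a polynomial expression in the later
    elements. By the induction hypothesis it can lie in \<open>P (Suc j)\<close> only if all its
    coefficients vanish, which is what \<open>prime_chain_step\<close> asks for.\<close>
  define U where "U = (\<lambda>a. \<Sum>l\<in>exponent_lists m i. const (c (a # l)) * chain_monomial x (Suc j) l)"
  have j: "j < n" "i + Suc j = n" using Suc.prems(1) by auto
  have zero: "\<forall>l\<in>exponent_lists m i. c (a # l) = 0" if "U a \<in> P (Suc j)" for a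
    using Suc.IH[of "Suc j" "\<lambda>l. c (a # l)"] j that by (simp add: U_def)
  have Uzero: "U a = 0" if "U a \<in> P (Suc j)" for a
    using zero[OF that] unfolding U_def by (intro sum.neutral) (auto simp: const_def)
  have "(\<Sum>l\<in>exponent_lists m (Suc i). const (c l) * chain_monomial x j l) = (\<Sum>a\<le>m. x j ^ a * U a)"
    unfolding sum_exponent_lists_Suc U_def by (simp add: sum_distrib_left mult_ac)
  then have "(\<Sum>a\<le>m. x j ^ a * U a) \<in> P j" using Suc.prems(2) by simp
  moreover have "U a \<in> carrier (edge_ring k G)" for a
    unfolding U_def using j
    by (intro edge_ring_sum edge_ring_closed(2) edge_ring_const chain_monomial_in_carrier) auto
  ultimately have "\<forall>a\<le>m. U a = 0"
    using j Uzero by (intro prime_chain_step[OF P(1) P(1) P(2) x(1) x(2)]) auto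
  then have "\<forall>l\<in>exponent_lists m i. c (a # l) = 0" if "a \<le> m" for a
    using zero[of a] edge_ring_ideal(2)[OF edge_ring_prime(1)[OF P(1)[of "Suc j"]]] j that by simp
  then show ?case unfolding exponent_lists_Suc by auto
qed

end

section \<open>Linear independence and growth of dimensions\<close>

lemma mpoly_span_singles:
  fixes p :: "('v, 'k::field) mpoly"
  assumes "Poly_Mapping.keys p \<subseteq> S"
  shows "p \<in> module.span scale_mpoly ((\<lambda>m. Poly_Mapping.single m 1) ` S)"
proof -
  interpret vs: vector_space "scale_mpoly :: 'k \<Rightarrow> ('v, 'k) mpoly \<Rightarrow> ('v, 'k) mpoly" by (rule vector_space_scale_mpoly)
  have "p = (\<Sum>m\<in>Poly_Mapping.keys p. scale_mpoly (Poly_Mapping.lookup p m) (Poly_Mapping.single m 1))"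
    by (rule poly_mapping_eqI)
      (auto simp: lookup_sum scale_mpoly_def const_def mult_single lookup_single when_def in_keys_iff
        sum.delta cong: if_cong)
  also have "\<dots> \<in> vs.span ((\<lambda>m. Poly_Mapping.single m 1) ` S)"
    using assms by (intro vs.span_sum vs.span_scale vs.span_base) auto
  finally show ?thesis .
qed

lemma independent_singles:
  "\<not> module.dependent scale_mpoly ((\<lambda>m. Poly_Mapping.single m (1::'k::field)) ` (S :: ('v \<Rightarrow>\<^sub>0 nat) set))"
proof -
  interpret vs: vector_space "scale_mpoly :: 'k \<Rightarrow> ('v, 'k) mpoly \<Rightarrow> ('v, 'k) mpoly" by (rule vector_space_scale_mpoly)
  show ?thesis unfolding vs.independent_explicit_finite_subsets
  proof (intro allI impI ballI)
    fix B u v assume B: "B \<subseteq> (\<lambda>m. Poly_Mapping.single m (1::'k)) ` S" "finite B"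
      and 0: "(\<Sum>v\<in>B. scale_mpoly (u v) v) = 0" and v: "v \<in> B"
    obtain m where m: "v = Poly_Mapping.single m 1" using B v by blast
    have "Poly_Mapping.lookup (\<Sum>v\<in>B. scale_mpoly (u v) v) m = (\<Sum>w\<in>B. if w = v then u v else 0)"
      unfolding lookup_sum
    proof (rule sum.cong[OF refl])
      fix w assume "w \<in> B"
      then obtain m' where m': "w = Poly_Mapping.single m' 1" using B by blast
      show "Poly_Mapping.lookup (scale_mpoly (u w) w) m = (if w = v then u v else 0)"
      proof (cases "m' = m")
        case True
        then show ?thesis using m m' by (simp add: scale_mpoly_def const_def mult_single)
      next
        case False
        then have "w \<noteq> v" unfolding m m' by (metis keys_single singleton_inject zero_neq_one)
        then show ?thesis using False m' by (simp add: scale_mpoly_def const_def mult_single lookup_single)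
      qed
    qed
    then show "u v = 0" using 0 v B(2) by simp
  qed
qed

text \<open>Independence is stated for an indexed family; coefficients 1 and -1 at two indices show
  that no member is repeated, so the family may be counted as a set.\<close>

lemma card_independent_family_le:
  fixes w :: "'i \<Rightarrow> ('v, 'k::field) mpoly"
  assumes "finite I" "finite S" "\<And>i. i \<in> I \<Longrightarrow> Poly_Mapping.keys (w i) \<subseteq> S"
    and ind: "\<And>c. (\<Sum>i\<in>I. const (c i) * w i) = 0 \<Longrightarrow> \<forall>i\<in>I. c i = 0"
  shows "card I \<le> card S"
proof -
  interpret vs: vector_space "scale_mpoly :: 'k \<Rightarrow> ('v, 'k) mpoly \<Rightarrow> ('v, 'k) mpoly" by (rule vector_space_scale_mpoly)
  have inj: "inj_on w I"
  proof (rule inj_onI, rule ccontr)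
    fix i j assume ij: "i \<in> I" "j \<in> I" "w i = w j" "i \<noteq> j"
    define c where "c = (\<lambda>l. if l = i then 1 else if l = j then -1 else 0 :: 'k)"
    have "(\<Sum>l\<in>I. const (c l) * w l) = (\<Sum>l\<in>{i, j}. const (c l) * w l)"
      using ij assms(1) by (intro sum.mono_neutral_right) (auto simp: c_def const_def)
    also have "\<dots> = 0" using ij
      by (simp add: c_def const_def single_uminus)
    finally show False using ind[of c] ij by (auto simp: c_def)
  qed
  have "vs.independent (w ` I)"
  proof (rule vs.independent_if_scalars_zero)
    fix f y assume "(\<Sum>x\<in>w ` I. scale_mpoly (f x) x) = 0" "y \<in> w ` I"
    then show "f y = 0" using ind[of "\<lambda>i. f (w i)"] inj by (auto simp: sum.reindex scale_mpoly_def)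
  qed (use assms(1) in simp)
  moreover have "w ` I \<subseteq> vs.span ((\<lambda>m. Poly_Mapping.single m 1) ` S)"
    using mpoly_span_singles assms(3) by blast
  ultimately have "card (w ` I) \<le> card ((\<lambda>m. Poly_Mapping.single m (1::'k)) ` S)"
    using vs.independent_span_bound assms(2) by blast
  then show ?thesis using inj card_image_le[OF assms(2), of "\<lambda>m. Poly_Mapping.single m (1::'k)"]
    by (simp add: card_image)
qed

lemma power_bound_exponent:
  assumes "\<And>m :: nat. (m + 1) ^ n \<le> (b * m + 1) ^ D"
  shows "n \<le> D"
proof (rule ccontr)
  assume "\<not> n \<le> D"
  \<comment> \<open>With this value the factor \<open>(b + 1) ^ D\<close> equals \<open>m\<close>,
    just below the extra factor \<open>m + 1\<close> on the other side.\<close>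
  define m where "m = (b + 1) ^ D"
  have "(m + 1) ^ Suc D \<le> (m + 1) ^ n" using \<open>\<not> n \<le> D\<close> by (intro power_increasing) auto
  also have "\<dots> \<le> (b * m + 1) ^ D" by fact
  also have "\<dots> \<le> ((b + 1) * (m + 1)) ^ D" by (intro power_mono) (auto simp: algebra_simps)
  also have "\<dots> = m * (m + 1) ^ D" by (simp only: power_mult_distrib m_def)
  finally have "(m + 1) * (m + 1) ^ D \<le> m * (m + 1) ^ D" by simp
  then show False by simp
qed

section \<open>Exponents of edge monomials and primes from vertex sets\<close>

definition exponent :: "'v set \<Rightarrow> 'v \<Rightarrow>\<^sub>0 nat" where
  "exponent e = (\<Sum>v\<in>e. Poly_Mapping.single v 1)"

lemma lookup_exponent: "finite e \<Longrightarrow> Poly_Mapping.lookup (exponent e) v = (if v \<in> e then 1 else 0)"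
  by (simp add: exponent_def lookup_sum lookup_single when_def)

lemma edge_mono_exponent: "finite e \<Longrightarrow> edge_mono e = Poly_Mapping.single (exponent e) (1::'k::comm_ring_1)"
  unfolding edge_mono_def exponent_def by (induction e rule: finite_induct) (simp_all add: var_def mult_single)

lemma prod_list_edge_mono:
  "(\<And>e. e \<in> set es \<Longrightarrow> finite e) \<Longrightarrow>
    prod_list (map edge_mono es) = Poly_Mapping.single (sum_list (map exponent es)) (1::'k::comm_ring_1)"
  by (induction es) (simp_all add: edge_mono_exponent mult_single)

lemma keys_plus_nat: "Poly_Mapping.keys (a + b :: 'v \<Rightarrow>\<^sub>0 nat) = Poly_Mapping.keys a \<union> Poly_Mapping.keys b"
  by (auto simp: in_keys_iff lookup_add)

text \<open>Says that \<open>p\<close> vanishes when all variables outside \<open>W\<close> are set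
  to zero, in terms of exponents instead of a substitution homomorphism.\<close>

definition avoids :: "'v set \<Rightarrow> ('v, 'k::comm_ring_1) mpoly \<Rightarrow> bool" where
  "avoids W p \<longleftrightarrow> (\<forall>m\<in>Poly_Mapping.keys p. \<not> Poly_Mapping.keys m \<subseteq> W)"

lemma avoids_add: "avoids W p \<Longrightarrow> avoids W q \<Longrightarrow> avoids W (p + q)"
  using keys_add[of p q] by (auto simp: avoids_def)

lemma avoids_mult: "avoids W p \<Longrightarrow> avoids W (q * p)"
  unfolding avoids_def
proof
  fix m assume p: "\<forall>m\<in>Poly_Mapping.keys p. \<not> Poly_Mapping.keys m \<subseteq> W" and "m \<in> Poly_Mapping.keys (q * p)"
  then obtain a b where "m = a + b" "b \<in> Poly_Mapping.keys p" using keys_mult[of q p] by blast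
  then show "\<not> Poly_Mapping.keys m \<subseteq> W" using p by (simp add: keys_plus_nat)
qed

lemma avoids_part:
  obtains q where "avoids W (p - q)" "\<And>m. m \<in> Poly_Mapping.keys q \<Longrightarrow> Poly_Mapping.keys m \<subseteq> W"
proof -
  define K where "K = {m \<in> Poly_Mapping.keys p. Poly_Mapping.keys m \<subseteq> W}"
  define q where "q = (\<Sum>m\<in>K. Poly_Mapping.single m (Poly_Mapping.lookup p m))"
  have "finite K" by (simp add: K_def)
  then have "Poly_Mapping.lookup q m = (if m \<in> K then Poly_Mapping.lookup p m else 0)" for m
    by (simp add: q_def lookup_sum lookup_single when_def)
  then show ?thesis
    by (intro that[of q]) (auto simp: avoids_def in_keys_iff lookup_minus K_def split: if_splits)
qed

text \<open>Split off the parts \<open>p1\<close> and \<open>q1\<close> with monomials in the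
  variables of \<open>W\<close> only. Their product has only such monomials, yet it avoids
  \<open>W\<close>, so it is zero, and the polynomial ring is a domain.\<close>

lemma avoids_prime:
  fixes p q :: "('v::linorder, 'k::idom) mpoly"
  assumes "avoids W (p * q)"
  shows "avoids W p \<or> avoids W q"
proof -
  obtain p1 where p1: "avoids W (p - p1)" "\<And>m. m \<in> Poly_Mapping.keys p1 \<Longrightarrow> Poly_Mapping.keys m \<subseteq> W"
    using avoids_part[of W p] by blast
  obtain q1 where q1: "avoids W (q - q1)" "\<And>m. m \<in> Poly_Mapping.keys q1 \<Longrightarrow> Poly_Mapping.keys m \<subseteq> W"
    using avoids_part[of W q] by blast
  have eq: "p1 * q1 = p * q + (- q) * (p - p1) + (- p1) * (q - q1)" by (simp add: algebra_simps)
  have av: "avoids W (p1 * q1)" unfolding eq by (intro avoids_add avoids_mult assms p1(1) q1(1))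
  have "Poly_Mapping.keys (p1 * q1) = {}"
  proof (rule ccontr)
    assume "Poly_Mapping.keys (p1 * q1) \<noteq> {}"
    then obtain m where m: "m \<in> Poly_Mapping.keys (p1 * q1)" by blast
    then obtain a b where "m = a + b" "a \<in> Poly_Mapping.keys p1" "b \<in> Poly_Mapping.keys q1"
      using keys_mult[of p1 q1] by blast
    then have "Poly_Mapping.keys m \<subseteq> W" using p1(2) q1(2) by (simp add: keys_plus_nat)
    then show False using av m by (auto simp: avoids_def)
  qed
  then have "p1 = 0 \<or> q1 = 0" by simp
  then show ?thesis using p1(1) q1(1) by auto
qed

definition coordinate_prime :: "'k::field itself \<Rightarrow> 'v graph \<Rightarrow> 'v set \<Rightarrow> ('v, 'k) mpoly set" where
  "coordinate_prime k G W = {p \<in> carrier (edge_ring k G). avoids W p}"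

lemma primeideal_coordinate_prime:
  fixes G :: "'v::linorder graph" and k :: "'k::field itself"
  shows "primeideal (coordinate_prime k G W) (edge_ring k G)"
proof -
  interpret R: cring "edge_ring k G" by (rule cring_edge_ring)
  have minus: "\<ominus>\<^bsub>edge_ring k G\<^esub> p = - p" if "p \<in> carrier (edge_ring k G)" for p
  proof (rule R.minus_equality)
    show "- p \<oplus>\<^bsub>edge_ring k G\<^esub> p = \<zero>\<^bsub>edge_ring k G\<^esub>" by (simp add: edge_ring_simps)
  qed (use that edge_ring_uminus[OF that] in simp_all)
  show ?thesis
  proof (rule primeidealI2)
    show "cring (edge_ring k G)" by (rule cring_edge_ring)
    show "additive_subgroup (coordinate_prime k G W) (edge_ring k G)"
    proof (rule additive_subgroupI, rule R.add.subgroupI)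
      show "coordinate_prime k G W \<subseteq> carrier (edge_ring k G)" by (auto simp: coordinate_prime_def)
      have "0 \<in> coordinate_prime k G W" by (simp add: coordinate_prime_def edge_ring_zero avoids_def)
      then show "coordinate_prime k G W \<noteq> {}" by blast
    next
      fix p assume "p \<in> coordinate_prime k G W"
      then show "\<ominus>\<^bsub>edge_ring k G\<^esub> p \<in> coordinate_prime k G W"
        by (auto simp: coordinate_prime_def minus edge_ring_uminus avoids_def)
    next
      fix p q assume "p \<in> coordinate_prime k G W" "q \<in> coordinate_prime k G W"
      then show "p \<oplus>\<^bsub>edge_ring k G\<^esub> q \<in> coordinate_prime k G W"
        by (auto simp: coordinate_prime_def edge_ring_simps(5) edge_ring_closed avoids_add)
    qed
  next
    fix p c assume "p \<in> coordinate_prime k G W" "c \<in> carrier (edge_ring k G)"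
    then show "c \<otimes>\<^bsub>edge_ring k G\<^esub> p \<in> coordinate_prime k G W" "p \<otimes>\<^bsub>edge_ring k G\<^esub> c \<in> coordinate_prime k G W"
      using avoids_mult[of W p c]
      by (auto simp: coordinate_prime_def edge_ring_simps(2) edge_ring_closed mult.commute)
  next
    have "1 \<notin> coordinate_prime k G W" by (simp add: coordinate_prime_def avoids_def)
    then show "carrier (edge_ring k G) \<noteq> coordinate_prime k G W" using edge_ring_one by blast
  next
    fix p q assume "p \<in> carrier (edge_ring k G)" "q \<in> carrier (edge_ring k G)"
      "p \<otimes>\<^bsub>edge_ring k G\<^esub> q \<in> coordinate_prime k G W"
    then show "p \<in> coordinate_prime k G W \<or> q \<in> coordinate_prime k G W"
      using avoids_prime[of W p q] by (auto simp: coordinate_prime_def edge_ring_simps(2))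
  qed
qed

section \<open>Counting exponents and the upper bound for the Krull dimension\<close>

context bipartite_sets begin

lemma finite_edge: "e \<in> E \<Longrightarrow> finite e"
  using edge_subset finite_V finite_subset by blast

lemma lookup_sum_list_exponent:
  assumes "set es \<subseteq> E"
  shows "int (Poly_Mapping.lookup (sum_list (map exponent es)) v) = deg (\<lambda>e. int (count_list es e)) v"
  using assms
proof (induction es)
  case (Cons e es)
  have "deg (\<lambda>e'. int (count_list (e # es) e')) v =
      deg (\<lambda>e'. int (count_list es e') + (if e' = e then 1 else 0)) v"
    by (rule arg_cong[of _ _ "\<lambda>f. deg f v"]) auto
  also have "\<dots> = deg (\<lambda>e'. int (count_list es e')) v + (if v \<in> e then 1 else 0)"
    using Cons.prems by (simp add: deg_add deg_single)
  finally show ?case using Cons by (simp add: lookup_add lookup_exponent finite_edge)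
qed simp

lemma sum_count_list_E:
  assumes "set es \<subseteq> E" shows "(\<Sum>e\<in>E. int (count_list es e)) = int (length es)"
  using assms
proof (induction es)
  case (Cons e es)
  have "(\<Sum>e'\<in>E. int (count_list (e # es) e')) = (\<Sum>e'\<in>E. int (count_list es e') + (if e' = e then 1 else 0))"
    by (intro sum.cong) auto
  then show ?case using Cons finite_E by (simp add: sum.distrib)
qed simp

lemma flow_as_list:
  assumes "\<And>e. e \<in> E \<Longrightarrow> f e \<ge> 0" "sum f E = int n"
  shows "\<exists>es. set es \<subseteq> E \<and> length es = n \<and> (\<forall>e\<in>E. int (count_list es e) = f e)"
  using assms
proof (induction n arbitrary: f)
  case 0
  then have "\<forall>e\<in>E. f e = 0" using finite_E by (simp add: sum_nonneg_eq_0_iff)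
  then show ?case by (intro exI[of _ "[]"]) simp
next
  case (Suc n)
  have "\<exists>e\<in>E. f e > 0"
  proof (rule ccontr)
    assume "\<not> ?thesis"
    then have "sum f E \<le> 0" by (intro sum_nonpos) auto
    then show False using Suc.prems(2) by simp
  qed
  then obtain e where e: "e \<in> E" "f e > 0" by blast
  have "\<exists>es. set es \<subseteq> E \<and> length es = n \<and> (\<forall>e'\<in>E. int (count_list es e') = f e' - (if e' = e then 1 else 0))"
  proof (rule Suc.IH)
    show "0 \<le> f e' - (if e' = e then 1 else 0)" if "e' \<in> E" for e' using Suc.prems(1)[OF that] e by auto
    show "(\<Sum>e'\<in>E. f e' - (if e' = e then 1 else 0)) = int n"
      using Suc.prems(2) e(1) finite_E by (simp add: sum_subtractf)
  qed
  then obtain es where es: "set es \<subseteq> E" "length es = n"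
    "\<And>e'. e' \<in> E \<Longrightarrow> int (count_list es e') = f e' - (if e' = e then 1 else 0)" by blast
  show ?case using es e(1) by (intro exI[of _ "e # es"]) (auto simp: es(3))
qed

text \<open>Keeps only the balance of exponents and a bound on their entries. This behaves well
  under products and is enough for a growth estimate.\<close>

definition box :: "nat \<Rightarrow> ('v \<Rightarrow>\<^sub>0 nat) set" where
  "box N = {m. Poly_Mapping.keys m \<subseteq> V \<and> sum (Poly_Mapping.lookup m) A = sum (Poly_Mapping.lookup m) B \<and>
    (\<forall>v. Poly_Mapping.lookup m v \<le> N)}"

lemma box_mono: "M \<le> N \<Longrightarrow> box M \<subseteq> box N"
  by (auto simp: box_def intro: order.trans)

lemma box_add: "a \<in> box M \<Longrightarrow> b \<in> box N \<Longrightarrow> a + b \<in> box (M + N)"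
  by (auto simp: box_def keys_plus_nat lookup_add sum.distrib intro: add_mono)

lemma box_0: "0 \<in> box N" by (simp add: box_def)

lemma box_exponent:
  assumes "e \<in> E" shows "exponent e \<in> box 1"
proof -
  obtain a b where ab: "a \<in> A" "b \<in> B" "e = {a, b}" "a \<noteq> b" "a \<notin> B" "b \<notin> A" using assms by (rule edge_cases')
  have l: "Poly_Mapping.lookup (exponent e) v = (if v \<in> e then 1 else 0)" for v
    by (rule lookup_exponent) (use ab in simp)
  have "A \<inter> e = {a}" "B \<inter> e = {b}" using ab by auto
  then have "sum (Poly_Mapping.lookup (exponent e)) A = sum (Poly_Mapping.lookup (exponent e)) B"
    using finite_A finite_B by (simp add: l sum.If_cases Int_def[symmetric])
  moreover have "Poly_Mapping.keys (exponent e) = e" by (simp add: set_eq_iff in_keys_iff l)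
  ultimately show ?thesis using edge_subset[OF assms] by (simp add: box_def l)
qed

lemma keys_mult_box:
  "Poly_Mapping.keys p \<subseteq> box M \<Longrightarrow> Poly_Mapping.keys q \<subseteq> box N \<Longrightarrow> Poly_Mapping.keys (p * q) \<subseteq> box (M + N)"
  using keys_mult[of p q] box_add by blast

lemma edge_ring_keys:
  fixes k :: "'k::field itself"
  assumes "p \<in> carrier (edge_ring k (V, E))"
  shows "\<exists>N. Poly_Mapping.keys p \<subseteq> box N"
  using assms unfolding edge_ring_simps
proof (induction rule: generate_ring.induct)
  case one
  show ?case using box_0 by (simp add: ring_of_type_algebra_def)
next
  case (incl p)
  then consider c where "p = const c" | e where "e \<in> E" "p = edge_mono e" by auto
  then show ?case
  proof cases
    case 1 then show ?thesis using box_0 by (auto simp: const_def)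
  next
    case 2 then show ?thesis using box_exponent[of e] by (intro exI[of _ 1]) (simp add: edge_mono_exponent finite_edge)
  qed
next
  case (a_inv p)
  interpret U: cring "ring_of_type_algebra :: ('v, 'k) mpoly ring" by (rule cring_from_type_algebra)
  have "\<ominus>\<^bsub>ring_of_type_algebra\<^esub> p = - p"
    by (rule U.minus_equality) (auto simp: ring_of_type_algebra_def)
  then show ?case using a_inv by simp
next
  case (eng_add p q)
  then obtain M N where "Poly_Mapping.keys p \<subseteq> box M" "Poly_Mapping.keys q \<subseteq> box N" by blast
  then have "Poly_Mapping.keys (p + q) \<subseteq> box (max M N)"
    using keys_add[of p q] box_mono[of M "max M N"] box_mono[of N "max M N"] by (meson Un_least max.cobounded1 max.cobounded2 order.trans)
  then show ?case by (auto simp: ring_of_type_algebra_def)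
next
  case (eng_mult p q)
  then obtain M N where "Poly_Mapping.keys p \<subseteq> box M" "Poly_Mapping.keys q \<subseteq> box N" by blast
  then have "Poly_Mapping.keys (p * q) \<subseteq> box (M + N)" by (rule keys_mult_box)
  then show ?case by (auto simp: ring_of_type_algebra_def)
qed

end

context connected_bipartite begin

text \<open>Balance recovers the entry at one vertex \<open>r\<close> from the others, which saves
  one in the exponent.\<close>

lemma card_box: "finite (box N) \<and> card (box N) \<le> (N + 1) ^ (card V - 1)"
proof -
  obtain r where r: "r \<in> A" using A_nonempty by blast
  define \<rho> where "\<rho> = (\<lambda>m :: 'v \<Rightarrow>\<^sub>0 nat. restrict (Poly_Mapping.lookup m) (V - {r}))"
  have "inj_on \<rho> (box N)"
  proof (rule inj_onI)
    fix m m' assume m: "m \<in> box N" "m' \<in> box N" "\<rho> m = \<rho> m'"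
    have eq: "Poly_Mapping.lookup m v = Poly_Mapping.lookup m' v" if "v \<in> V - {r}" for v
      using fun_cong[OF m(3), of v] that by (simp add: \<rho>_def)
    have B: "sum (Poly_Mapping.lookup m) B = sum (Poly_Mapping.lookup m') B"
      using eq r disjoint by (intro sum.cong) (auto simp: V_def)
    have A': "sum (Poly_Mapping.lookup m) (A - {r}) = sum (Poly_Mapping.lookup m') (A - {r})"
      using eq by (intro sum.cong) (auto simp: V_def)
    have "sum (Poly_Mapping.lookup m) A = sum (Poly_Mapping.lookup m') A" using m B by (simp add: box_def)
    then have "Poly_Mapping.lookup m r = Poly_Mapping.lookup m' r"
      using A' r finite_A by (simp add: sum.remove[of A r])
    moreover have "Poly_Mapping.lookup m v = 0 \<and> Poly_Mapping.lookup m' v = 0" if "v \<notin> V" for v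
      using m that by (auto simp: box_def in_keys_iff)
    ultimately show "m = m'" using eq by (intro poly_mapping_eqI) (metis DiffI singletonD)
  qed
  moreover have sub: "\<rho> ` box N \<subseteq> (V - {r}) \<rightarrow>\<^sub>E {..N}" 
    unfolding \<rho>_def by (intro image_subsetI) (simp add: restrict_PiE_iff box_def)
  moreover have fin: "finite ((V - {r}) \<rightarrow>\<^sub>E {..N})" using finite_V by (intro finite_PiE) auto
  ultimately have "finite (box N)" "card (box N) \<le> card ((V - {r}) \<rightarrow>\<^sub>E {..N})"
    by (auto intro: inj_on_finite card_inj_on_le)
  moreover have "card ((V - {r}) \<rightarrow>\<^sub>E {..N}) = (N + 1) ^ (card V - 1)"
    using r finite_V by (simp add: card_PiE V_def)
  ultimately show ?thesis by simp
qed

text \<open>A chain of length \<open>n\<close> gives \<open>(m + 1) ^ n\<close> independent products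
  of powers, one for each list of exponents up to \<open>m\<close>. Their monomials lie in a box of
  side linear in \<open>m\<close>, with at most \<open>(n * m * b + 1) ^ (card V - 1)\<close>
  points; letting \<open>m\<close> grow compares the exponents.\<close>

lemma krull_dim_upper:
  fixes k :: "'k::field itself"
  assumes P: "\<And>i. i \<le> n \<Longrightarrow> primeideal (P i) (edge_ring k (V, E))" "\<And>i. i < n \<Longrightarrow> P i \<subset> P (Suc i)"
  shows "n \<le> card V - 1"
proof -
  have "\<forall>i. \<exists>x. i < n \<longrightarrow> x \<in> P (Suc i) \<and> x \<notin> P i" using P(2) by blast
  then obtain x where x: "\<And>i. i < n \<Longrightarrow> x i \<in> P (Suc i)" "\<And>i. i < n \<Longrightarrow> x i \<notin> P i" by metis
  have P2: "P i \<subseteq> P (Suc i)" if "i < n" for i using P(2)[OF that] by blast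
  note ctx = P(1) P2 x
  have "\<forall>i. \<exists>N. i < n \<longrightarrow> Poly_Mapping.keys (x i) \<subseteq> box N"
    using edge_ring_keys chain_in_carrier[where P = P and x = x and n = n, OF ctx] by blast
  then obtain N where N: "\<And>i. i < n \<Longrightarrow> Poly_Mapping.keys (x i) \<subseteq> box (N i)" by metis
  define b where "b = (\<Sum>i<n. N i)"
  have xb: "Poly_Mapping.keys (x i) \<subseteq> box b" if "i < n" for i
    using N[OF that] box_mono[of "N i" b] member_le_sum[of i "{..<n}" N] that by (auto simp: b_def)
  have pow: "Poly_Mapping.keys (x i ^ a) \<subseteq> box (a * b)" if "i < n" for i a
  proof (induction a)
    case 0 then show ?case using box_0 by simp
  next
    case (Suc a) then show ?case using keys_mult_box[OF xb[OF that] Suc] by simp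
  qed
  have mon: "Poly_Mapping.keys (chain_monomial x j l) \<subseteq> box (sum_list l * b)" if "j + length l \<le> n" for j l
    using that
  proof (induction l arbitrary: j)
    case Nil then show ?case using box_0 by simp
  next
    case (Cons a l)
    then show ?case using keys_mult_box[OF pow[of j a] Cons.IH[of "Suc j"]] by (simp add: algebra_simps)
  qed
  have "(m + 1) ^ n \<le> ((n * b) * m + 1) ^ (card V - 1)" for m
  proof -
    have "card (exponent_lists m n) \<le> card (box (n * m * b))"
    proof (rule card_independent_family_le)
      show "finite (exponent_lists m n)" by (rule finite_lists_length_eq) simp
      show "finite (box (n * m * b))" using card_box by blast
      fix l assume l: "l \<in> exponent_lists m n"
      have "set l \<subseteq> {..m} \<Longrightarrow> sum_list l \<le> length l * m" by (induction l) auto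
      then have "sum_list l * b \<le> n * m * b" using l by simp
      moreover have "Poly_Mapping.keys (chain_monomial x 0 l) \<subseteq> box (sum_list l * b)" using l by (intro mon) simp
      ultimately show "Poly_Mapping.keys (chain_monomial x 0 l) \<subseteq> box (n * m * b)"
        using box_mono by blast
    next
      fix c :: "nat list \<Rightarrow> 'k" assume "(\<Sum>l\<in>exponent_lists m n. const (c l) * chain_monomial x 0 l) = 0"
      moreover have "0 \<in> P 0" using edge_ring_ideal(2)[OF edge_ring_prime(1)[OF P(1)[of 0]]] by simp
      ultimately show "\<forall>l\<in>exponent_lists m n. c l = 0"
        using chain_independent[where P = P and x = x and n = n, OF ctx, of n 0 c m] by simp
    qed
    also have "\<dots> \<le> (n * m * b + 1) ^ (card V - 1)" using card_box by blast
    finally show ?thesis by (simp add: card_lists_length_eq mult_ac)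
  qed
  then show ?thesis by (rule power_bound_exponent)
qed

text \<open>The sets grow from a single vertex by one neighbour at a time. The edge to the new
  vertex is what will separate consecutive primes.\<close>

lemma growing_connected_sets:
  obtains W where "\<And>i. Suc i < card V \<Longrightarrow> W i \<subseteq> W (Suc i) \<and> (\<exists>x y. {x, y} \<in> E \<and> {x, y} \<subseteq> W (Suc i) \<and> y \<notin> W i)"
proof -
  define P where "P = (\<lambda>n S. S \<subseteq> V \<and> S \<noteq> {} \<and> (n < card V \<longrightarrow> card S = Suc n))"
  define Q where "Q = (\<lambda>n S S'. Suc n < card V \<longrightarrow>
    S \<subseteq> S' \<and> (\<exists>x y. {x, y} \<in> E \<and> {x, y} \<subseteq> S' \<and> y \<notin> S))"
  have "\<exists>f. \<forall>n. P n (f n) \<and> Q n (f n) (f (Suc n))"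
  proof (rule dependent_nat_choice)
    obtain a where "a \<in> V" using A_nonempty by (auto simp: V_def)
    then show "\<exists>S. P 0 S" unfolding P_def by (intro exI[of _ "{a}"]) simp
    fix S n assume S: "P n S"
    show "\<exists>S'. P (Suc n) S' \<and> Q n S S'"
    proof (cases "Suc n < card V")
      case True
      then have "card S = Suc n" "S \<subseteq> V" "S \<noteq> {}" using S by (auto simp: P_def)
      moreover from this have "S \<noteq> V" using True by auto
      ultimately obtain x y where xy: "x \<in> S" "y \<in> V" "y \<notin> S" "{x, y} \<in> E" using bicutD[OF connected, of S] by auto
      have "finite S" using \<open>S \<subseteq> V\<close> finite_V finite_subset by blast
      then have "P (Suc n) (insert y S)" using xy \<open>S \<subseteq> V\<close> \<open>card S = Suc n\<close> by (simp add: P_def)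
      moreover have "Q n S (insert y S)" using xy by (auto simp: Q_def)
      ultimately show ?thesis by blast
    next
      case False
      then show ?thesis using S by (intro exI[of _ S]) (auto simp: P_def Q_def)
    qed
  qed
  then obtain f where "\<forall>n. P n (f n) \<and> Q n (f n) (f (Suc n))" by blast
  then show ?thesis by (intro that[of f]) (simp add: Q_def)
qed

text \<open>The monomial of the edge \<open>{x, y}\<close> involves a vertex outside
  \<open>W\<close> but none outside \<open>W'\<close>.\<close>

lemma coordinate_prime_strict:
  assumes "W \<subseteq> W'" "{x, y} \<in> E" "{x, y} \<subseteq> W'" "y \<notin> W"
  shows "coordinate_prime k (V, E) W' \<subset> coordinate_prime k (V, E) W"
proof
  show "coordinate_prime k (V, E) W' \<subseteq> coordinate_prime k (V, E) W"
    using assms(1) by (auto simp: coordinate_prime_def avoids_def)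
  have fin: "finite {x, y}" by simp
  have keys: "Poly_Mapping.keys (exponent {x, y}) = {x, y}"
    by (auto simp: in_keys_iff lookup_exponent[OF fin] split: if_splits)
  have "edge_mono {x, y} \<in> coordinate_prime k (V, E) W" "edge_mono {x, y} \<notin> coordinate_prime k (V, E) W'"
    using assms edge_ring_edge_mono[of "{x, y}" "(V, E)" k]
    by (simp_all add: coordinate_prime_def avoids_def edge_mono_exponent keys)
  then show "coordinate_prime k (V, E) W' \<noteq> coordinate_prime k (V, E) W" by blast
qed

end

theorem krull_dim_edge_ring:
  fixes A B :: "'v::linorder set" and k :: "'k::field itself"
  assumes "connected_bipartite A B E"
  shows "krull_dim (edge_ring k (A \<union> B, E)) = enat (card (A \<union> B) - 1)"
proof -
  interpret connected_bipartite A B E by fact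
  obtain W where W: "\<And>i. Suc i < card V \<Longrightarrow> W i \<subseteq> W (Suc i) \<and> (\<exists>x y. {x, y} \<in> E \<and> {x, y} \<subseteq> W (Suc i) \<and> y \<notin> W i)"
    by (rule growing_connected_sets) blast
  define D where "D = card V - 1"
  \<comment> \<open>The primes shrink as the vertex sets grow, so the sets are traversed
    backwards.\<close>
  define P where "P = (\<lambda>i. coordinate_prime k (V, E) (W (D - i)))"
  have "P i \<subset> P (Suc i)" if "i < D" for i
  proof -
    have D: "D - i = Suc (D - Suc i)" "Suc (D - Suc i) < card V" using that by (auto simp: D_def)
    obtain x y where "{x, y} \<in> E" "{x, y} \<subseteq> W (D - i)" "y \<notin> W (D - Suc i)"
      using W[OF D(2)] unfolding D(1)[symmetric] by auto
    moreover have "W (D - Suc i) \<subseteq> W (D - i)" using W[OF D(2)] unfolding D(1)[symmetric] by auto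
    ultimately show ?thesis unfolding P_def by (intro coordinate_prime_strict)
  qed
  moreover have "primeideal (P i) (edge_ring k (V, E))" for i
    unfolding P_def by (rule primeideal_coordinate_prime)
  ultimately have low: "enat D \<in> {enat n |n. \<exists>P :: nat \<Rightarrow> ('v, 'k) mpoly set.
     (\<forall>i\<le>n. primeideal (P i) (edge_ring k (V, E))) \<and> (\<forall>i<n. P i \<subset> P (Suc i))}"
    by (intro CollectI exI[of _ D] exI[of _ P] conjI allI impI refl) auto
  have "krull_dim (edge_ring k (V, E)) = enat D"
    unfolding krull_dim_def
  proof (rule antisym[OF Sup_least Sup_upper[OF low]])
    fix z assume "z \<in> {enat n |n. \<exists>P :: nat \<Rightarrow> ('v, 'k) mpoly set.
     (\<forall>i\<le>n. primeideal (P i) (edge_ring k (V, E))) \<and> (\<forall>i<n. P i \<subset> P (Suc i))}"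
    then obtain n P where "z = enat n" "\<forall>i\<le>n. primeideal (P i) (edge_ring k (V, E))" "\<forall>i<n. P i \<subset> P (Suc i)"
      by blast
    then show "z \<le> enat D" using krull_dim_upper[of n P k] by (simp add: D_def)
  qed
  then show ?thesis by (simp add: V_def D_def)
qed

section \<open>The Hilbert series\<close>

context connected_bipartite begin

text \<open>Products of edge monomials are single monomials, so the dimension is the number of
  distinct exponents. Hall's theorem identifies these with the Hall vectors on level
  \<open>n\<close>, which the inward push leaves unchanged as a set.\<close>

lemma edge_ring_grade_dim:
  fixes k :: "'k::field itself"
  shows "vector_space.dim (scale_mpoly :: 'k \<Rightarrow> ('v, 'k) mpoly \<Rightarrow> ('v, 'k) mpoly) (edge_ring_grade k (V, E) n) =
    card (shifted_points 1 n)"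
proof -
  interpret vs: vector_space "scale_mpoly :: 'k \<Rightarrow> ('v, 'k) mpoly \<Rightarrow> ('v, 'k) mpoly" by (rule vector_space_scale_mpoly)
  define M where "M = {sum_list (map exponent es) |es. set es \<subseteq> E \<and> length es = n}"
  have mono: "prod_list (map edge_mono es) = Poly_Mapping.single (sum_list (map exponent es)) (1::'k)"
    if "set es \<subseteq> E" for es
    using that finite_edge by (intro prod_list_edge_mono) auto
  have "{prod_list (map edge_mono es) |es. set es \<subseteq> E \<and> length es = n} =
      (\<lambda>m. Poly_Mapping.single m (1::'k)) ` M"
  proof (intro equalityI subsetI)
    fix p :: "('v, 'k) mpoly" assume "p \<in> {prod_list (map edge_mono es) |es. set es \<subseteq> E \<and> length es = n}"
    then obtain es where "p = prod_list (map edge_mono es)" "set es \<subseteq> E" "length es = n" by blast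
    then show "p \<in> (\<lambda>m. Poly_Mapping.single m 1) ` M" using mono unfolding M_def by blast
  next
    fix p :: "('v, 'k) mpoly" assume "p \<in> (\<lambda>m. Poly_Mapping.single m 1) ` M"
    then obtain es where "p = Poly_Mapping.single (sum_list (map exponent es)) 1" "set es \<subseteq> E" "length es = n"
      unfolding M_def by blast
    then show "p \<in> {prod_list (map edge_mono es) |es. set es \<subseteq> E \<and> length es = n}"
      using mono[of es] by (intro CollectI exI[of _ es]) simp
  qed
  then have "vs.dim (edge_ring_grade k (V, E) n) = card ((\<lambda>m. Poly_Mapping.single m (1::'k)) ` M)"
    unfolding edge_ring_grade_def using vs.dim_span_eq_card_independent[OF independent_singles] by simp
  also have "\<dots> = card M"
  proof (intro card_image inj_onI)
    fix m m' :: "'v \<Rightarrow>\<^sub>0 nat"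
    assume "Poly_Mapping.single m (1::'k) = Poly_Mapping.single m' 1"
    then have "Poly_Mapping.keys (Poly_Mapping.single m (1::'k)) = Poly_Mapping.keys (Poly_Mapping.single m' (1::'k))"
      by (rule arg_cong)
    then show "m = m'" by simp
  qed
  also have "\<dots> = card (shifted_points 1 n)"
  proof (rule bij_betw_same_card)
    show "bij_betw (\<lambda>m v. int (Poly_Mapping.lookup m v)) M (shifted_points 1 n)"
      unfolding bij_betw_def
    proof
      show "inj_on (\<lambda>m v. int (Poly_Mapping.lookup m v)) M"
        by (rule inj_onI, rule poly_mapping_eqI) (metis of_nat_eq_iff)
      show "(\<lambda>m v. int (Poly_Mapping.lookup m v)) ` M = shifted_points 1 n"
      proof (intro equalityI subsetI)
        fix p assume "p \<in> (\<lambda>m v. int (Poly_Mapping.lookup m v)) ` M"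
        then obtain es where es: "set es \<subseteq> E" "length es = n"
          "p = (\<lambda>v. int (Poly_Mapping.lookup (sum_list (map exponent es)) v))" by (auto simp: M_def)
        have p: "p = deg (\<lambda>e. int (count_list es e))"
          unfolding es(3) using lookup_sum_list_exponent[OF es(1)] by blast
        have "hall p" unfolding p by (rule flow_hall) simp
        moreover have "sum p A = int n" unfolding p deg_level using sum_count_list_E[OF es(1)] es(2) by simp
        ultimately show "p \<in> shifted_points 1 n"
          using hall_shifted_plus[of p] bal_deg deg_outside by (simp add: shifted_points_def p)
      next
        fix p assume "p \<in> shifted_points 1 n"
        then have p: "\<And>v. v \<notin> V \<Longrightarrow> p v = 0" "hall p" "sum p A = int n"
          using hall_shifted_plus[of p] by (auto simp: shifted_points_def)
        obtain f where f: "\<And>e. e \<in> E \<Longrightarrow> f e \<ge> 0" "\<And>e. e \<notin> E \<Longrightarrow> f e = 0" "\<And>v. v \<in> V \<Longrightarrow> deg f v = p v"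
          using p(2) by (rule hall_flow) blast
        have dp: "deg f = p"
        proof
          show "deg f v = p v" for v using f(3) p(1) deg_outside by (cases "v \<in> V") auto
        qed
        then have "sum f E = int n" using p(3) deg_level[of f] by simp
        then obtain es where es: "set es \<subseteq> E" "length es = n" "\<forall>e\<in>E. int (count_list es e) = f e"
          using flow_as_list[of f n] f(1) by blast
        have "int (Poly_Mapping.lookup (sum_list (map exponent es)) v) = p v" for v
          using deg_cong[of "\<lambda>e. int (count_list es e)" f v] es(3) dp
          by (simp add: lookup_sum_list_exponent[OF es(1)])
        then have "p = (\<lambda>v. int (Poly_Mapping.lookup (sum_list (map exponent es)) v))" by auto
        then show "p \<in> (\<lambda>m v. int (Poly_Mapping.lookup m v)) ` M" using es(1,2) by (auto simp: M_def)
      qed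
    qed
  qed
  finally show ?thesis .
qed

text \<open>The denominator is an invertible power series, so the numerator is determined and the
  existential quantifier over \<open>h\<close> in \<open>pseudo_gorenstein\<close> has a single
  candidate.\<close>

lemma hilbert_series_edge_ring:
  fixes k :: "'k::field itself"
  shows "hilbert_series (scale_mpoly :: 'k \<Rightarrow> ('v, 'k) mpoly \<Rightarrow> _) (edge_ring_grade k (V, E)) =
    fps_of_poly h / (1 - fps_X) ^ (card V - 1) \<longleftrightarrow> h = h_poly"
proof -
  define F :: "rat fps" where "F = Abs_fps (\<lambda>n. of_nat (card (shifted_points 1 n)))"
  define g :: "rat fps" where "g = (1 - fps_X) ^ (card V - 1)"
  have g0: "g $ 0 \<noteq> 0" by (simp add: g_def fps_nth_power_0)
  have div: "fps_of_poly h / g = fps_of_poly h * inverse g" by (rule fps_divide_unit[OF g0])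
  have Fg: "F * g = fps_of_poly h_poly" using fps_shifted_points by (simp add: F_def g_def)
  have "F = fps_of_poly h * inverse g \<longleftrightarrow> F * g = fps_of_poly h"
  proof
    assume "F = fps_of_poly h * inverse g"
    then show "F * g = fps_of_poly h" by (simp add: mult.assoc inverse_mult_eq_1[OF g0])
  next
    assume "F * g = fps_of_poly h"
    then have "fps_of_poly h * inverse g = F * (g * inverse g)" by (simp add: mult.assoc)
    then show "F = fps_of_poly h * inverse g" by (simp add: inverse_mult_eq_1'[OF g0])
  qed
  then show ?thesis unfolding hilbert_series_def edge_ring_grade_dim F_def[symmetric] g_def[symmetric] div Fg
    by (auto simp: fps_of_poly_eq_iff)
qed

end

theorem pseudo_gorenstein_edge_ring:
  fixes A B :: "'v::linorder set" and k :: "'k::field itself"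
  assumes "connected_bipartite A B E"
  shows "pseudo_gorenstein scale_mpoly (edge_ring k (A \<union> B, E)) (edge_ring_grade k (A \<union> B, E)) \<longleftrightarrow>
    lead_coeff (connected_bipartite.h_poly A B E) = 1"
proof -
  interpret connected_bipartite A B E by fact
  show ?thesis unfolding pseudo_gorenstein_def krull_dim_edge_ring[OF assms]
    using hilbert_series_edge_ring[where k = k] unfolding V_def by auto
qed

section \<open>From reachability in the graph to conditions on cuts\<close>

lemma connected_graph_cut:
  assumes conn: "connected_graph H" and E: "\<And>e. e \<in> edges H \<Longrightarrow> e \<subseteq> verts H"
    and K: "K \<subseteq> verts H" "K \<noteq> {}" "K \<noteq> verts H"
  shows "\<exists>x\<in>K. \<exists>y\<in>verts H - K. {x, y} \<in> edges H"
proof (rule ccontr)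
  assume no: "\<not> ?thesis"
  obtain u v where uv: "u \<in> K" "v \<in> verts H - K" using K by blast
  have "(u, v) \<in> {(x, y). {x, y} \<in> edges H}\<^sup>*" using conn uv K(1) by (auto simp: connected_graph_def)
  then have "v \<in> K"
  proof (induction rule: rtrancl_induct)
    case base show ?case by (rule uv(1))
  next
    case (step y z) then show ?case using no E[of "{y, z}"] by auto
  qed
  then show False using uv(2) by simp
qed

theorem theorem3p6:
  fixes G :: "nat graph"
  assumes "simple_graph G"
    and "card (verts G) \<ge> 3"
    and "two_connected G"
    and "bipartite G"
  shows "(pseudo_gorenstein scale_mpoly
            (edge_ring TYPE('k::{alg_closed_field, field_char_0}) G)
            (edge_ring_grade TYPE('k) G)
          \<longleftrightarrow> phi G = 1)
       \<and> (phi G = 1 \<longleftrightarrow> matching_covered G)"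
proof -
  obtain A B where AB: "A \<union> B = verts G" "A \<inter> B = {}" "\<forall>e\<in>edges G. \<exists>a\<in>A. \<exists>b\<in>B. e = {a, b}"
    using assms(4) unfolding bipartite_def by auto
  have fin: "finite A" "finite B" using assms(1) AB(1) by (auto simp: simple_graph_def intro: finite_subset)
  have sub: "e \<subseteq> verts G" if "e \<in> edges G" for e using assms(1) that by (simp add: simple_graph_def)
  interpret bipartite_sets A B "edges G" by unfold_locales (use fin AB in auto)
  have V: "V = verts G" using AB(1) by (simp add: V_def)
  have conn: "connected_graph G" using assms(3) by (simp add: two_connected_def)
  have cut: "bicut (edges G) V" unfolding bicut_def V using connected_graph_cut[OF conn sub] by blast
  have "\<exists>u w. u \<in> verts G \<and> w \<in> verts G \<and> u \<noteq> w"
  proof (rule ccontr)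
    assume "\<not> ?thesis"
    then have "card (verts G) \<le> 1" using finite_V unfolding V by (auto simp: card_le_Suc0_iff_eq)
    then show False using assms(2) by simp
  qed
  then obtain u w where "u \<in> verts G" "w \<in> verts G" "u \<noteq> w" by blast
  then have "{u} \<subseteq> verts G" "{u} \<noteq> {}" "{u} \<noteq> verts G" by auto
  then obtain y where "{u, y} \<in> edges G" using connected_graph_cut[OF conn sub] by blast
  then have ne: "A \<noteq> {}" "B \<noteq> {}" using AB(3) by blast+
  have cut2: "bicut (edges G) (V - {v})" if v: "v \<in> V" for v
  proof -
    have c: "connected_graph (delete_vertex G v)" using assms(3) v by (simp add: two_connected_def V)
    have s: "e \<subseteq> verts (delete_vertex G v)" if "e \<in> edges (delete_vertex G v)" for e
      using that sub by (auto simp: delete_vertex_def)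
    have d: "verts (delete_vertex G v) = V - {v}" "edges (delete_vertex G v) \<subseteq> edges G"
      by (auto simp: delete_vertex_def V)
    show ?thesis unfolding bicut_def
    proof (intro allI impI)
      fix K assume "K \<subseteq> V - {v} \<and> K \<noteq> {} \<and> K \<noteq> V - {v}"
      then obtain x y where "x \<in> K" "y \<in> V - {v} - K" "{x, y} \<in> edges (delete_vertex G v)"
        using connected_graph_cut[OF c s, of K] unfolding d(1) by blast
      then show "\<exists>x\<in>K. \<exists>y\<in>V - {v} - K. {x, y} \<in> edges G" using d(2) by blast
    qed
  qed
  interpret two_connected_bipartite A B "edges G"
    by unfold_locales (use cut ne cut2 assms(2) V in auto)
  have G: "(V, edges G) = G" "(A \<union> B, edges G) = G" using V AB(1) by (auto simp: prod_eq_iff)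
  have "pseudo_gorenstein scale_mpoly (edge_ring TYPE('k) G) (edge_ring_grade TYPE('k) G) \<longleftrightarrow> matching_covered G"
    using pseudo_gorenstein_edge_ring[OF connected_bipartite_axioms, of "TYPE('k)"]
      lead_coeff_iff_matching_covered conn by (simp add: G)
  then show ?thesis using phi_iff_matching_covered conn by (simp add: G)
qed

end
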